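(* Let $d\ge 0$ be an integer, let $F\in\mathbb{R}[X,Y]_d$ be a nonzero real homogeneous form of degree $d$, and let $s=s(F)$ be its Sperner number. Then the following two equivalences hold. (1) The Toeplitz matrix $\phi^{s-1}_d(F)$ is totally positive if and only if $H^F_i(X,Y)>0$ for all real $X\ge 0$, $Y\ge 0$ with $(X,Y)\ne(0,0)$ and all integers $0\le i\le s-1$. (2) The Toeplitz matrix $\phi^{s-1}_d(F)$ is totally nonnegative if and only if $H^F_i(X,Y)>0$ for all real $X>0$, $Y>0$ and all integers $0\le i\le s-1$.
   Context: $\mathbb{R}[X,Y]_d$ is the space of real homogeneous polynomials of degree $d$ in $X,Y$. Sperner number: let $R=\mathbb{R}[x,y]$ (standard grading) act on $\mathbb{R}[X,Y]$ by partial differentiation, $x\circ F=\partial F/\partial X$, $y\circ F=\partial F/\partial Y$. Put $\operatorname{Ann}(F)=\{f\in R: f\circ F=0\}$, a homogeneous ideal, and $A_F=R/\operatorname{Ann}(F)$, a graded algebra with graded components $(A_F)_i$. The Sperner number is $s(F)=\max\{\dim_{\mathbb{R}}(A_F)_i : 0\le i\le d\}$. (One has $s(F)-1\le\lfloor d/2\rfloor$.) Toeplitz matrix: write $F=\sum_{k=0}^d\binom{d}{k}c_kX^kY^{d-k}$. For $0\le i\le d$, $\phi^i_d(F)$ is the $(i+1)\times(d-i+1)$ matrix $\left(c_{i+q-p}\right)_{0\le p\le i,\ 0\le q\le d-i}$. Higher Hessian polynomial: for $0\le i\le\lfloor d/2\rfloor$, $$H^F_i(X,Y)=(-1)^{\lfloor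 (i+1)/2\rfloor}\det\left(\frac{\partial^{2i}F}{\partial X^{p+q}\,\partial Y^{2i-p-q}}\right)_{0\le p,q\le i}.$$ In particular $H^F_0=F$. A real matrix is totally positive (respectively totally nonnegative) if all of its minors, of all sizes, are positive (respectively nonnegative). *)

theory Defs
  imports
    "HOL-Algebra.QuotRing"
    "HOL-Algebra.Embedded_Algebras"
    "HOL-Computational_Algebra.Polynomial"
    "Jordan_Normal_Form.Determinant"
    "Jordan_Normal_Form.DL_Submatrix"
begin

text \<open>
  A real polynomial in \<open>X, Y\<close> is an element of \<open>\<real>[X][Y]\<close>: the outer variable is \<open>Y\<close>,
  the inner one is \<open>X\<close>. The type also serves as the ring \<open>\<real>[x,y]\<close> of differential operators.
\<close>

type_synonym bipoly = "real poly poly"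

definition bicoeff :: "bipoly \<Rightarrow> nat \<Rightarrow> nat \<Rightarrow> real" where
  \<comment> \<open>coefficient of \<open>X\<^sup>a Y\<^sup>b\<close>\<close>
  "bicoeff F a b = coeff (coeff F b) a"

definition bieval :: "bipoly \<Rightarrow> real \<Rightarrow> real \<Rightarrow> real" where
  "bieval F X Y = poly (poly F [:Y:]) X"

definition forms :: "nat \<Rightarrow> bipoly set" where
  "forms d = {F. \<forall>a b. bicoeff F a b \<noteq> 0 \<longrightarrow> a + b = d}"

definition dX :: "bipoly \<Rightarrow> bipoly" where
  "dX F = map_poly pderiv F"

definition dY :: "bipoly \<Rightarrow> bipoly" where
  "dY F = pderiv F"

definition diff_act :: "bipoly \<Rightarrow> bipoly \<Rightarrow> bipoly" where
  \<comment> \<open>\<open>f \<circ> F\<close>, where \<open>x\<close> acts as \<open>\<partial>/\<partial>X\<close> and \<open>y\<close> as \<open>\<partial>/\<partial>Y\<close>\<close>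
  "diff_act f F =
     (\<Sum>b\<le>degree f. \<Sum>a\<le>degree (coeff f b).
        smult [:bicoeff f a b:] ((dX ^^ a) ((dY ^^ b) F)))"

definition bipoly_ring :: "bipoly ring" where
  "bipoly_ring = \<lparr>carrier = UNIV, monoid.mult = (*), one = 1, zero = 0, add = (+)\<rparr>"

definition Ann :: "bipoly \<Rightarrow> bipoly set" where
  "Ann F = {f. diff_act f F = 0}"

definition apolar_algebra :: "bipoly \<Rightarrow> bipoly set ring" where
  "apolar_algebra F = bipoly_ring Quot Ann F"

definition apolar_scalars :: "bipoly \<Rightarrow> bipoly set set" where
  \<comment> \<open>the image of \<open>\<real>\<close> under the structure map of the \<open>\<real>\<close>-algebra \<open>apolar_algebra F\<close>\<close>
  "apolar_scalars F = (\<lambda>c. Ann F +>\<^bsub>bipoly_ring\<^esub> [:[:c:]:]) ` (UNIV :: real set)"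

definition apolar_component :: "bipoly \<Rightarrow> nat \<Rightarrow> bipoly set set" where
  "apolar_component F i = (\<lambda>f. Ann F +>\<^bsub>bipoly_ring\<^esub> f) ` forms i"

definition sperner :: "nat \<Rightarrow> bipoly \<Rightarrow> nat" where
  "sperner d F = Max ((\<lambda>i. ring.dim (apolar_algebra F) (apolar_scalars F) (apolar_component F i)) ` {0..d})"

definition normalized_coeff :: "nat \<Rightarrow> bipoly \<Rightarrow> nat \<Rightarrow> real" where
  \<comment> \<open>the \<open>c\<^sub>k\<close> in \<open>F = (\<Sum>k\<le>d. (d choose k) c\<^sub>k X\<^sup>k Y\<^sup>d\<^sup>-\<^sup>k)\<close>\<close>
  "normalized_coeff d F k = bicoeff F k (d - k) / real (d choose k)"

definition toeplitz :: "nat \<Rightarrow> nat \<Rightarrow> bipoly \<Rightarrow> real mat" where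
  "toeplitz d i F = mat (i + 1) (d - i + 1) (\<lambda>(p, q). normalized_coeff d F (i + q - p))"

definition hess :: "bipoly \<Rightarrow> nat \<Rightarrow> bipoly" where
  "hess F i = (- 1) ^ ((i + 1) div 2) *
     det (mat (i + 1) (i + 1) (\<lambda>(p, q). (dX ^^ (p + q)) ((dY ^^ (2 * i - p - q)) F)))"

definition totally_positive :: "real mat \<Rightarrow> bool" where
  "totally_positive M \<longleftrightarrow>
     (\<forall>I J. I \<subseteq> {..<dim_row M} \<and> J \<subseteq> {..<dim_col M} \<and> card I = card J \<and> I \<noteq> {}
        \<longrightarrow> det (submatrix M I J) > 0)"

definition totally_nonnegative :: "real mat \<Rightarrow> bool" where
  "totally_nonnegative M \<longleftrightarrow>
     (\<forall>I J. I \<subseteq> {..<dim_row M} \<and> J \<subseteq> {..<dim_col M} \<and> card I = card J \<and> I \<noteq> {}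
        \<longrightarrow> det (submatrix M I J) \<ge> 0)"

end

theory Submission
  imports Defs
begin

text \<open>
  Let \<open>c\<^sub>0, \<dots>, c\<^sub>d\<close> be the normalized coefficients of \<open>F\<close>, and let \<open>\<Lambda>\<close> be the linear functional on
  univariate polynomials with \<open>\<Lambda>(x\<^sup>k) = c\<^sub>k\<close>.  Differentiating \<open>F\<close> shows that \<open>H\<^sub>i(X, Y)\<close> is, up to a
  positive constant, the determinant of the bilinear form \<open>(u, v) \<mapsto> \<Lambda>(l\<^sup>n u v)\<close> on polynomials of
  degree at most \<open>i\<close>, where \<open>l = X x + Y\<close> and \<open>n = d - 2 i\<close> (lemma \<open>bieval_hess\<close>).  The sign in the
  definition of \<open>H\<^sub>i\<close> is the one that turns the Hankel matrix of this form into a Toeplitz matrix.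

  From Toeplitz minors to Hessians: the Toeplitz matrix is the pairing \<open>\<Lambda>(u v)\<close> of
  polynomials of degree \<open>s - 1\<close> with polynomials of degree \<open>d - s + 1\<close>.  Replacing the monomials on
  either side by multiples of a power of \<open>l\<close>, one factor \<open>l\<close> at a time, multiplies the matrix by
  bidiagonal matrices with the entries \<open>X, Y \<ge> 0\<close>.  Expanding minors column by column shows that
  this preserves their signs.  After enough factors a single minor of order \<open>i + 1\<close> is left, and it is
  the determinant above.  In the totally nonnegative case it is positive for \<open>X, Y > 0\<close> because the
  matrix that one starts from has rank \<open>s\<close>.

  From Hessians to Toeplitz minors: for \<open>0 \<le> t < 1\<close> expand \<open>F\<close> in coordinates adapted to the cone
  spanned by \<open>x + t\<close> and \<open>t x + 1\<close>.  Up to a positive factor the contiguous minors of the new Toeplitz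
  matrices are the determinants of \<open>\<Lambda>((x + t)\<^sup>a (t x + 1)\<^sup>b u v)\<close> with \<open>a + b = n\<close>.  At \<open>t = 1\<close> these
  determinants are positive multiples of \<open>H\<^sub>i(1, 1)\<close>, hence positive.  Suppose that one of them
  becomes zero as \<open>t\<close> decreases, and take the first \<open>t\<close> at which this happens.  Before it
  Fekete's criterion makes all minors positive, so at this \<open>t\<close> all minors are nonnegative.  The
  corner minors there are positive multiples of values of \<open>H\<^sub>i\<close> on the two edges of the cone, hence
  still positive.  Lemma \<open>toeplitz_det_pos_of_corners\<close> then forces every contiguous minor to be
  positive, a contradiction.  So the cone can be opened up to the whole quadrant, where the
  coordinates are the original ones; if the hypothesis holds only in the open quadrant, total
  nonnegativity follows by passing to the limit \<open>t = 0\<close>.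

  The Sperner number enters through linear recurrences.  A form of degree \<open>m\<close> annihilates \<open>F\<close> exactly
  if its coefficients are those of a recurrence of length \<open>m\<close> for \<open>c\<close>, and \<open>s\<close> is the least \<open>m\<close> for
  which all components of the apolar algebra have dimension at most \<open>m\<close>.  Hence \<open>c\<close> has a
  recurrence of length \<open>s\<close> when \<open>s \<le> d\<close>, which carries nonvanishing from one contiguous minor of
  order \<open>s\<close> to the next, and none of length \<open>s - 1\<close>, which gives the rank \<open>s\<close> and the bound
  \<open>2 (s - 1) \<le> d\<close>.
\<close>

section \<open>Determinants of lists of columns\<close>

text \<open>
  A list of functions serves as a list of column vectors, and only their first entries, as many as
  the list is long, matter.  So vectors need not be truncated when a column is added or removed.
\<close>

definition col_det :: "(nat \<Rightarrow> 'a::comm_ring_1) list \<Rightarrow> 'a" where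
  "col_det cs = det (mat (length cs) (length cs) (\<lambda>(p, q). (cs ! q) p))"

lemma col_det_cong:
  assumes "length cs = length ds"
    and "\<And>p q. p < length cs \<Longrightarrow> q < length cs \<Longrightarrow> (cs ! q) p = (ds ! q) p"
  shows "col_det cs = col_det ds"
  unfolding col_det_def by (rule arg_cong[where f = det]) (rule eq_matI, auto simp: assms)

text \<open>
  Laplace expansion along one column: the coefficients \<open>w\<close> are the cofactors.  Without naming them,
  this says that the determinant is a linear functional of that column.
\<close>

lemma col_det_expand:
  "\<exists>w. \<forall>u::nat \<Rightarrow> 'a::comm_ring_1. col_det (xs @ u # ys) = (\<Sum>p<length xs + Suc (length ys). u p * w p)"
proof -
  let ?n = "length xs + Suc (length ys)"
  let ?M = "\<lambda>u::nat \<Rightarrow> 'a. mat ?n ?n (\<lambda>(p, q). ((xs @ u # ys) ! q) p)"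
  let ?w = "\<lambda>p. cofactor (?M (\<lambda>_. 0)) p (length xs)"
  have "col_det (xs @ u # ys) = (\<Sum>p<?n. u p * ?w p)" for u :: "nat \<Rightarrow> 'a"
  proof -
    have "col_det (xs @ u # ys) = (\<Sum>p<?n. ?M u $$ (p, length xs) * cofactor (?M u) p (length xs))"
      using laplace_expansion_column[of "?M u" ?n "length xs"] unfolding col_det_def by simp
    also have "\<dots> = (\<Sum>p<?n. u p * ?w p)"
    proof (rule sum.cong)
      fix p assume p: "p \<in> {..<?n}"
      have "mat_delete (?M u) p (length xs) = mat_delete (?M (\<lambda>_. 0)) p (length xs)"
        unfolding mat_delete_def by (rule eq_matI) (auto simp: nth_append)
      then show "?M u $$ (p, length xs) * cofactor (?M u) p (length xs) = u p * ?w p"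
        using p unfolding cofactor_def by simp
    qed simp
    finally show ?thesis .
  qed
  then show ?thesis by (intro exI[of _ ?w]) blast
qed

lemma col_det_linear:
  "col_det (xs @ (\<lambda>p. a * u p + b * v p) # ys) = a * col_det (xs @ u # ys) + b * col_det (xs @ v # ys)"
proof -
  obtain w where "\<forall>u. col_det (xs @ u # ys) = (\<Sum>p<length xs + Suc (length ys). u p * w p)"
    using col_det_expand by blast
  then show ?thesis
    by (simp add: sum_distrib_left sum.distrib[symmetric] algebra_simps)
qed

lemma col_det_repeat:
  assumes "u \<in> set ys"
  shows "col_det (xs @ u # ys) = 0"
proof -
  obtain k where k: "k < length ys" "ys ! k = u" using assms by (auto simp: in_set_conv_nth)
  let ?n = "length (xs @ u # ys)"
  show ?thesis unfolding col_det_def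
    by (rule det_identical_columns[of _ ?n "length xs" "length xs + Suc k"])
      (use k in \<open>auto simp: nth_append intro!: eq_vecI\<close>)
qed

lemma col_det_swap:
  "col_det (xs @ u # v # ys) = - col_det (xs @ v # u # ys)"
proof -
  let ?s = "\<lambda>p. 1 * u p + 1 * v p"
  have "0 = col_det (xs @ ?s # ?s # ys)" by (simp add: col_det_repeat)
  also have "\<dots> = col_det (xs @ u # ?s # ys) + col_det (xs @ v # ?s # ys)"
    using col_det_linear[of xs 1 u 1 v "?s # ys"] by simp
  also have "col_det (xs @ u # ?s # ys) = col_det (xs @ u # u # ys) + col_det (xs @ u # v # ys)"
    using col_det_linear[of "xs @ [u]" 1 u 1 v ys] by simp
  also have "col_det (xs @ v # ?s # ys) = col_det (xs @ v # u # ys) + col_det (xs @ v # v # ys)"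
    using col_det_linear[of "xs @ [v]" 1 u 1 v ys] by simp
  finally show ?thesis by (simp add: col_det_repeat eq_neg_iff_add_eq_0 add.commute)
qed

lemma col_det_move:
  "col_det (zs @ xs @ u # ys) = (- 1) ^ length xs * col_det (zs @ u # xs @ ys)"
proof (induction xs arbitrary: ys rule: rev_induct)
  case (snoc x xs)
  have "col_det (zs @ (xs @ [x]) @ u # ys) = - col_det (zs @ xs @ u # x # ys)"
    using col_det_swap[of "zs @ xs" x u ys] by simp
  also have "\<dots> = - ((- 1) ^ length xs * col_det (zs @ u # xs @ x # ys))"
    using snoc.IH[of "x # ys"] by simp
  finally show ?case by simp
qed simp

text \<open>
  A linear relation between the rows kills the determinant; \<open>col_det_eq_0_obtain\<close> is the
  converse.
\<close>

lemma col_det_eq_0: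
  fixes cs :: "(nat \<Rightarrow> 'a::idom) list"
  assumes "\<And>q. q < length cs \<Longrightarrow> (\<Sum>p<length cs. a p * (cs ! q) p) = 0"
    and "p0 < length cs" "a p0 \<noteq> 0"
  shows "col_det cs = 0"
proof -
  let ?n = "length cs"
  let ?M = "mat ?n ?n (\<lambda>(p, q). (cs ! q) p)"
  have M: "?M\<^sup>T \<in> carrier_mat ?n ?n" by simp
  have "vec ?n a \<noteq> 0\<^sub>v ?n" using assms(2,3) by (metis index_vec index_zero_vec(1))
  moreover have "?M\<^sup>T *\<^sub>v vec ?n a = 0\<^sub>v ?n"
    using assms(1) by (intro eq_vecI) (auto simp: scalar_prod_def atLeast0LessThan mult.commute)
  ultimately have "det ?M\<^sup>T = 0"
    using det_0_iff_vec_prod_zero[OF M] by (auto intro!: exI[of _ "vec ?n a"])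
  then show ?thesis unfolding col_det_def using det_transpose[of ?M ?n] by simp
qed

lemma col_det_eq_0_obtain:
  fixes cs :: "(nat \<Rightarrow> 'a::idom) list"
  assumes "col_det cs = 0"
  obtains a p0 where "p0 < length cs" "a p0 \<noteq> 0"
    "\<And>q. q < length cs \<Longrightarrow> (\<Sum>p<length cs. a p * (cs ! q) p) = 0"
proof -
  let ?n = "length cs"
  let ?M = "mat ?n ?n (\<lambda>(p, q). (cs ! q) p)"
  have M: "?M\<^sup>T \<in> carrier_mat ?n ?n" by simp
  have "det ?M\<^sup>T = 0" using assms unfolding col_det_def using det_transpose[of ?M ?n] by simp
  then obtain v where v: "v \<in> carrier_vec ?n" "v \<noteq> 0\<^sub>v ?n" "?M\<^sup>T *\<^sub>v v = 0\<^sub>v ?n"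
    using det_0_iff_vec_prod_zero[OF M] by auto
  obtain p0 where "p0 < ?n" "v $ p0 \<noteq> 0"
    using v(1,2) by (metis carrier_vecD eq_vecI index_zero_vec(1) index_zero_vec(2))
  moreover have "(\<Sum>p<?n. v $ p * (cs ! q) p) = 0" if "q < ?n" for q
  proof -
    have "(?M\<^sup>T *\<^sub>v v) $ q = 0" using v(3) that by simp
    then show ?thesis using that v(1) by (simp add: scalar_prod_def atLeast0LessThan mult.commute)
  qed
  ultimately show ?thesis using that[of p0 "\<lambda>p. v $ p"] by blast
qed

text \<open>
  The three-term Pluecker relation.  As a function of \<open>t\<close> the left-hand side is linear, and it
  vanishes on \<open>u\<close>, \<open>x\<close>, \<open>y\<close> and on the columns of \<open>W\<close>.  If it is not identically zero, its
  coefficient vector is a row relation for each determinant formed from two of \<open>u, x, y\<close> and \<open>W\<close>, so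
  these determinants vanish and the relation holds anyway.
\<close>

lemma col_det_plucker:
  fixes W :: "(nat \<Rightarrow> 'a::idom) list"
  shows "col_det (t # u # W) * col_det (x # y # W) - col_det (t # x # W) * col_det (u # y # W)
    + col_det (t # y # W) * col_det (u # x # W) = 0" (is "?F t = 0")
proof -
  let ?r = "Suc (Suc (length W))"
  have ex: "\<exists>w. \<forall>t. col_det (t # z # W) = (\<Sum>p<?r. t p * w p)" for z
    using col_det_expand[of "[]" "z # W"] by auto
  obtain wu where wu: "\<And>t. col_det (t # u # W) = (\<Sum>p<?r. t p * wu p)" using ex by blast
  obtain wx where wx: "\<And>t. col_det (t # x # W) = (\<Sum>p<?r. t p * wx p)" using ex by blast
  obtain wy where wy: "\<And>t. col_det (t # y # W) = (\<Sum>p<?r. t p * wy p)" using ex by blast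
  define f where "f p = wu p * col_det (x # y # W) - wx p * col_det (u # y # W) + wy p * col_det (u # x # W)" for p
  have F: "?F t = (\<Sum>p<?r. f p * t p)" for t
    unfolding wu[of t] wx[of t] wy[of t] f_def
    by (simp only: sum_distrib_right sum_subtractf[symmetric] sum.distrib[symmetric])
      (rule sum.cong, auto simp: algebra_simps)
  have rep: "col_det (z # z' # W) = 0" if "z = z' \<or> z \<in> set W" for z z'
    using col_det_repeat[of z "z' # W" "[]"] that by auto
  have sw: "col_det (z # z' # W) = - col_det (z' # z # W)" for z z'
    using col_det_swap[of "[]" z z' W] by simp
  have z: "?F z = 0" if "z \<in> {u, x, y} \<union> set W" for z
    using that by (auto simp: rep sw[of x u] sw[of y u] sw[of y x] algebra_simps)
  have zero: "col_det (a # b # W) = 0" if "p < ?r" "f p \<noteq> 0" "a \<in> {u, x, y}" "b \<in> {u, x, y}" for p a b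
  proof (rule col_det_eq_0[where a = f])
    fix q assume "q < length (a # b # W)"
    then have "(a # b # W) ! q \<in> {u, x, y} \<union> set W"
      using that nth_mem[of q "a # b # W"] by auto
    then show "(\<Sum>p<length (a # b # W). f p * ((a # b # W) ! q) p) = 0"
      using F z by simp
  qed (use that in auto)
  show ?thesis
  proof (cases "\<exists>p<?r. f p \<noteq> 0")
    case True
    then show ?thesis using zero by auto
  next
    case False
    then show ?thesis unfolding F by simp
  qed
qed

text \<open>
  Adjoining a unit column deletes a row.  In this way minors of order one less fit into the Pluecker
  relation.
\<close>

definition unit_col :: "nat \<Rightarrow> nat \<Rightarrow> 'a::comm_ring_1" where
  "unit_col i p = (if p = i then 1 else 0)"

lemma col_det_append_unit_col:
  "col_det (cs @ [unit_col (length cs)]) = col_det cs"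
proof -
  let ?n = "Suc (length cs)"
  let ?M = "mat ?n ?n (\<lambda>(p, q). ((cs @ [unit_col (length cs)]) ! q) p)"
  have "col_det (cs @ [unit_col (length cs)]) = (\<Sum>p<?n. ?M $$ (p, length cs) * cofactor ?M p (length cs))"
    using laplace_expansion_column[of ?M ?n "length cs"] unfolding col_det_def by simp
  also have "\<dots> = cofactor ?M (length cs) (length cs)"
    by (simp add: unit_col_def)
  also have "\<dots> = det (mat_delete ?M (length cs) (length cs))"
    unfolding cofactor_def by simp
  also have "mat_delete ?M (length cs) (length cs) = mat (length cs) (length cs) (\<lambda>(p, q). (cs ! q) p)"
    unfolding mat_delete_def by (rule eq_matI) (auto simp: nth_append)
  finally show ?thesis unfolding col_det_def .
qed

lemma col_det_Cons_unit_col: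
  "col_det (unit_col 0 # cs) = col_det (map (\<lambda>c p. c (Suc p)) cs)"
proof -
  let ?n = "Suc (length cs)"
  let ?M = "mat ?n ?n (\<lambda>(p, q). ((unit_col 0 # cs) ! q) p)"
  have "col_det (unit_col 0 # cs) = (\<Sum>p<?n. ?M $$ (p, 0) * cofactor ?M p 0)"
    using laplace_expansion_column[of ?M ?n 0] unfolding col_det_def by simp
  also have "\<dots> = cofactor ?M 0 0"
    by (subst sum.lessThan_Suc_shift) (simp add: unit_col_def)
  also have "\<dots> = det (mat_delete ?M 0 0)"
    unfolding cofactor_def by simp
  also have "mat_delete ?M 0 0 = mat (length cs) (length cs) (\<lambda>(p, q). (map (\<lambda>c p. c (Suc p)) cs ! q) p)"
    unfolding mat_delete_def by (rule eq_matI) auto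
  finally show ?thesis unfolding col_det_def by simp
qed

definition minor :: "(nat \<Rightarrow> nat \<Rightarrow> 'a::comm_ring_1) \<Rightarrow> nat list \<Rightarrow> nat list \<Rightarrow> 'a" where
  "minor A I J = col_det (map (\<lambda>j p. A (I ! p) j) J)"

lemma minor_transpose:
  assumes "length I = length J"
  shows "minor A I J = minor (\<lambda>i j. A j i) J I"
proof -
  let ?M = "mat (length J) (length J) (\<lambda>(p, q). A (I ! p) (J ! q))"
  have "minor A I J = det ?M"
    unfolding minor_def col_det_def by (rule arg_cong[where f = det]) (rule eq_matI, auto)
  also have "\<dots> = det ?M\<^sup>T" by (rule det_transpose[symmetric]) auto
  also have "\<dots> = minor (\<lambda>i j. A j i) J I"
    unfolding minor_def col_det_def by (rule arg_cong[where f = det]) (rule eq_matI, auto simp: assms)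
  finally show ?thesis .
qed

text \<open>
  Reversing the columns turns Toeplitz into Hankel determinants; the sign is the one in the
  definition of the higher Hessians.
\<close>

lemma col_det_rev:
  "col_det (zs @ rev cs) = (- 1) ^ (length cs div 2) * col_det (zs @ cs)"
proof (induction cs arbitrary: zs)
  case (Cons c cs)
  have sgn: "(- 1 :: 'a) ^ n * (- 1) ^ (n div 2) = (- 1) ^ (Suc n div 2)" for n
  proof (cases "even n")
    case True
    then show ?thesis by simp
  next
    case False
    then have "Suc n div 2 = Suc (n div 2)" by presburger
    then show ?thesis using False by simp
  qed
  have "col_det (zs @ rev (c # cs)) = (- 1) ^ length cs * col_det ((zs @ [c]) @ rev cs)"
    using col_det_move[of zs "rev cs" c "[]"] by simp
  also have "\<dots> = (- 1) ^ length cs * (- 1) ^ (length cs div 2) * col_det (zs @ c # cs)"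
    unfolding Cons.IH by simp
  finally show ?case unfolding sgn by simp
qed simp

lemma col_det_zero_column: "col_det (xs @ (\<lambda>_. 0) # ys) = 0"
  using col_det_linear[of xs 0 "\<lambda>_. 0" 0 "\<lambda>_. 0" ys] by simp

lemma underdetermined_system:
  fixes A :: "nat \<Rightarrow> nat \<Rightarrow> 'a::idom"
  assumes "m < n"
  obtains u k where "k < n" "u k \<noteq> 0" "\<And>j. j < m \<Longrightarrow> (\<Sum>k<n. u k * A k j) = 0"
proof -
  \<comment> \<open>padding the equations with zero columns makes the system square and singular\<close>
  let ?cs = "map (\<lambda>j p. A p j) [0..<m] @ (\<lambda>_. 0) # map (\<lambda>_ _. 0) [Suc m..<n]"
  have len: "length ?cs = n" using assms by simp
  have "col_det ?cs = 0" by (rule col_det_zero_column)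
  then obtain a p0 where a: "p0 < length ?cs" "a p0 \<noteq> 0"
    "\<And>q. q < length ?cs \<Longrightarrow> (\<Sum>p<length ?cs. a p * (?cs ! q) p) = 0"
    by (rule col_det_eq_0_obtain) blast
  have "(\<Sum>k<n. a k * A k j) = 0" if "j < m" for j
    using a(3)[of j] that assms unfolding len by (simp add: nth_append)
  then show ?thesis using that[of p0 a] a(1,2) unfolding len by blast
qed

section \<open>Products with bidiagonal matrices\<close>

text \<open>
  The columns \<open>y v\<^sub>j + x v\<^sub>j\<^sub>+\<^sub>1\<close> come from multiplying by a bidiagonal matrix.  They are introduced
  from left to right: in every intermediate determinant the last new column splits by linearity
  into \<open>v\<^sub>j\<close> and \<open>v\<^sub>j\<^sub>+\<^sub>1\<close>, and the indices stay strictly increasing, except that \<open>v\<^sub>j\<^sub>+\<^sub>1\<close> may collide with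
  the next column and then contributes nothing.
\<close>

lemma bidiagonal_nonneg:
  fixes v :: "nat \<Rightarrow> nat \<Rightarrow> real"
  assumes v: "\<And>J. sorted_wrt (<) J \<Longrightarrow> set J \<subseteq> {..N} \<Longrightarrow> length J = r \<Longrightarrow> col_det (map v J) \<ge> 0"
    and "x \<ge> 0" "y \<ge> 0"
  shows "sorted_wrt (<) (ps @ qs) \<Longrightarrow> set ps \<subseteq> {..<N} \<Longrightarrow> set qs \<subseteq> {..N} \<Longrightarrow> length ps + length qs = r \<Longrightarrow>
    col_det (map (\<lambda>j p. y * v j p + x * v (Suc j) p) ps @ map v qs) \<ge> 0"
proof (induction ps arbitrary: qs rule: rev_induct)
  case Nil
  then show ?case using v by simp
next
  case (snoc j ps)
  let ?w = "\<lambda>j p. y * v j p + x * v (Suc j) p"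
  have eq: "col_det (map ?w (ps @ [j]) @ map v qs)
      = y * col_det (map ?w ps @ map v (j # qs)) + x * col_det (map ?w ps @ map v (Suc j # qs))"
    using col_det_linear[of "map ?w ps" y "v j" x "v (Suc j)" "map v qs"] by simp
  have 1: "col_det (map ?w ps @ map v (j # qs)) \<ge> 0"
    using snoc.prems by (intro snoc.IH) auto
  have 2: "col_det (map ?w ps @ map v (Suc j # qs)) \<ge> 0"
  proof (cases "Suc j \<in> set qs")
    case True
    then show ?thesis using col_det_repeat[of "v (Suc j)" "map v qs" "map ?w ps"] by simp
  next
    case False
    then have "\<forall>q\<in>set qs. Suc j < q"
      using snoc.prems(1) by (auto simp: sorted_wrt_append) (metis Suc_lessI)
    then show ?thesis
      using snoc.prems by (intro snoc.IH) (auto simp: sorted_wrt_append less_SucI)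
  qed
  show ?case unfolding eq using 1 2 assms(2,3) by simp
qed

text \<open>
  Follows one branch of the expansion: \<open>\<delta>\<close> chooses, for each \<open>j\<close>, the column \<open>v\<^sub>j\<close> or \<open>v\<^sub>j\<^sub>+\<^sub>1\<close> in which to
  continue.  If the minor at the end of the branch is positive, then so is the whole sum.
\<close>

lemma bidiagonal_pos:
  fixes v :: "nat \<Rightarrow> nat \<Rightarrow> real"
  assumes v: "\<And>J. sorted_wrt (<) J \<Longrightarrow> set J \<subseteq> {..N} \<Longrightarrow> length J = r \<Longrightarrow> col_det (map v J) \<ge> 0"
    and "x \<ge> 0" "y \<ge> 0"
    and \<delta>: "\<And>j. \<delta> j = j \<and> y > 0 \<or> \<delta> j = Suc j \<and> x > 0"
  shows "sorted_wrt (<) (ps @ qs) \<Longrightarrow> sorted_wrt (<) (map \<delta> ps @ qs) \<Longrightarrow>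
    set ps \<subseteq> {..<N} \<Longrightarrow> set qs \<subseteq> {..N} \<Longrightarrow> length ps + length qs = r \<Longrightarrow>
    col_det (map v (map \<delta> ps @ qs)) > 0 \<Longrightarrow>
    col_det (map (\<lambda>j p. y * v j p + x * v (Suc j) p) ps @ map v qs) > 0"
proof (induction ps arbitrary: qs rule: rev_induct)
  case Nil
  then show ?case by simp
next
  case (snoc j ps)
  let ?w = "\<lambda>j p. y * v j p + x * v (Suc j) p"
  have eq: "col_det (map ?w (ps @ [j]) @ map v qs)
      = y * col_det (map ?w ps @ map v (j # qs)) + x * col_det (map ?w ps @ map v (Suc j # qs))"
    using col_det_linear[of "map ?w ps" y "v j" x "v (Suc j)" "map v qs"] by simp
  have 1: "col_det (map ?w ps @ map v (j # qs)) \<ge> 0"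
    using snoc.prems by (intro bidiagonal_nonneg[OF v assms(2,3)]) auto
  have 2: "col_det (map ?w ps @ map v (Suc j # qs)) \<ge> 0"
  proof (cases "Suc j \<in> set qs")
    case True
    then show ?thesis using col_det_repeat[of "v (Suc j)" "map v qs" "map ?w ps"] by simp
  next
    case False
    then have "\<forall>q\<in>set qs. Suc j < q"
      using snoc.prems(1) by (auto simp: sorted_wrt_append) (metis Suc_lessI)
    then show ?thesis
      using snoc.prems by (intro bidiagonal_nonneg[OF v assms(2,3)]) (auto simp: sorted_wrt_append less_SucI)
  qed
  have "col_det (map ?w ps @ map v (\<delta> j # qs)) > 0"
  proof (rule snoc.IH)
    show "sorted_wrt (<) (ps @ \<delta> j # qs)"
      using snoc.prems(1,2) \<delta>[of j] by (auto simp: sorted_wrt_append less_SucI)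
    show "set (\<delta> j # qs) \<subseteq> {..N}" using snoc.prems(3,4) \<delta>[of j] by auto
  qed (use snoc.prems in auto)
  then show ?case unfolding eq using 1 2 assms(2,3) \<delta>[of j]
    by (auto intro: add_pos_nonneg add_nonneg_pos)
qed

text \<open>
  The given positive minor misses some column \<open>k\<close>.  Move its indices beyond \<open>k\<close> one step down; in the
  expansion of the resulting new minor one branch leads back to the given one.
\<close>

lemma bidiagonal_exists_pos:
  fixes v :: "nat \<Rightarrow> nat \<Rightarrow> real"
  assumes v: "\<And>J. sorted_wrt (<) J \<Longrightarrow> set J \<subseteq> {..N} \<Longrightarrow> length J = r \<Longrightarrow> col_det (map v J) \<ge> 0"
    and "x > 0" "y > 0" "r \<le> N"
    and J: "sorted_wrt (<) J" "set J \<subseteq> {..N}" "length J = r" "col_det (map v J) > 0"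
  shows "\<exists>J'. sorted_wrt (<) J' \<and> set J' \<subseteq> {..<N} \<and> length J' = r \<and>
    col_det (map (\<lambda>j p. y * v j p + x * v (Suc j) p) J') > 0"
proof -
  have "card (set J) = r" using J(1,3) by (metis distinct_card strict_sorted_iff)
  then have "card (set J) < card {..N}" using assms(4) by simp
  then obtain k where k: "k \<le> N" "k \<notin> set J"
    using card_mono[of "set J" "{..N}"] by (metis List.finite_set atMost_iff not_less subsetI)
  define \<delta> where "\<delta> j = (if j < k then j else Suc j)" for j
  define \<gamma> where "\<gamma> j = (if j < k then j else j - 1)" for j
  have \<delta>\<gamma>: "map \<delta> (map \<gamma> J) = J"
    unfolding map_map
  proof (rule map_idI)
    fix j assume "j \<in> set J"
    then have "j \<noteq> k" using k(2) by auto
    then show "(\<delta> \<circ> \<gamma>) j = j" by (auto simp: \<delta>_def \<gamma>_def)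
  qed
  have "\<gamma> i < \<gamma> j" if "i < j" "i \<in> set J" "j \<in> set J" for i j
  proof -
    have "i \<noteq> k" "j \<noteq> k" using that k(2) by metis+
    then show ?thesis using that(1) by (auto simp: \<gamma>_def)
  qed
  then have srt: "sorted_wrt (<) (map \<gamma> J)"
    using J(1) by (auto simp: sorted_wrt_map intro: sorted_wrt_mono_rel[of J "(<)"])
  have sub: "set (map \<gamma> J) \<subseteq> {..<N}"
  proof
    fix i assume "i \<in> set (map \<gamma> J)"
    then obtain j where j: "j \<in> set J" "i = \<gamma> j" by auto
    then have "j \<noteq> k" "j \<le> N" using k(2) J(2) by auto
    then show "i \<in> {..<N}" using k(1) by (auto simp: \<gamma>_def j(2))
  qed
  have "col_det (map (\<lambda>j p. y * v j p + x * v (Suc j) p) (map \<gamma> J) @ map v []) > 0"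
    by (rule bidiagonal_pos[where \<delta> = \<delta> and N = N and r = r and x = x and y = y])
      (use assms(2,3) srt sub J v in \<open>auto simp: \<delta>\<gamma>[unfolded map_map] \<delta>_def\<close>)
  then show ?thesis using srt sub J(3) by (intro exI[of _ "map \<gamma> J"]) simp
qed

lemma sorted_full_interval:
  assumes "sorted_wrt (<) J" "set J \<subseteq> {..<r}" "length J = r"
  shows "J = [0..<r]"
proof (rule strict_sorted_equal)
  have "card (set J) = card {..<r}" using assms(1,3) by (metis card_lessThan distinct_card strict_sorted_iff)
  then have "set J = {..<r}" using assms(2) by (intro card_subset_eq) auto
  then show "set J = set [0..<r]" by (simp only: set_upt atLeast0LessThan)
  show "sorted_wrt (<) [0..<r]" by (rule sorted_wrt_upt)
qed (rule assms(1))

text \<open>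
  Repeated multiplication by bidiagonal matrices; each round uses up one column.
\<close>

locale bidiagonal_iteration =
  fixes v :: "nat \<Rightarrow> nat \<Rightarrow> nat \<Rightarrow> real" and N r :: nat and x y :: real
  assumes step: "\<And>k j p. k + j < N \<Longrightarrow> v (Suc k) j p = y * v k j p + x * v k (Suc j) p"
begin

lemma step_map: "k < N \<Longrightarrow> set J \<subseteq> {..N - Suc k} \<Longrightarrow>
    map (v (Suc k)) J = map (\<lambda>j p. y * v k j p + x * v k (Suc j) p) J"
  using step by fastforce

lemma nonneg:
  assumes base: "\<And>J. sorted_wrt (<) J \<Longrightarrow> set J \<subseteq> {..N} \<Longrightarrow> length J = r \<Longrightarrow> col_det (map (v 0) J) \<ge> 0"
    and "x \<ge> 0" "y \<ge> 0"
  shows "k \<le> N \<Longrightarrow> sorted_wrt (<) J \<Longrightarrow> set J \<subseteq> {..N - k} \<Longrightarrow> length J = r \<Longrightarrow> col_det (map (v k) J) \<ge> 0"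
proof (induction k arbitrary: J)
  case 0
  then show ?case using base by simp
next
  case (Suc k)
  have "col_det (map (\<lambda>j p. y * v k j p + x * v k (Suc j) p) J @ map (v k) []) \<ge> 0"
    by (rule bidiagonal_nonneg[where N = "N - k" and r = r])
      (use Suc assms(2,3) in \<open>auto simp: subset_iff Suc_diff_Suc less_Suc_eq_le\<close>)
  moreover have "map (v (Suc k)) J = map (\<lambda>j p. y * v k j p + x * v k (Suc j) p) J"
    using Suc.prems by (intro step_map) auto
  ultimately show ?case by (simp del: map_eq_conv)
qed

lemma all_pos:
  assumes base: "\<And>J. sorted_wrt (<) J \<Longrightarrow> set J \<subseteq> {..N} \<Longrightarrow> length J = r \<Longrightarrow> col_det (map (v 0) J) > 0"
    and "x \<ge> 0" "y \<ge> 0" "x \<noteq> 0 \<or> y \<noteq> 0"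
  shows "k \<le> N \<Longrightarrow> sorted_wrt (<) J \<Longrightarrow> set J \<subseteq> {..N - k} \<Longrightarrow> length J = r \<Longrightarrow> col_det (map (v k) J) > 0"
proof (induction k arbitrary: J)
  case 0
  then show ?case using base by simp
next
  case (Suc k)
  define \<delta> where "\<delta> j = (if y > 0 then j else Suc j)" for j :: nat
  have J: "\<And>j. j \<in> set J \<Longrightarrow> j < N - k" using Suc.prems by fastforce
  have \<delta>: "sorted_wrt (<) (map \<delta> J)"
    using Suc.prems(2) by (auto simp: sorted_wrt_map \<delta>_def)
  have "col_det (map (v k) (map \<delta> J)) > 0"
    by (rule Suc.IH) (use \<delta> Suc.prems(1,4) J in \<open>auto simp: \<delta>_def dest!: J\<close>)
  then have "col_det (map (\<lambda>j p. y * v k j p + x * v k (Suc j) p) J @ map (v k) []) > 0"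
  proof (intro bidiagonal_pos[where N = "N - k" and r = r and \<delta> = \<delta>])
    show "col_det (map (v k) J) \<ge> 0" if "sorted_wrt (<) J" "set J \<subseteq> {..N - k}" "length J = r" for J
      by (rule less_imp_le[OF Suc.IH]) (use that Suc.prems(1) in simp_all)
    show "set J \<subseteq> {..<N - k}" using J by auto
  qed (use Suc.prems(2,4) \<delta> assms(2-4) in \<open>auto simp: \<delta>_def\<close>)
  moreover have "map (v (Suc k)) J = map (\<lambda>j p. y * v k j p + x * v k (Suc j) p) J"
    using Suc.prems by (intro step_map) auto
  ultimately show ?case by (simp del: map_eq_conv)
qed

lemma exists_pos:
  assumes base: "\<And>J. sorted_wrt (<) J \<Longrightarrow> set J \<subseteq> {..N} \<Longrightarrow> length J = r \<Longrightarrow> col_det (map (v 0) J) \<ge> 0"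
    and ex: "\<exists>J. sorted_wrt (<) J \<and> set J \<subseteq> {..N} \<and> length J = r \<and> col_det (map (v 0) J) > 0"
    and "x > 0" "y > 0" "r \<ge> 1"
  shows "k + r \<le> Suc N \<Longrightarrow> \<exists>J. sorted_wrt (<) J \<and> set J \<subseteq> {..N - k} \<and> length J = r \<and> col_det (map (v k) J) > 0"
proof (induction k)
  case 0
  then show ?case using ex by simp
next
  case (Suc k)
  then obtain J where J: "sorted_wrt (<) J" "set J \<subseteq> {..N - k}" "length J = r" "col_det (map (v k) J) > 0" by auto
  have "\<exists>J'. sorted_wrt (<) J' \<and> set J' \<subseteq> {..<N - k} \<and> length J' = r \<and>
      col_det (map (\<lambda>j p. y * v k j p + x * v k (Suc j) p) J') > 0"
  proof (rule bidiagonal_exists_pos[OF _ assms(3,4) _ J])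
    show "col_det (map (v k) J) \<ge> 0" if "sorted_wrt (<) J" "set J \<subseteq> {..N - k}" "length J = r" for J
      by (rule nonneg[OF base]) (use that assms(3-5) Suc.prems in simp_all)
    show "r \<le> N - k" using Suc.prems by simp
  qed
  then obtain J' where J': "sorted_wrt (<) J'" "set J' \<subseteq> {..<N - k}" "length J' = r"
      "col_det (map (\<lambda>j p. y * v k j p + x * v k (Suc j) p) J') > 0" by blast
  have "set J' \<subseteq> {..N - Suc k}" using J'(2) by fastforce
  moreover from this have "map (v (Suc k)) J' = map (\<lambda>j p. y * v k j p + x * v k (Suc j) p) J'"
    using Suc.prems assms(5) by (intro step_map) auto
  ultimately show ?case using J' by (intro exI[of _ J']) (simp del: map_eq_conv)
qed

end

section \<open>Fekete's criterion\<close>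

text \<open>
  Gives the place at which a new index has to be inserted into an increasing list.
\<close>

lemma strict_sorted_split:
  fixes xs :: "nat list"
  assumes "sorted_wrt (<) xs" "j \<notin> set xs"
  shows "xs = filter (\<lambda>i. i < j) xs @ filter (\<lambda>i. j < i) xs"
proof (rule strict_sorted_equal[OF _ assms(1)])
  show "sorted_wrt (<) (filter (\<lambda>i. i < j) xs @ filter (\<lambda>i. j < i) xs)"
    unfolding sorted_wrt_append using assms(1) by (auto intro: sorted_wrt_filter)
  show "set xs = set (filter (\<lambda>i. i < j) xs @ filter (\<lambda>i. j < i) xs)"
    using assms(2) by auto (metis linorder_neqE_nat)
qed

text \<open>
  If \<open>J\<close> is not an interval, take an index \<open>j\<close> strictly between its first element \<open>a\<close> and its last
  element \<open>b\<close> that it misses.  The Pluecker relation for the columns \<open>a, j, b\<close> and a unit column, modulo the inner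
  columns, expresses the minor on \<open>J\<close> through minors of one order less and minors whose first and last
  column are closer together, with only positive signs.
\<close>

lemma fekete_columns:
  fixes v :: "nat \<Rightarrow> nat \<Rightarrow> real"
  assumes lower: "\<And>J. sorted_wrt (<) J \<Longrightarrow> set J \<subseteq> {..N} \<Longrightarrow> length J = r \<Longrightarrow> col_det (map v J) > 0"
    and cont: "\<And>m. m + r \<le> N \<Longrightarrow> col_det (map v [m..<Suc (m + r)]) > 0"
    and J: "sorted_wrt (<) J" "set J \<subseteq> {..N}" "length J = Suc r"
  shows "col_det (map v J) > 0"
  using J
proof (induction "last J - hd J" arbitrary: J rule: less_induct)
  case less
  show ?case
  proof (cases "\<exists>j. hd J < j \<and> j < last J \<and> j \<notin> set J")
    case False
    define a b where "a = hd J" and "b = last J"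
    have ne: "J \<noteq> []" using less.prems(3) by auto
    have srt: "sorted J" "distinct J" using less.prems(1) by (auto simp: strict_sorted_iff)
    have ab: "a \<in> set J" "b \<in> set J" using ne by (auto simp: a_def b_def)
    have "J = butlast J @ [b]" "J = a # tl J" using ne by (simp_all add: a_def b_def)
    then have "sorted (butlast J @ [b])" "sorted (a # tl J)" "set J = insert b (set (butlast J))"
      "set J = insert a (set (tl J))"
      using srt(1) by (metis, metis, metis Un_insert_right list.set set_append sup_bot_right, metis list.set(2))
    then have bnd: "\<forall>j\<in>set J. a \<le> j \<and> j \<le> b" by (auto simp: sorted_append)
    have "set J = {a..b}" using False bnd ab unfolding a_def[symmetric] b_def[symmetric]
      by (auto) (metis le_neq_implies_less)
    then have "set J = set [a..<Suc b]" by (simp only: set_upt atLeastLessThanSuc_atLeastAtMost)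
    then have Jeq: "J = [a..<Suc b]"
      by (intro strict_sorted_equal) (simp_all only: less.prems(1) sorted_wrt_upt)
    then have "length J = Suc b - a" by (simp only: length_upt)
    then have br: "b = a + r" using less.prems(3) bnd ab by auto
    show ?thesis unfolding Jeq br by (rule cont) (use ab(2) less.prems(2) br in auto)
  next
    case True
    then obtain j where j: "hd J < j" "j < last J" "j \<notin> set J" by auto
    obtain a W b where J: "J = a # W @ [b]"
    proof -
      obtain a J' where "J = a # J'" using less.prems(3) by (cases J) auto
      moreover have "J' \<noteq> []" using j calculation by auto
      ultimately show ?thesis using that[of a "butlast J'" "last J'"] by simp
    qed
    define W1 where "W1 = filter (\<lambda>i. i < j) W"
    define W2 where "W2 = filter (\<lambda>i. j < i) W"
    have sW: "sorted_wrt (<) W" using less.prems(1) by (auto simp: J sorted_wrt_append)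
    have W: "W = W1 @ W2"
      unfolding W1_def W2_def using sW j(3) by (intro strict_sorted_split) (auto simp: J)
    have W1: "\<forall>i\<in>set W1. i < j" and W2: "\<forall>i\<in>set W2. j < i" by (auto simp: W1_def W2_def)
    have aj: "a < j" "j < b" using j(1,2) by (auto simp: J)
    have len: "Suc (length W1 + length W2) = r" using less.prems(3) by (simp add: J W)
    let ?e = "unit_col r :: nat \<Rightarrow> real"
    let ?W = "map v W1 @ map v W2"
    let ?s1 = "(- 1) ^ length W1 :: real" and ?s2 = "(- 1) ^ length W2 :: real"
    have sgn: "?s1 * ?s1 = 1" "?s2 * ?s2 = 1" by (simp_all flip: power_mult_distrib)
    have e: "col_det (cs @ [?e]) = col_det cs" if "length cs = r" for cs
      using col_det_append_unit_col[of cs] that by simp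
    have srtJ: "sorted_wrt (<) (a # (W1 @ W2) @ [b])" using less.prems(1) unfolding J W .
    have inJ: "set (a # (W1 @ W2) @ [b]) \<subseteq> {..N}" using less.prems(2) unfolding J W .
    \<comment> \<open>the minors known to be positive: \<open>p1\<close> to \<open>p3\<close> have lower order, \<open>p4\<close> and \<open>p5\<close> smaller spread\<close>
    have p1: "col_det (map v (W1 @ j # W2) @ [?e]) > 0"
      by (subst e, use len in simp, rule lower) (use srtJ inJ aj W1 W2 len in \<open>auto simp: sorted_wrt_append\<close>)
    have p2: "col_det (map v (a # W1 @ W2) @ [?e]) > 0"
      by (subst e, use len in simp, rule lower) (use srtJ inJ aj W1 W2 len in \<open>auto simp: sorted_wrt_append\<close>)
    have p3: "col_det (map v (W1 @ W2 @ [b]) @ [?e]) > 0"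
      by (subst e, use len in simp, rule lower) (use srtJ inJ aj W1 W2 len in \<open>auto simp: sorted_wrt_append\<close>)
    have p4: "col_det (map v (a # W1 @ j # W2)) > 0"
    proof (rule less.hyps)
      have "last (a # W1 @ j # W2) < b" using aj srtJ
        by (cases "W2 = []") (auto simp: sorted_wrt_append)
      then show "last (a # W1 @ j # W2) - hd (a # W1 @ j # W2) < last J - hd J"
        using aj W2 by (auto simp: J) 
    qed (use srtJ inJ aj W1 W2 len in \<open>auto simp: sorted_wrt_append\<close>)
    have p5: "col_det (map v (W1 @ j # W2 @ [b])) > 0"
    proof (rule less.hyps)
      have "a < hd (W1 @ j # W2 @ [b])" using aj srtJ
        by (cases "W1") (auto simp: sorted_wrt_append)
      then show "last (W1 @ j # W2 @ [b]) - hd (W1 @ j # W2 @ [b]) < last J - hd J"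
        using aj by (auto simp: J) 
    qed (use srtJ inJ aj W1 W2 len in \<open>auto simp: sorted_wrt_append\<close>)
    \<comment> \<open>sorting the columns of the six determinants in the Pluecker relation\<close>
    have q1: "col_det (v j # ?e # ?W) = ?s2 * col_det (map v (W1 @ j # W2) @ [?e])"
      using col_det_move[of "[v j]" "?W" ?e "[]"] col_det_move[of "[]" "map v W1" "v j" "map v W2 @ [?e]"] sgn
      by (simp add: power_add algebra_simps)
    have q2: "col_det (v a # ?e # ?W) = ?s1 * ?s2 * col_det (map v (a # W1 @ W2) @ [?e])"
      using col_det_move[of "[v a]" "?W" ?e "[]"] sgn
      by (simp add: power_add algebra_simps)
    have q3: "col_det (v b # ?e # ?W) = col_det (map v (W1 @ W2 @ [b]) @ [?e])"
      using col_det_move[of "[v b]" "?W" ?e "[]"] col_det_move[of "[]" "?W" "v b" "[?e]"] sgn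
      by (simp add: power_add algebra_simps)
    have q4: "col_det (v a # v j # ?W) = ?s1 * col_det (map v (a # W1 @ j # W2))"
      using col_det_move[of "[v a]" "map v W1" "v j" "map v W2"] sgn
      by (simp add: power_add algebra_simps)
    have q5: "col_det (v j # v b # ?W) = ?s2 * col_det (map v (W1 @ j # W2 @ [b]))"
      using col_det_move[of "[v j]" "?W" "v b" "[]"] col_det_move[of "[]" "map v W1" "v j" "map v W2 @ [v b]"] sgn
      by (simp add: power_add algebra_simps)
    have q6: "col_det (v a # v b # ?W) = ?s1 * ?s2 * col_det (map v J)"
      using col_det_move[of "[v a]" "?W" "v b" "[]"] sgn
      by (simp add: power_add algebra_simps J W)
    have cancel: "C * D = A * B + E * G"
      if "s1 * A * B - s1 * s2 * C * (s2 * D) + s1 * s2 * E * (s2 * G) = 0" "s1 * s1 = 1" "s2 * s2 = 1"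
      for s1 s2 A B C D E G :: real
    proof -
      have "s1 * s1 * (A * B - (s2 * s2) * (C * D) + (s2 * s2) * (E * G)) = 0"
        using arg_cong[OF that(1), of "\<lambda>z. s1 * z"] by (simp add: algebra_simps)
      then show ?thesis unfolding that(2,3) by simp
    qed
    have "col_det (map v J) * col_det (map v (W1 @ j # W2) @ [?e])
        = col_det (map v (a # W1 @ j # W2)) * col_det (map v (W1 @ W2 @ [b]) @ [?e])
          + col_det (map v (a # W1 @ W2) @ [?e]) * col_det (map v (W1 @ j # W2 @ [b]))"
      using col_det_plucker[of "v a" "v j" ?W "v b" ?e] unfolding q1 q2 q3 q4 q5 q6
      using sgn by (rule cancel)
    also have "\<dots> > 0" using p2 p3 p4 p5 by (intro add_pos_pos mult_pos_pos) auto
    finally show ?thesis using p1 by (simp add: zero_less_mult_iff)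
  qed
qed

lemma minor_row_interval:
  assumes "length J = r"
  shows "minor A [a..<a + r] J = col_det (map (\<lambda>j p. A (a + p) j) J)"
  unfolding minor_def by (rule col_det_cong) (use assms in auto)

text \<open>
  First half of Fekete's criterion, by induction on the order: rows stay contiguous, columns become
  arbitrary.
\<close>

lemma fekete_consecutive_rows:
  fixes A :: "nat \<Rightarrow> nat \<Rightarrow> real"
  assumes cont: "\<And>r a b. a + r \<le> Suc M \<Longrightarrow> b + r \<le> Suc N \<Longrightarrow> minor A [a..<a + r] [b..<b + r] > 0"
  shows "a + r \<le> Suc M \<Longrightarrow> sorted_wrt (<) J \<Longrightarrow> set J \<subseteq> {..N} \<Longrightarrow> length J = r \<Longrightarrow>
    minor A [a..<a + r] J > 0"
proof (induction r arbitrary: J)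
  case 0
  then show ?case by (simp add: minor_def col_det_def)
next
  case (Suc r)
  have "col_det (map (\<lambda>j p. A (a + p) j) J) > 0"
  proof (rule fekete_columns[where N = N and r = r])
    fix J' assume J': "sorted_wrt (<) J'" "set J' \<subseteq> {..N}" "length J' = r"
    show "col_det (map (\<lambda>j p. A (a + p) j) J') > 0"
      using Suc.IH[OF _ J'] Suc.prems(1) minor_row_interval[of J' r A a, OF J'(3)] by simp
  next
    fix m assume "m + r \<le> N"
    then show "col_det (map (\<lambda>j p. A (a + p) j) [m..<Suc (m + r)]) > 0"
      using cont[of a "Suc r" m] Suc.prems(1) minor_row_interval[of "[m..<Suc (m + r)]" "Suc r" A a] by simp
  qed (use Suc.prems in auto)
  then show ?case using minor_row_interval[of J "Suc r" A a] Suc.prems by simp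
qed

text \<open>
  Second half of Fekete's criterion: the same step applied to the transposed matrix makes the rows
  arbitrary as well.
\<close>

lemma fekete:
  fixes A :: "nat \<Rightarrow> nat \<Rightarrow> real"
  assumes cont: "\<And>r a b. a + r \<le> Suc M \<Longrightarrow> b + r \<le> Suc N \<Longrightarrow> minor A [a..<a + r] [b..<b + r] > 0"
  shows "sorted_wrt (<) I \<Longrightarrow> set I \<subseteq> {..M} \<Longrightarrow> length I = r \<Longrightarrow>
    sorted_wrt (<) J \<Longrightarrow> set J \<subseteq> {..N} \<Longrightarrow> length J = r \<Longrightarrow> minor A I J > 0"
proof (induction r arbitrary: I J)
  case 0
  then show ?case by (simp add: minor_def col_det_def)
next
  case (Suc r)
  have tr: "minor A I' J' = col_det (map (\<lambda>i p. A i (J' ! p)) I')" if "length I' = length J'" for I' J'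
    unfolding minor_transpose[OF that] by (simp add: minor_def)
  have "col_det (map (\<lambda>i p. A i (J ! p)) I) > 0"
  proof (rule fekete_columns[where N = M and r = r])
    fix I' assume I': "sorted_wrt (<) I'" "set I' \<subseteq> {..M}" "length I' = r"
    have "minor A I' (take r J) > 0"
      using Suc.prems I' by (intro Suc.IH) (auto simp: sorted_wrt_take dest: in_set_takeD)
    also have "minor A I' (take r J) = col_det (map (\<lambda>i p. A i (J ! p)) I')"
      using Suc.prems I' by (subst tr) (auto intro!: col_det_cong)
    finally show "col_det (map (\<lambda>i p. A i (J ! p)) I') > 0" .
  next
    fix m assume "m + r \<le> M"
    then have "minor A [m..<m + Suc r] J > 0"
      using Suc.prems by (intro fekete_consecutive_rows[OF cont]) auto
    then show "col_det (map (\<lambda>i p. A i (J ! p)) [m..<Suc (m + r)]) > 0"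
      using Suc.prems by (subst (asm) tr) auto
  qed (use Suc.prems in auto)
  then show ?case using Suc.prems by (subst tr) auto
qed

section \<open>Toeplitz minors\<close>

text \<open>
  Truncated subtraction is harmless here: row indices never exceed \<open>i\<close>.
\<close>

definition toep_entry :: "(nat \<Rightarrow> real) \<Rightarrow> nat \<Rightarrow> nat \<Rightarrow> nat \<Rightarrow> real" where
  "toep_entry c i p q = c (i + q - p)"

text \<open>
  The contiguous Toeplitz minor of order \<open>r\<close> with \<open>c\<^sub>m\<close> in its upper left corner.  It is meaningful for
  \<open>r \<le> m + 1\<close> and \<open>m + r \<le> d + 1\<close>; the two extreme values of \<open>m\<close> give the corner minors.
\<close>

definition toeplitz_det :: "(nat \<Rightarrow> real) \<Rightarrow> nat \<Rightarrow> nat \<Rightarrow> real" where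
  "toeplitz_det c r m = col_det (map (\<lambda>j p. c (m + j - p)) [0..<r])"

text \<open>
  Covers total positivity and total nonnegativity.  The empty minor \<open>1\<close> is included, which both
  conditions satisfy.
\<close>

definition minors_satisfy :: "(real \<Rightarrow> bool) \<Rightarrow> (nat \<Rightarrow> nat \<Rightarrow> real) \<Rightarrow> nat \<Rightarrow> nat \<Rightarrow> bool" where
  "minors_satisfy P A M N \<longleftrightarrow> (\<forall>I J. sorted_wrt (<) I \<and> sorted_wrt (<) J \<and> set I \<subseteq> {..M} \<and> set J \<subseteq> {..N}
     \<and> length I = length J \<longrightarrow> P (minor A I J))"

lemma minors_satisfyD:
  assumes "minors_satisfy P A M N" "sorted_wrt (<) I" "set I \<subseteq> {..M}" "sorted_wrt (<) J" "set J \<subseteq> {..N}"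
    "length I = length J"
  shows "P (minor A I J)"
  using assms unfolding minors_satisfy_def by blast

lemma minor_toep_contiguous:
  assumes "a + r \<le> Suc i"
  shows "minor (toep_entry c i) [a..<a + r] [b..<b + r] = toeplitz_det c r (i + b - a)"
  unfolding minor_def toeplitz_det_def toep_entry_def
  by (rule col_det_cong) (use assms in \<open>auto intro!: arg_cong[where f = c]\<close>)

lemma toeplitz_fekete:
  assumes "\<And>r m. r \<le> Suc i \<Longrightarrow> r \<le> Suc m \<Longrightarrow> m + r \<le> Suc d \<Longrightarrow> toeplitz_det c r m > 0" "i \<le> d"
  shows "minors_satisfy (\<lambda>x. x > 0) (toep_entry c i) i (d - i)"
  unfolding minors_satisfy_def
proof (intro allI impI, elim conjE)
  fix I J assume IJ: "sorted_wrt (<) I" "sorted_wrt (<) J" "set I \<subseteq> {..i}" "set J \<subseteq> {..d - i}"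
    "length I = length J"
  have "minor (toep_entry c i) [a..<a + r] [b..<b + r] > 0" if "a + r \<le> Suc i" "b + r \<le> Suc (d - i)" for r a b
    unfolding minor_toep_contiguous[OF that(1)] using that assms(2) by (intro assms(1)) auto
  from fekete[OF this IJ(1) IJ(3) refl IJ(2) IJ(4) IJ(5)[symmetric]] show "minor (toep_entry c i) I J > 0" by blast
qed

text \<open>
  Minors whose order is the length of the recurrence.  The coefficient \<open>g\<^sub>0\<close> cannot vanish, for
  otherwise the recurrence would be a relation in the last corner minor.  Since \<open>g\<^sub>0 \<noteq> 0\<close>, the recurrence can
  be run backwards, so a row relation of the minor at \<open>m + 1\<close> is also one of the minor at \<open>m\<close>.
  Nonvanishing therefore spreads from the first corner.
\<close>

lemma toeplitz_det_top_nonzero: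
  assumes rec: "\<And>q. q + s \<le> d \<Longrightarrow> (\<Sum>j\<le>s. g j * c (q + j)) = 0" and g: "j0 \<le> s" "g j0 \<noteq> 0"
    and s: "s \<ge> 1" "2 * s \<le> Suc d"
    and corner1: "toeplitz_det c s (s - 1) \<noteq> 0" and corner2: "toeplitz_det c s (Suc d - s) \<noteq> 0"
    and m: "s \<le> Suc m" "m + s \<le> Suc d"
  shows "toeplitz_det c s m \<noteq> 0"
proof -
  have g0: "g 0 \<noteq> 0"
  proof
    assume g0: "g 0 = 0"
    have "toeplitz_det c s (Suc d - s) = col_det (map (\<lambda>i p. c (Suc d - s + p - i)) [0..<s])"
    proof -
      have "toeplitz_det c s (Suc d - s) = minor (\<lambda>p j. c (Suc d - s + j - p)) [0..<s] [0..<s]"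
        unfolding toeplitz_det_def minor_def by (rule col_det_cong) auto
      also have "\<dots> = col_det (map (\<lambda>i p. c (Suc d - s + p - i)) [0..<s])"
        by (subst minor_transpose) (auto simp: minor_def intro!: col_det_cong)
      finally show ?thesis .
    qed
    also have "\<dots> = 0"
    proof (rule col_det_eq_0[where a = "\<lambda>p. g (Suc p)" and ?p0.0 = "j0 - 1"])
      show "j0 - 1 < length (map (\<lambda>i p. c (Suc d - s + p - i)) [0..<s])" using g g0 s by (cases j0) auto
      show "g (Suc (j0 - 1)) \<noteq> 0" using g g0 by (cases j0) auto
      fix i assume "i < length (map (\<lambda>i p. c (Suc d - s + p - i)) [0..<s])"
      then have i: "i < s" by simp
      have "0 = (\<Sum>j\<le>s. g j * c (d - s - i + j))" using rec[of "d - s - i"] i s by simp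
      also have "\<dots> = (\<Sum>p<s. g (Suc p) * c (d - s - i + Suc p))"
        by (subst sum.atMost_shift) (simp add: g0 )
      also have "\<dots> = (\<Sum>p<s. g (Suc p) * c (Suc d - s + p - i))"
        using i s by (intro sum.cong refl arg_cong2[where f = "(*)"] arg_cong[where f = c]) auto
      finally show "(\<Sum>p<length (map (\<lambda>i p. c (Suc d - s + p - i)) [0..<s]).
          g (Suc p) * (map (\<lambda>i p. c (Suc d - s + p - i)) [0..<s] ! i) p) = 0"
        using i by simp
    qed
    finally show False using corner2 by simp
  qed
  have "m \<ge> s - 1" using m by simp
  then show ?thesis using m
  proof (induction m rule: dec_induct)
    case base
    then show ?case using corner1 by simp
  next
    case (step m)
    show ?case
    proof
      assume "toeplitz_det c s (Suc m) = 0"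
      then obtain a p0 where a: "p0 < s" "a p0 \<noteq> 0"
        "\<And>q. q < s \<Longrightarrow> (\<Sum>p<s. a p * c (Suc m + q - p)) = 0"
        unfolding toeplitz_det_def by (rule col_det_eq_0_obtain) auto
      have ext: "(\<Sum>p<s. a p * c (m - p)) = 0"
      proof -
        have "g 0 * (\<Sum>p<s. a p * c (m - p)) + (\<Sum>j<s. g (Suc j) * (\<Sum>p<s. a p * c (Suc m + j - p)))
            = (\<Sum>p<s. a p * (g 0 * c (m - p) + (\<Sum>j<s. g (Suc j) * c (Suc m + j - p))))"
        proof -
          have "(\<Sum>j<s. g (Suc j) * (\<Sum>p<s. a p * c (Suc m + j - p)))
              = (\<Sum>j<s. \<Sum>p<s. a p * (g (Suc j) * c (Suc m + j - p)))"
            unfolding sum_distrib_left by (simp only: mult.left_commute)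
          also have "\<dots> = (\<Sum>p<s. a p * (\<Sum>j<s. g (Suc j) * c (Suc m + j - p)))"
            by (subst sum.swap) (simp only: sum_distrib_left)
          finally show ?thesis
            by (simp only: distrib_left sum.distrib sum_distrib_left mult.left_commute)
        qed
        also have "\<dots> = (\<Sum>p<s. a p * (\<Sum>j\<le>s. g j * c (m - p + j)))"
          using step.hyps s
          by (intro sum.cong refl arg_cong2[where f = "(*)"], subst sum.atMost_shift)
            (auto intro!: sum.cong arg_cong[where f = c])
        also have "\<dots> = 0"
        proof (intro sum.neutral ballI)
          fix p assume "p \<in> {..<s}"
          then have "(\<Sum>j\<le>s. g j * c (m - p + j)) = 0"
            using step.prems step.hyps s by (intro rec) auto
          then show "a p * (\<Sum>j\<le>s. g j * c (m - p + j)) = 0" by (simp only: mult_zero_right)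
        qed
        finally show ?thesis using a(3) g0 by simp
      qed
      have "toeplitz_det c s m = 0" unfolding toeplitz_det_def
      proof (rule col_det_eq_0[where a = a and ?p0.0 = p0])
        fix q assume "q < length (map (\<lambda>j p. c (m + j - p)) [0..<s])"
        then show "(\<Sum>p<length (map (\<lambda>j p. c (m + j - p)) [0..<s]).
            a p * (map (\<lambda>j p. c (m + j - p)) [0..<s] ! q) p) = 0"
          using ext a(3)[of "q - 1"] by (cases q) auto
      qed (use a in auto)
      then show False using step by auto
    qed
  qed
qed

text \<open>
  A nonzero minor on the first \<open>r\<close> rows extends to one on the first \<open>r + 1\<close> rows: otherwise the
  cofactors of the additional column would give a relation between these rows.
\<close>

lemma full_row_rank_minor:
  fixes A :: "nat \<Rightarrow> nat \<Rightarrow> real"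
  assumes rank: "\<And>a p. (\<And>j. j \<le> N \<Longrightarrow> (\<Sum>p<s. a p * A p j) = 0) \<Longrightarrow> p < s \<Longrightarrow> a p = 0"
  shows "r \<le> s \<Longrightarrow> \<exists>J. sorted_wrt (<) J \<and> set J \<subseteq> {..N} \<and> length J = r \<and> minor A [0..<r] J \<noteq> 0"
proof (induction r)
  case 0
  show ?case by (rule exI[of _ "[]"]) (simp add: minor_def col_det_def)
next
  case (Suc r)
  then obtain J where J: "sorted_wrt (<) J" "set J \<subseteq> {..N}" "length J = r" "minor A [0..<r] J \<noteq> 0" by auto
  define V where "V j = (\<lambda>p. A p j)" for j
  have mV: "minor A [0..<length J'] J' = col_det (map V J')" for J'
    using minor_row_interval[of J' "length J'" A 0] by (simp add: V_def[abs_def])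
  obtain w where w: "\<And>u. col_det (u # map V J) = (\<Sum>p<Suc r. u p * w p)"
    using col_det_expand[of "[]" "map V J"] J(3) by auto
  have "col_det (unit_col r # map V J) = w r" unfolding w by (simp add: unit_col_def)
  moreover have "col_det (map V J @ [unit_col r]) = (- 1) ^ r * col_det (unit_col r # map V J)"
    using col_det_move[of "[]" "map V J" "unit_col r :: nat \<Rightarrow> real" "[]"] J(3) by simp
  moreover have "col_det (map V J @ [unit_col r]) \<noteq> 0"
    using col_det_append_unit_col[of "map V J"] J(3,4) mV[of J] by simp
  ultimately have wr: "w r \<noteq> 0" by (metis mult_zero_right)
  \<comment> \<open>\<open>w\<close> is the vector of cofactors, and its last entry is the given nonzero minor\<close>
  have "\<exists>j\<le>N. col_det (V j # map V J) \<noteq> 0"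
  proof (rule ccontr)
    assume neg: "\<not> ?thesis"
    define a where "a p = (if p \<le> r then w p else 0)" for p
    have "(\<Sum>p<s. a p * A p j) = 0" if "j \<le> N" for j
    proof -
      have "(\<Sum>p<s. a p * A p j) = (\<Sum>p<Suc r. V j p * w p)"
        using Suc.prems by (intro sum.mono_neutral_cong_right) (auto simp: a_def V_def)
      then show ?thesis using neg that unfolding w by simp
    qed
    from rank[of a r, OF this] show False using wr Suc.prems by (simp add: a_def)
  qed
  then obtain j where j: "j \<le> N" "col_det (V j # map V J) \<noteq> 0" by blast
  then have jJ: "j \<notin> set J" using col_det_repeat[of "V j" "map V J" "[]"] by auto
  define J1 where "J1 = filter (\<lambda>i. i < j) J"
  define J2 where "J2 = filter (\<lambda>i. j < i) J"
  have J12: "J = J1 @ J2"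
    unfolding J1_def J2_def by (rule strict_sorted_split[OF J(1) jJ])
  have "col_det (map V (J1 @ j # J2)) \<noteq> 0"
    using col_det_move[of "[]" "map V J1" "V j" "map V J2"] j(2) by (simp add: J12)
  moreover have "length (J1 @ j # J2) = Suc r" using J(3) by (simp add: J12)
  ultimately have "minor A [0..<Suc r] (J1 @ j # J2) \<noteq> 0" using mV[of "J1 @ j # J2"] by (simp del: upt_Suc)
  moreover have "sorted_wrt (<) (J1 @ j # J2)"
  proof -
    have "\<forall>i\<in>set J1. i < j" "\<forall>i\<in>set J2. j < i" by (simp_all add: J1_def J2_def)
    then show ?thesis using J(1) unfolding J12 by (auto simp: sorted_wrt_append)
  qed
  moreover have "set (J1 @ j # J2) \<subseteq> {..N}" using J(2) j(1) unfolding J12 by simp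
  ultimately show ?case using \<open>length (J1 @ j # J2) = Suc r\<close> by blast
qed

section \<open>Corner minors force positivity\<close>

text \<open>
  The first zero among the contiguous minors of order \<open>r\<close> propagates to the last corner.  Let the zero
  minor occupy the columns \<open>q, \<dots>, q + r - 1\<close> and let \<open>\<beta>\<close> consist of all of them but the first.  The Pluecker
  relation for column \<open>q\<close>, a later column \<open>j\<close> and two unit columns, modulo \<open>\<beta>\<close>, is a sum of two
  nonnegative terms equal to zero, so the minor on \<open>\<beta>\<close> and \<open>j\<close> vanishes.  Hence all later columns
  lie in the span of the \<open>r - 1\<close> columns of \<open>\<beta>\<close>, and the corner minor, which consists of such
  columns, is zero.
\<close>

lemma toeplitz_det_pos_step:
  assumes tnn: "minors_satisfy (\<lambda>x. x \<ge> 0) (toep_entry c r) r (d - r)"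
    and r: "1 \<le> r" "2 * r \<le> d"
    and lower: "toeplitz_det c (r - 1) m > 0"
    and m: "r \<le> m" "m + r \<le> d"
    and zero: "toeplitz_det c r m = 0" and prev: "toeplitz_det c r (m - 1) > 0"
  shows "toeplitz_det c r (Suc d - r) = 0"
proof -
  define i where "i = r - 1"
  have ri: "r = Suc i" using r by (simp add: i_def)
  define q where "q = m - r"
  have mq: "m = r + q" using m by (simp add: q_def)
  define V where "V j = (\<lambda>p. c (r + j - p))" for j
  define ix where "ix = [Suc q..<Suc q + i]"
  define \<beta> where "\<beta> = map V ix"
  have len: "length \<beta> = i" "length ix = i" by (simp_all add: \<beta>_def ix_def)
  let ?e0 = "unit_col 0 :: nat \<Rightarrow> real" and ?el = "unit_col r :: nat \<Rightarrow> real"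
  let ?\<sigma> = "(- 1) ^ i :: real"
  have \<sigma>: "?\<sigma> * ?\<sigma> = 1" by (simp flip: power_mult_distrib)
  have el: "col_det (cs @ [?el]) = col_det cs" if "length cs = r" for cs
    using col_det_append_unit_col[of cs] that by simp
  have ndup: "col_det (V j # \<beta>) = 0" if q2: "j + r \<le> d" "q < j" for j
  proof (cases "j \<in> set ix")
    case True
    then show ?thesis using col_det_repeat[of "V j" \<beta> "[]"] by (simp add: \<beta>_def)
  next
    case False
    then have j: "q + i < j" using q2 by (auto simp: ix_def)
    define full where "full = col_det (V q # \<beta> @ [V j])"
    have full: "full \<ge> 0"
    proof -
      have "minor (toep_entry c r) [0..<Suc r] (q # ix @ [j]) \<ge> 0"
        using q2 j r by (intro minors_satisfyD[OF tnn]) (auto simp: ix_def sorted_wrt_append ri simp del: upt_Suc)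
      also have "minor (toep_entry c r) [0..<Suc r] (q # ix @ [j]) = full"
        using minor_row_interval[of "q # ix @ [j]" "Suc r" "toep_entry c r" 0] len ri
        by (simp add: full_def \<beta>_def V_def[abs_def] toep_entry_def del: upt_Suc)
      finally show ?thesis .
    qed
    define low where "low = col_det (\<beta> @ [V j])"
    have low: "low \<ge> 0"
    proof -
      have "minor (toep_entry c r) [0..<r] (ix @ [j]) \<ge> 0"
        using q2 j r by (intro minors_satisfyD[OF tnn]) (auto simp: ix_def sorted_wrt_append ri simp del: upt_Suc)
      also have "minor (toep_entry c r) [0..<r] (ix @ [j]) = low"
        using minor_row_interval[of "ix @ [j]" r "toep_entry c r" 0] len ri
        by (simp add: low_def \<beta>_def V_def[abs_def] toep_entry_def del: upt_Suc)
      finally show ?thesis .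
    qed
    \<comment> \<open>the Pluecker relation pairs \<open>full\<close> with the pivot below, and \<open>low\<close> with the preceding minor\<close>
    have piv: "col_det (?e0 # \<beta> @ [?el]) = toeplitz_det c (r - 1) m"
    proof -
      have "col_det (?e0 # \<beta> @ [?el]) = col_det (?e0 # \<beta>)" using el[of "?e0 # \<beta>"] len ri by simp
      also have "\<dots> = toeplitz_det c (r - 1) m"
        unfolding col_det_Cons_unit_col toeplitz_det_def
        by (rule col_det_cong) (auto simp: \<beta>_def V_def ix_def ri mq add_ac simp del: upt_Suc)
      finally show ?thesis .
    qed
    have a1: "col_det (V q # V j # \<beta>) = ?\<sigma> * full"
      using col_det_move[of "[V q]" \<beta> "V j" "[]"] \<sigma> by (simp add: full_def len)
    have "col_det (?e0 # ?el # \<beta>) = ?\<sigma> * col_det (?e0 # \<beta> @ [?el])"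
      using col_det_move[of "[?e0]" \<beta> ?el "[]"] \<sigma> by (simp add: len)
    then have a2: "col_det (?e0 # ?el # \<beta>) = ?\<sigma> * toeplitz_det c (r - 1) m" unfolding piv .
    have a3: "col_det (V q # ?e0 # \<beta>) = - toeplitz_det c r (m - 1)"
    proof -
      have "col_det (V q # ?e0 # \<beta>) = - col_det (?e0 # V q # \<beta>)"
        using col_det_swap[of "[]" "V q" ?e0 \<beta>] by simp
      also have "col_det (?e0 # V q # \<beta>) = toeplitz_det c r (m - 1)"
        unfolding col_det_Cons_unit_col toeplitz_det_def
        by (rule col_det_cong) (auto simp: \<beta>_def V_def ix_def ri mq nth_Cons add_ac simp del: upt_Suc split: nat.split)
      finally show ?thesis .
    qed
    have mv: "col_det (x # ?el # \<beta>) = ?\<sigma> * col_det (x # \<beta>)" for x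
    proof -
      have "col_det (x # ?el # \<beta>) = ?\<sigma> * col_det (x # \<beta> @ [?el])"
        using col_det_move[of "[x]" \<beta> ?el "[]"] \<sigma> by (simp add: len)
      then show ?thesis using el[of "x # \<beta>"] by (simp add: len ri)
    qed
    have a4: "col_det (V j # \<beta>) = ?\<sigma> * low"
      using col_det_move[of "[]" \<beta> "V j" "[]"] \<sigma> by (simp add: low_def len)
    have a5: "col_det (V q # \<beta>) = 0"
    proof -
      have "col_det (V q # \<beta>) = toeplitz_det c r m"
        unfolding toeplitz_det_def
        by (rule col_det_cong) (auto simp: \<beta>_def V_def ix_def ri mq nth_Cons add_ac simp del: upt_Suc split: nat.split)
      then show ?thesis using zero by simp
    qed
    have "?\<sigma> * ?\<sigma> * (full * toeplitz_det c (r - 1) m) + toeplitz_det c r (m - 1) * (?\<sigma> * ?\<sigma> * low) = 0"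
      using col_det_plucker[of "V q" "V j" \<beta> ?e0 ?el] unfolding a1 a2 a3 mv[of "V j"] mv[of "V q"] a4 a5 by (simp add: mult_ac)
    then have "full * toeplitz_det c (r - 1) m + toeplitz_det c r (m - 1) * low = 0" unfolding \<sigma> by simp
    moreover have "full * toeplitz_det c (r - 1) m \<ge> 0" using full lower by simp
    moreover have "toeplitz_det c r (m - 1) * low \<ge> 0" using low prev by simp
    ultimately have "toeplitz_det c r (m - 1) * low = 0" by linarith
    then have "low = 0" using prev by simp
    then show ?thesis using a4 by simp
  qed
  \<comment> \<open>\<open>w\<close> is the normal vector of the hyperplane spanned by \<open>\<beta>\<close>\<close>
  obtain w where w: "\<And>u. col_det (u # \<beta>) = (\<Sum>p<r. u p * w p)"
    using col_det_expand[of "[]" \<beta>] len ri by auto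
  have "w 0 = col_det (?e0 # \<beta>)" unfolding w by (subst ri, subst sum.lessThan_Suc_shift) (simp add: unit_col_def)
  also have "\<dots> = toeplitz_det c (r - 1) m"
    unfolding col_det_Cons_unit_col toeplitz_det_def by (rule col_det_cong) (auto simp: \<beta>_def V_def ix_def ri mq add_ac simp del: upt_Suc)
  finally have w0: "w 0 \<noteq> 0" using lower by simp
  show ?thesis unfolding toeplitz_det_def
  proof (rule col_det_eq_0[where a = w and ?p0.0 = 0])
    fix k assume "k < length (map (\<lambda>j p. c (Suc d - r + j - p)) [0..<r])"
    then have k: "k < r" by simp
    have "(\<Sum>p<r. V (Suc d - 2 * r + k) p * w p) = 0"
      unfolding w[symmetric] using k r m mq by (intro ndup) auto
    moreover have "V (Suc d - 2 * r + k) = (\<lambda>p. c (Suc d - r + k - p))"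
      using r by (auto simp: V_def intro!: arg_cong[where f = c])
    ultimately show "(\<Sum>p<length (map (\<lambda>j p. c (Suc d - r + j - p)) [0..<r]).
        w p * (map (\<lambda>j p. c (Suc d - r + j - p)) [0..<r] ! k) p) = 0"
      using k by (simp add: mult.commute)
  qed (use ri w0 in auto)
qed

text \<open>
  Induction on the order, and for each order along the diagonal.  Below the order \<open>s\<close> the first zero
  would force the last corner to vanish; at the order \<open>s\<close> the recurrence excludes zeros.
\<close>

lemma toeplitz_det_pos_of_corners:
  assumes s: "s \<ge> 1" "2 * s \<le> Suc (Suc d)"
    and tnn: "\<And>i. i < s \<Longrightarrow> minors_satisfy (\<lambda>x. x \<ge> 0) (toep_entry c i) i (d - i)"
    and corner1: "\<And>r. 1 \<le> r \<Longrightarrow> r \<le> s \<Longrightarrow> toeplitz_det c r (r - 1) \<noteq> 0"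
    and corner2: "\<And>r. 1 \<le> r \<Longrightarrow> r \<le> s \<Longrightarrow> toeplitz_det c r (Suc d - r) \<noteq> 0"
    and rec: "s \<le> d \<Longrightarrow> \<exists>g. (\<exists>j\<le>s. g j \<noteq> 0) \<and> (\<forall>q. q + s \<le> d \<longrightarrow> (\<Sum>j\<le>s. g j * c (q + j)) = 0)"
  shows "r \<le> s \<Longrightarrow> r \<le> Suc m \<Longrightarrow> m + r \<le> Suc d \<Longrightarrow> toeplitz_det c r m > 0"
proof (induction r arbitrary: m)
  case 0
  then show ?case by (simp add: toeplitz_det_def col_det_def)
next
  case (Suc i)
  let ?r = "Suc i"
  have nn: "toeplitz_det c ?r m \<ge> 0" if "?r \<le> Suc m" "m + ?r \<le> Suc d" for m
  proof -
    have "minor (toep_entry c i) [0..<0 + ?r] [m - i..<m - i + ?r] \<ge> 0"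
      using that Suc.prems s by (intro minors_satisfyD[OF tnn]) (auto simp del: upt_Suc)
    then show ?thesis using that by (subst (asm) minor_toep_contiguous) auto
  qed
  show ?case
  proof (cases "?r = s")
    case True
    have ms: "s \<le> Suc m" "m + s \<le> Suc d" using Suc.prems unfolding True by simp_all
    have "toeplitz_det c s m \<noteq> 0"
    proof (cases "2 * s \<le> Suc d \<and> s \<le> d")
      case True
      then obtain g j where g: "j \<le> s" "g j \<noteq> 0" "\<And>q. q + s \<le> d \<Longrightarrow> (\<Sum>j\<le>s. g j * c (q + j)) = 0"
        using rec by blast
      show ?thesis
        by (rule toeplitz_det_top_nonzero[OF g(3) g(1,2) s(1) _ corner1 corner2 ms]) (use True s(1) in auto)
    next
      case False
      then have "m = s - 1" using ms s by linarith
      then show ?thesis using corner1[of s] s by simp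
    qed
    then show ?thesis using nn[of m] ms unfolding True by simp
  next
    case False
    then have rs: "?r < s" using Suc.prems by simp
    have "m \<ge> i" using Suc.prems by simp
    then show ?thesis using Suc.prems
    proof (induction m rule: dec_induct)
      case base
      then show ?case using nn[of i] corner1[of ?r] by force
    next
      case (step m)
      have prev: "toeplitz_det c ?r m > 0" using step by simp
      have "toeplitz_det c ?r (Suc m) \<noteq> 0"
      proof
        assume z: "toeplitz_det c ?r (Suc m) = 0"
        show False
        proof (cases "Suc m + ?r \<le> d")
          case True
          have "toeplitz_det c ?r (Suc d - ?r) = 0"
            by (rule toeplitz_det_pos_step[where m = "Suc m", OF tnn[OF rs]])
              (use True z prev s rs step.hyps step.prems in \<open>auto intro!: Suc.IH\<close>)
          then show False using corner2[of ?r] rs by simp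
        next
          case False
          then have "Suc m = Suc d - ?r" using step.prems by simp
          then show False using corner2[of ?r] z rs by simp
        qed
      qed
      then show ?case using nn[of "Suc m"] step by force
    qed
  qed
qed

section \<open>From Toeplitz minors to Hessian determinants\<close>

text \<open>
  The functional \<open>x\<^sup>k \<mapsto> c\<^sub>k\<close> on polynomials of degree at most \<open>d\<close>.  Univariate polynomials stand here for
  binary forms with the second variable set to \<open>1\<close>.
\<close>

definition umbral :: "(nat \<Rightarrow> real) \<Rightarrow> nat \<Rightarrow> real poly \<Rightarrow> real" where
  "umbral c d p = (\<Sum>k\<le>d. coeff p k * c k)"

lemma umbral_add: "umbral c d (p + q) = umbral c d p + umbral c d q"
  by (simp add: umbral_def algebra_simps sum.distrib)

lemma umbral_smult: "umbral c d (smult a p) = a * umbral c d p"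
  by (simp add: umbral_def sum_distrib_left algebra_simps)

lemma umbral_sum: "umbral c d (\<Sum>i\<in>A. f i) = (\<Sum>i\<in>A. umbral c d (f i))"
  unfolding umbral_def coeff_sum sum_distrib_right by (rule sum.swap)

lemma umbral_monom: "k \<le> d \<Longrightarrow> umbral c d (monom 1 k) = c k"
proof -
  assume k: "k \<le> d"
  have "umbral c d (monom 1 k) = (\<Sum>j\<le>d. if k = j then c j else 0)"
    unfolding umbral_def by (intro sum.cong) auto
  then show ?thesis using k by simp
qed

text \<open>
  The determinant of \<open>(u, v) \<mapsto> \<Lambda>(L u v)\<close> on polynomials of degree at most \<open>i\<close>, with the monomials in
  opposite order on the two sides.  For \<open>L = (X x + Y)\<^sup>n\<close> with \<open>n = d - 2 i\<close> it is a positive multiple of \<open>H\<^sub>i(X, Y)\<close>.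
\<close>

definition hessian_det :: "(nat \<Rightarrow> real) \<Rightarrow> nat \<Rightarrow> nat \<Rightarrow> real poly \<Rightarrow> real" where
  "hessian_det c d i L = col_det (map (\<lambda>q p. umbral c d (L * monom 1 (i + q - p))) [0..<Suc i])"

lemma umbral_linear_factor:
  "umbral c d ([:y, x:] ^ Suc k * monom 1 n)
    = y * umbral c d ([:y, x:] ^ k * monom 1 n) + x * umbral c d ([:y, x:] ^ k * monom 1 (Suc n))"
proof -
  have "[:y, x:] * monom 1 n = smult y (monom 1 n) + smult x (monom 1 (Suc n))"
    by (simp add: monom_Suc)
  then have "[:y, x:] ^ Suc k * monom 1 n
      = smult y ([:y, x:] ^ k * monom 1 n) + smult x ([:y, x:] ^ k * monom 1 (Suc n))"
    by (simp only: power_Suc2 mult.assoc) (simp add: distrib_left)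
  then show ?thesis by (simp only: umbral_add umbral_smult)
qed

context
  fixes c :: "nat \<Rightarrow> real" and d s i :: nat and x y :: real
  assumes i: "i < s" and s: "2 * s \<le> Suc (Suc d)"
begin

text \<open>
  The rows \<open>I\<close> of the Toeplitz matrix after its columns \<open>x\<^sup>q\<close> have been replaced by \<open>l\<^sup>k x\<^sup>q\<close>,
  where \<open>l\<close> is the linear polynomial \<open>[:y, x:]\<close>.
\<close>

definition column_stage :: "nat list \<Rightarrow> nat \<Rightarrow> nat \<Rightarrow> nat \<Rightarrow> real" where
  "column_stage I k q p = umbral c d ([:y, x:] ^ k * monom 1 (s - 1 - I ! p + q))"

text \<open>
  Continues from the last column stage, where the columns \<open>l\<^sup>e x\<^sup>q\<close> with \<open>e = d + 1 - s - i\<close> and \<open>q \<le> i\<close>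
  are left, by distributing further factors \<open>l\<close> over the rows.
\<close>

definition row_stage :: "nat \<Rightarrow> nat \<Rightarrow> nat \<Rightarrow> real" where
  "row_stage k a q = umbral c d ([:y, x:] ^ (Suc d - s - i + k) * monom 1 (s - 1 - k - a + q))"

lemma hessian_det_row_stage: "hessian_det c d i ([:y, x:] ^ (d - 2 * i)) = col_det (map (row_stage (s - 1 - i)) [0..<Suc i])"
proof -
  have "hessian_det c d i ([:y, x:] ^ (d - 2 * i))
      = minor (\<lambda>p q. umbral c d ([:y, x:] ^ (d - 2 * i) * monom 1 (i + q - p))) [0..<Suc i] [0..<Suc i]"
    unfolding hessian_det_def minor_def by (rule col_det_cong) (auto simp del: upt_Suc)
  also have "\<dots> = col_det (map (\<lambda>a q. umbral c d ([:y, x:] ^ (d - 2 * i) * monom 1 (i + q - a))) [0..<Suc i])"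
    by (subst minor_transpose) (auto simp: minor_def simp del: upt_Suc intro!: col_det_cong)
  also have "\<dots> = col_det (map (row_stage (s - 1 - i)) [0..<Suc i])"
  proof (rule col_det_cong)
    fix p q assume "p < length (map (\<lambda>a q. umbral c d ([:y, x:] ^ (d - 2 * i) * monom 1 (i + q - a))) [0..<Suc i])"
      and "q < length (map (\<lambda>a q. umbral c d ([:y, x:] ^ (d - 2 * i) * monom 1 (i + q - a))) [0..<Suc i])"
    then have pq: "p \<le> i" "q \<le> i" by simp_all
    have "Suc d - s - i + (s - 1 - i) = d - 2 * i" "s - 1 - (s - 1 - i) - q + p = i + p - q"
      using pq i s by auto
    then show "(map (\<lambda>a q. umbral c d ([:y, x:] ^ (d - 2 * i) * monom 1 (i + q - a))) [0..<Suc i] ! q) p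
        = (map (row_stage (s - 1 - i)) [0..<Suc i] ! q) p"
      using pq by (simp add: row_stage_def del: upt_Suc)
  qed simp
  finally show ?thesis .
qed

lemma column_stage_0:
  assumes "length I = length J" "set I \<subseteq> {..s - 1}" "set J \<subseteq> {..d - (s - 1)}"
  shows "col_det (map (column_stage I 0) J) = minor (toep_entry c (s - 1)) I J"
  unfolding minor_def
proof (rule col_det_cong)
  fix p q assume "p < length (map (column_stage I 0) J)" "q < length (map (column_stage I 0) J)"
  then have pq: "p < length J" "q < length J" by simp_all
  have "I ! p \<in> set I" "J ! q \<in> set J" using assms(1) pq by simp_all
  then have "I ! p \<le> s - 1" "J ! q \<le> d - (s - 1)" using assms(2,3) by auto
  then have "s - 1 - I ! p + J ! q \<le> d" "s - 1 - I ! p + J ! q = s - 1 + J ! q - I ! p"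
    using i s by auto
  then show "(map (column_stage I 0) J ! q) p = (map (\<lambda>j p. toep_entry c (s - 1) (I ! p) j) J ! q) p"
    using pq by (simp add: column_stage_def toep_entry_def umbral_monom)
qed simp

lemma row_stage_0:
  assumes "length I = Suc i"
  shows "col_det (map (row_stage 0) I) = col_det (map (column_stage I (Suc d - s - i)) [0..<Suc i])"
proof -
  have "col_det (map (row_stage 0) I) = minor (\<lambda>a b. row_stage 0 b a) [0..<Suc i] I"
    unfolding minor_def using assms by (intro col_det_cong) (auto simp del: upt_Suc)
  also have "\<dots> = minor (\<lambda>a b. row_stage 0 a b) I [0..<Suc i]"
    using assms by (subst minor_transpose) auto
  also have "\<dots> = col_det (map (column_stage I (Suc d - s - i)) [0..<Suc i])"
    unfolding minor_def row_stage_def column_stage_def using assms by (intro col_det_cong) (auto simp del: upt_Suc)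
  finally show ?thesis .
qed

lemma bidiagonal_column_stage: "bidiagonal_iteration (column_stage I) (Suc d - s) x y"
  by unfold_locales (simp only: column_stage_def umbral_linear_factor add_Suc_right)

lemma bidiagonal_row_stage: "bidiagonal_iteration row_stage (s - 1) y x"
proof
  fix k j p assume "k + j < s - 1"
  then have e: "s - 1 - k - j + p = Suc (s - 1 - Suc k - j + p)" "s - 1 - k - Suc j + p = s - 1 - Suc k - j + p"
    by simp_all
  show "row_stage (Suc k) j p = x * row_stage k j p + y * row_stage k (Suc j) p"
    unfolding row_stage_def e add_Suc_right umbral_linear_factor by (rule add.commute)
qed

lemma hessian_det_pos_of_totally_positive:
  assumes tp: "minors_satisfy (\<lambda>z. z > 0) (toep_entry c (s - 1)) (s - 1) (d - (s - 1))"
    and xy: "x \<ge> 0" "y \<ge> 0" "x \<noteq> 0 \<or> y \<noteq> 0"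
  shows "hessian_det c d i ([:y, x:] ^ (d - 2 * i)) > 0"
  unfolding hessian_det_row_stage
proof (rule bidiagonal_iteration.all_pos[OF bidiagonal_row_stage, where r = "Suc i"])
  fix I assume I: "sorted_wrt (<) I" "set I \<subseteq> {..s - 1}" "length I = Suc i"
  show "col_det (map (row_stage 0) I) > 0"
    unfolding row_stage_0[OF I(3)]
  proof (rule bidiagonal_iteration.all_pos[OF bidiagonal_column_stage, where r = "Suc i"])
    fix J assume J: "sorted_wrt (<) J" "set J \<subseteq> {..Suc d - s}" "length J = Suc i"
    have "d - (s - 1) = Suc d - s" using i by simp
    then show "col_det (map (column_stage I 0) J) > 0"
      using column_stage_0[of I J] I J minors_satisfyD[OF tp I(1,2) J(1)] by simp
  qed (use xy i s in \<open>auto simp del: upt_Suc\<close>)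
qed (use xy i s in \<open>auto simp del: upt_Suc\<close>)

text \<open>
  The number of columns, and afterwards the number of rows, decreases to \<open>i + 1\<close>.  A positive minor of
  this order survives every round, and at the end there is only one left.
\<close>

lemma hessian_det_pos_of_totally_nonnegative:
  assumes tnn: "minors_satisfy (\<lambda>z. z \<ge> 0) (toep_entry c (s - 1)) (s - 1) (d - (s - 1))"
    and xy: "x > 0" "y > 0"
    and ex: "\<exists>I J. sorted_wrt (<) I \<and> set I \<subseteq> {..s - 1} \<and> length I = Suc i \<and>
      sorted_wrt (<) J \<and> set J \<subseteq> {..d - (s - 1)} \<and> length J = Suc i \<and> minor (toep_entry c (s - 1)) I J \<noteq> 0"
  shows "hessian_det c d i ([:y, x:] ^ (d - 2 * i)) > 0"
proof -
  have ds: "d - (s - 1) = Suc d - s" using i by simp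
  have base: "col_det (map (column_stage I 0) J) \<ge> 0"
    if "sorted_wrt (<) I" "set I \<subseteq> {..s - 1}" "length I = Suc i"
      "sorted_wrt (<) J" "set J \<subseteq> {..Suc d - s}" "length J = Suc i" for I J
    using column_stage_0[of I J] that minors_satisfyD[OF tnn that(1,2,4)] ds by simp
  have nn: "col_det (map (row_stage 0) I) \<ge> 0"
    if I: "sorted_wrt (<) I" "set I \<subseteq> {..s - 1}" "length I = Suc i" for I
    unfolding row_stage_0[OF I(3)]
    by (rule bidiagonal_iteration.nonneg[OF bidiagonal_column_stage, where r = "Suc i"])
      (use base[OF I] xy i s in \<open>auto simp del: upt_Suc\<close>)
  obtain I J where IJ: "sorted_wrt (<) I" "set I \<subseteq> {..s - 1}" "length I = Suc i"
      "sorted_wrt (<) J" "set J \<subseteq> {..Suc d - s}" "length J = Suc i" "minor (toep_entry c (s - 1)) I J \<noteq> 0"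
    using ex unfolding ds by blast
  have "\<exists>J. sorted_wrt (<) J \<and> set J \<subseteq> {..Suc d - s - (Suc d - s - i)} \<and> length J = Suc i \<and>
      col_det (map (column_stage I (Suc d - s - i)) J) > 0"
  proof (rule bidiagonal_iteration.exists_pos[OF bidiagonal_column_stage])
    have "col_det (map (column_stage I 0) J) > 0"
      using base[OF IJ(1-6)] IJ(7) column_stage_0[of I J] IJ ds by simp
    then show "\<exists>J. sorted_wrt (<) J \<and> set J \<subseteq> {..Suc d - s} \<and> length J = Suc i \<and> col_det (map (column_stage I 0) J) > 0"
      using IJ by blast
  qed (use base[OF IJ(1-3)] xy i s in auto)
  then obtain J' where J': "sorted_wrt (<) J'" "set J' \<subseteq> {..Suc d - s - (Suc d - s - i)}" "length J' = Suc i"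
      "col_det (map (column_stage I (Suc d - s - i)) J') > 0" by blast
  have "J' = [0..<Suc i]" using J' i s by (intro sorted_full_interval) auto
  then have posI: "col_det (map (row_stage 0) I) > 0" using J'(4) row_stage_0[OF IJ(3)] by simp
  have "\<exists>J. sorted_wrt (<) J \<and> set J \<subseteq> {..s - 1 - (s - 1 - i)} \<and> length J = Suc i \<and>
      col_det (map (row_stage (s - 1 - i)) J) > 0"
    by (rule bidiagonal_iteration.exists_pos[OF bidiagonal_row_stage])
      (use nn posI IJ xy i in \<open>auto intro!: exI[of _ I]\<close>)
  then obtain J'' where J'': "sorted_wrt (<) J''" "set J'' \<subseteq> {..s - 1 - (s - 1 - i)}" "length J'' = Suc i"
      "col_det (map (row_stage (s - 1 - i)) J'') > 0" by blast
  have "J'' = [0..<Suc i]" using J'' i by (intro sorted_full_interval) auto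
  then show ?thesis using J''(4) unfolding hessian_det_row_stage by simp
qed

end

section \<open>Change of coordinates\<close>

text \<open>
  For \<open>t\<^sup>2 \<noteq> 1\<close> these products form the basis of the polynomials of degree at most \<open>m\<close> that is adapted to
  the cone spanned by \<open>x + t\<close> and \<open>t x + 1\<close>.  For \<open>t = 0\<close> they are the monomials \<open>x\<^sup>j\<close>.
\<close>

definition cone_monomial :: "real \<Rightarrow> nat \<Rightarrow> nat \<Rightarrow> real poly" where
  "cone_monomial t m j = [:t, 1:] ^ j * [:1, t:] ^ (m - j)"

lemma degree_linear_powers:
  fixes u v w z :: "'a::comm_ring_1"
  shows "degree ([:u, v:] ^ a * [:w, z:] ^ b) \<le> a + b"
proof -
  have 1: "degree ([:u, v:] ^ a) \<le> 1 * a" for u v :: 'a and a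
    by (rule order.trans[OF degree_power_le]) (rule mult_right_mono, auto)
  show ?thesis
    by (rule order.trans[OF degree_mult_le]) (use 1[of u v a] 1[of w z b] in simp)
qed

lemma degree_cone_monomial: "j \<le> m \<Longrightarrow> degree (cone_monomial t m j) \<le> m"
  unfolding cone_monomial_def using degree_linear_powers[of t 1 j 1 t "m - j"] by simp

lemma coeff_linear_mult:
  "coeff ([:u, v:] * p) m = u * coeff p m + (if m = 0 then 0 else v * coeff p (m - 1))"
  for u v :: "'a::comm_ring_1"
  by (cases m) simp_all

lemma reversed_linear_mult:
  fixes u v :: "'a::comm_ring_1"
  assumes "degree p \<le> n" "degree p' \<le> n" "\<And>k. k \<le> n \<Longrightarrow> coeff p (n - k) = coeff p' k" "k \<le> Suc n"
  shows "coeff ([:u, v:] * p) (Suc n - k) = coeff ([:v, u:] * p') k"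
proof (cases "k = 0 \<or> k = Suc n")
  case True
  then show ?thesis
    using assms(3)[of 0] assms(3)[of n] coeff_eq_0[of p "Suc n"] coeff_eq_0[of p' "Suc n"] assms(1,2)
    unfolding coeff_linear_mult by auto
next
  case False
  then obtain k' where "k = Suc k'" "k' < n" using assms(4) by (cases k) auto
  then show ?thesis using assms(3)[of k] assms(3)[of k'] unfolding coeff_linear_mult
    by (simp add: Suc_diff_le Suc_diff_Suc add.commute)
qed

lemma coeff_reversed_power:
  fixes u v :: "'a::comm_ring_1"
  shows "k \<le> b \<Longrightarrow> coeff ([:u, v:] ^ b) (b - k) = coeff ([:v, u:] ^ b) k"
proof (induction b arbitrary: k)
  case (Suc b)
  have deg: "degree ([:u, v:] ^ b) \<le> b" for u v :: 'a
    using degree_linear_powers[of u v b 0 0 0] by simp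
  show ?case unfolding power_Suc
    by (rule reversed_linear_mult[OF deg deg Suc.IH Suc.prems])
qed simp

text \<open>
  Reversing the coefficients of a product exchanges the two linear factors.  Stated for \<open>a + b\<close> in place of the degree,
  since a factor may be constant.
\<close>

lemma coeff_reversed_product:
  fixes u v :: "'a::comm_ring_1"
  shows "k \<le> a + b \<Longrightarrow> coeff ([:u, v:] ^ a * [:v, u:] ^ b) (a + b - k) = coeff ([:v, u:] ^ a * [:u, v:] ^ b) k"
proof (induction a arbitrary: k)
  case 0
  then show ?case using coeff_reversed_power[of k b v u] by simp
next
  case (Suc a)
  have k: "k \<le> Suc (a + b)" using Suc.prems by simp
  show ?case unfolding power_Suc mult.assoc add_Suc
    by (rule reversed_linear_mult[OF degree_linear_powers degree_linear_powers Suc.IH k])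
qed

text \<open>
  Subtracting a multiple of \<open>(t x + 1)\<^sup>m\<close> makes \<open>p\<close> vanish at \<open>- t\<close>, so \<open>x + t\<close> can be divided off.  This
  needs that the two edges are not proportional, that is \<open>t\<^sup>2 \<noteq> 1\<close>.
\<close>

lemma cone_monomial_span:
  assumes t: "t * t \<noteq> 1" and "degree p \<le> m"
  shows "\<exists>g. p = (\<Sum>j\<le>m. smult (g j) (cone_monomial t m j))"
  using assms(2)
proof (induction m arbitrary: p)
  case 0
  then obtain a where "p = [:a:]" by (auto elim: degree_eq_zeroE)
  then show ?case by (intro exI[of _ "\<lambda>_. a"]) (simp add: cone_monomial_def)
next
  case (Suc m)
  define b where "b = poly p (- t) / (1 - t * t) ^ Suc m"
  have ne: "1 - t * t \<noteq> 0" using t by simp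
  have "poly ([:1, t:] ^ Suc m) (- t) = (1 - t * t) ^ Suc m" by (simp only: poly_power) simp
  then have "poly (p - smult b ([:1, t:] ^ Suc m)) (- t) = 0"
    using ne by (simp only: poly_diff poly_smult b_def) simp
  then have "[:t, 1:] dvd p - smult b ([:1, t:] ^ Suc m)"
    unfolding poly_eq_0_iff_dvd by simp
  then obtain r where r: "p - smult b ([:1, t:] ^ Suc m) = [:t, 1:] * r" by (rule dvdE)
  have "degree ([:1, t:] ^ Suc m) \<le> Suc m"
    using degree_cone_monomial[of 0 "Suc m" t] by (simp add: cone_monomial_def)
  then have "degree (p - smult b ([:1, t:] ^ Suc m)) \<le> Suc m"
    using Suc.prems by (intro degree_diff_le) (auto intro: order.trans[OF degree_smult_le])
  then have "degree ([:t, 1:] * r) \<le> Suc m" unfolding r .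
  moreover have "degree ([:t, 1:] * r) = Suc (degree r)" if "r \<noteq> 0"
    using degree_mult_eq[of "[:t, 1:]" r] that by (simp del: mult_pCons_left)
  ultimately have "degree r \<le> m" by (cases "r = 0") auto
  then obtain g where g: "r = (\<Sum>j\<le>m. smult (g j) (cone_monomial t m j))" using Suc.IH by blast
  have "p = smult b (cone_monomial t (Suc m) 0) + [:t, 1:] * r"
    using r by (simp add: cone_monomial_def algebra_simps)
  also have "[:t, 1:] * r = (\<Sum>j\<le>m. smult (g j) (cone_monomial t (Suc m) (Suc j)))"
    unfolding g sum_distrib_left by (simp only: cone_monomial_def mult_smult_right power_Suc mult.assoc diff_Suc_Suc)
  also have "smult b (cone_monomial t (Suc m) 0) + \<dots> = (\<Sum>j\<le>Suc m. smult (case j of 0 \<Rightarrow> b | Suc j \<Rightarrow> g j) (cone_monomial t (Suc m) j))"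
    by (subst sum.atMost_Suc_shift) simp
  finally show ?case by blast
qed

definition cone_monomial_mat :: "real \<Rightarrow> nat \<Rightarrow> real mat" where
  "cone_monomial_mat t m = mat (Suc m) (Suc m) (\<lambda>(q, k). coeff (cone_monomial t m q) k)"

lemma det_cone_monomial_mat_nonzero:
  assumes "t * t \<noteq> 1"
  shows "det (cone_monomial_mat t m) \<noteq> 0"
proof -
  have "\<exists>g. monom 1 l = (\<Sum>j\<le>m. smult (g j) (cone_monomial t m j))" if "l \<le> m" for l
    using that cone_monomial_span[OF assms, of "monom 1 l" m] by (simp add: degree_monom_eq)
  then obtain g where g: "\<And>l. l \<le> m \<Longrightarrow> monom 1 l = (\<Sum>j\<le>m. smult (g l j) (cone_monomial t m j))" by metis
  define R where "R = mat (Suc m) (Suc m) (\<lambda>(l, j). g l j)"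
  have "R * cone_monomial_mat t m = 1\<^sub>m (Suc m)"
  proof (rule eq_matI)
    fix l k assume "l < dim_row (1\<^sub>m (Suc m))" "k < dim_col (1\<^sub>m (Suc m))"
    then have lk: "l \<le> m" "k \<le> m" by auto
    have "(R * cone_monomial_mat t m) $$ (l, k) = (\<Sum>j\<le>m. g l j * coeff (cone_monomial t m j) k)"
      using lk by (simp add: R_def cone_monomial_mat_def scalar_prod_def atLeast0LessThan lessThan_Suc_atMost)
    also have "\<dots> = coeff (monom 1 l) k"
      unfolding g[OF lk(1)] by (simp add: coeff_sum)
    finally show "(R * cone_monomial_mat t m) $$ (l, k) = 1\<^sub>m (Suc m) $$ (l, k)"
      using lk by simp
  qed (auto simp: R_def cone_monomial_mat_def)
  then have "det R * det (cone_monomial_mat t m) = 1"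
    using det_mult[of R "Suc m" "cone_monomial_mat t m"] by (simp add: R_def cone_monomial_mat_def)
  then show ?thesis by auto
qed

text \<open>
  The normalized coefficients of the form in coordinates adapted to the cone.
\<close>

definition cone_seq :: "(nat \<Rightarrow> real) \<Rightarrow> nat \<Rightarrow> real \<Rightarrow> nat \<Rightarrow> real" where
  "cone_seq c d t k = umbral c d (cone_monomial t d k)"

text \<open>
  Both matrices represent the same bilinear form, so they differ by a base change on either side.  By
  the symmetry under coefficient reversal the two base changes have the same determinant,
  and the factor is a square.
\<close>

lemma toeplitz_det_cone_seq:
  assumes "a + 2 * i \<le> d"
  shows "toeplitz_det (cone_seq c d t) (Suc i) (i + a) = (det (cone_monomial_mat t i))\<^sup>2 * hessian_det c d i (cone_monomial t (d - 2 * i) a)"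
proof -
  let ?n = "Suc i"
  let ?L = "cone_monomial t (d - 2 * i) a"
  define P where "P = cone_monomial_mat t i"
  define E where "E = mat ?n ?n (\<lambda>(k, l). umbral c d (?L * monom 1 (i + l - k)))"
  define M where "M = mat ?n ?n (\<lambda>(p, q). cone_seq c d t (i + a + q - p))"
  have carr: "P \<in> carrier_mat ?n ?n" "E \<in> carrier_mat ?n ?n" "P\<^sup>T \<in> carrier_mat ?n ?n"
    by (simp_all add: P_def cone_monomial_mat_def E_def)
  have "M = P * E * P\<^sup>T"
  proof (rule eq_matI)
    fix p q assume "p < dim_row (P * E * P\<^sup>T)" "q < dim_col (P * E * P\<^sup>T)"
    then have pq: "p \<le> i" "q \<le> i" by (auto simp: P_def cone_monomial_mat_def)
    define f where "f = cone_monomial t i (i - p)"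
    define h where "h = cone_monomial t i q"
    \<comment> \<open>the row basis is listed in reverse order, so its coefficients are those of the column basis\<close>
    have f: "f = (\<Sum>k\<le>i. monom (P $$ (p, k)) (i - k))"
    proof -
      have "f = (\<Sum>k\<le>i. monom (coeff f k) k)"
        using degree_cone_monomial[of "i - p" i t] by (simp add: poly_as_sum_of_monoms' f_def)
      also have "\<dots> = (\<Sum>k\<le>i. monom (coeff f (i - k)) (i - k))"
        by (rule sum.reindex_bij_witness[of _ "\<lambda>k. i - k" "\<lambda>k. i - k"]) auto
      also have "\<dots> = (\<Sum>k\<le>i. monom (P $$ (p, k)) (i - k))"
      proof (rule sum.cong)
        fix k assume "k \<in> {..i}"
        then have "coeff f (i - k) = coeff (cone_monomial t i p) k"
          using coeff_reversed_product[of k "i - p" p t 1] pq by (simp add: f_def cone_monomial_def mult.commute)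
        then show "monom (coeff f (i - k)) (i - k) = monom (P $$ (p, k)) (i - k)"
          using pq \<open>k \<in> {..i}\<close> by (simp add: P_def cone_monomial_mat_def)
      qed simp
      finally show ?thesis .
    qed
    have "h = (\<Sum>l\<le>i. monom (coeff h l) l)"
      using degree_cone_monomial[of q i t] pq by (simp add: poly_as_sum_of_monoms' h_def)
    also have "\<dots> = (\<Sum>l\<le>i. monom (P $$ (q, l)) l)"
      using pq by (intro sum.cong refl) (simp add: P_def cone_monomial_mat_def h_def)
    finally have h: "h = (\<Sum>l\<le>i. monom (P $$ (q, l)) l)" .
    have "cone_monomial t d (i + a + q - p) = ?L * (f * h)"
    proof -
      have e: "i + a + q - p = a + (i - p) + q" "d - (i + a + q - p) = d - 2 * i - a + p + (i - q)"
        using pq assms by auto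
      show ?thesis unfolding cone_monomial_def f_def h_def e(2) unfolding e(1) power_add using pq by (simp add: mult_ac)
    qed
    also have "\<dots> = (\<Sum>k\<le>i. \<Sum>l\<le>i. smult (P $$ (p, k) * P $$ (q, l)) (?L * monom 1 (i - k + l)))"
      unfolding f h sum_product unfolding sum_distrib_left
      by (intro sum.cong refl) (simp add: mult_monom smult_monom flip: mult_smult_right)
    finally have "cone_seq c d t (i + a + q - p)
        = (\<Sum>k\<le>i. \<Sum>l\<le>i. P $$ (p, k) * P $$ (q, l) * umbral c d (?L * monom 1 (i - k + l)))"
      by (simp only: cone_seq_def umbral_sum umbral_smult)
    also have "\<dots> = (\<Sum>k\<le>i. \<Sum>l\<le>i. P $$ (p, k) * E $$ (k, l) * P $$ (q, l))"
      by (intro sum.cong refl) (auto simp: E_def)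
    also have "\<dots> = (P * E * P\<^sup>T) $$ (p, q)"
      using pq carr by (subst sum.swap) (simp add: P_def cone_monomial_mat_def E_def scalar_prod_def atLeast0LessThan lessThan_Suc_atMost sum_distrib_right)
    finally show "M $$ (p, q) = (P * E * P\<^sup>T) $$ (p, q)" using pq by (simp add: M_def)
  qed (simp_all add: M_def P_def cone_monomial_mat_def)
  then have "det M = det P * det E * det P"
    using carr det_mult[of "P * E" ?n "P\<^sup>T"] det_mult[of P ?n E] det_transpose[of P ?n] by simp
  moreover have "toeplitz_det (cone_seq c d t) ?n (i + a) = det M"
    unfolding toeplitz_det_def col_det_def M_def by (rule arg_cong[where f = det]) (rule eq_matI, auto simp del: upt_Suc)
  moreover have "hessian_det c d i ?L = det E"
    unfolding hessian_det_def col_det_def E_def by (rule arg_cong[where f = det]) (rule eq_matI, auto simp del: upt_Suc)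
  ultimately show ?thesis by (simp add: P_def power2_eq_square)
qed

text \<open>
  A recurrence of length \<open>s\<close> says that \<open>\<Lambda>\<close> kills all multiples of a polynomial of degree at most \<open>s\<close>, and
  this does not depend on the basis in which the polynomial is written.
\<close>

lemma cone_seq_recurrence:
  assumes t: "t * t \<noteq> 1"
    and rec: "\<And>q. q + s \<le> d \<Longrightarrow> (\<Sum>j\<le>s. g j * c (q + j)) = 0" and g: "j0 \<le> s" "g j0 \<noteq> 0" and "s \<le> d"
  shows "\<exists>g'. (\<exists>j\<le>s. g' j \<noteq> 0) \<and> (\<forall>q. q + s \<le> d \<longrightarrow> (\<Sum>j\<le>s. g' j * cone_seq c d t (q + j)) = 0)"
proof -
  define G where "G = (\<Sum>j\<le>s. monom (g j) j)"
  have "degree G \<le> s" unfolding G_def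
    by (intro degree_sum_le) (auto intro: order.trans[OF degree_monom_le])
  then obtain g' where g': "G = (\<Sum>j\<le>s. smult (g' j) (cone_monomial t s j))" using cone_monomial_span[OF t] by blast
  have cG: "coeff G j0 = g j0" unfolding G_def coeff_sum using g(1) by simp
  have "\<exists>j\<le>s. g' j \<noteq> 0"
  proof (rule ccontr)
    assume "\<not> ?thesis"
    then have "G = 0" unfolding g' by simp
    then show False using cG g(2) by simp
  qed
  moreover have "(\<Sum>j\<le>s. g' j * cone_seq c d t (q + j)) = 0" if q: "q + s \<le> d" for q
  proof -
    define h where "h = cone_monomial t (d - s) q"
    have hd: "degree h \<le> d - s" unfolding h_def by (rule degree_cone_monomial) (use q in simp)
    have "(\<Sum>j\<le>s. g' j * cone_seq c d t (q + j)) = umbral c d (G * h)"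
    proof -
      have "cone_monomial t s j * h = cone_monomial t d (q + j)" if "j \<le> s" for j
      proof -
        have e: "d - (q + j) = (s - j) + (d - s - q)" using that q by simp
        show ?thesis unfolding cone_monomial_def h_def e power_add by (simp add: mult_ac)
      qed
      then have "G * h = (\<Sum>j\<le>s. smult (g' j) (cone_monomial t d (q + j)))"
        unfolding g' sum_distrib_right by (intro sum.cong) simp_all
      then show ?thesis by (simp only: umbral_sum umbral_smult cone_seq_def)
    qed
    also have "G * h = (\<Sum>l\<le>d - s. \<Sum>j\<le>s. smult (coeff h l * g j) (monom 1 (l + j)))"
    proof -
      have "G * h = (\<Sum>j\<le>s. \<Sum>l\<le>d - s. monom (g j) j * monom (coeff h l) l)"
        unfolding G_def poly_as_sum_of_monoms'[OF hd, symmetric, THEN arg_cong[where f = "\<lambda>z. _ * z"]]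
        by (simp only: sum_product)
      also have "\<dots> = (\<Sum>l\<le>d - s. \<Sum>j\<le>s. smult (coeff h l * g j) (monom 1 (l + j)))"
        by (subst sum.swap) (simp add: mult_monom smult_monom add.commute mult.commute)
      finally show ?thesis .
    qed
    also have "umbral c d \<dots> = (\<Sum>l\<le>d - s. coeff h l * (\<Sum>j\<le>s. g j * c (l + j)))"
      unfolding umbral_sum umbral_smult sum_distrib_left
      using assms(5) by (intro sum.cong refl) (simp add: umbral_monom)
    also have "\<dots> = 0"
    proof (intro sum.neutral ballI)
      fix l assume "l \<in> {..d - s}"
      then have "(\<Sum>j\<le>s. g j * c (l + j)) = 0" using assms(5) by (intro rec) auto
      then show "coeff h l * (\<Sum>j\<le>s. g j * c (l + j)) = 0" by simp
    qed
    finally show ?thesis .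
  qed
  ultimately show ?thesis by blast
qed

section \<open>Shrinking the quadrant to a ray\<close>

lemma continuous_on_col_det:
  fixes cs :: "'b::topological_space \<Rightarrow> (nat \<Rightarrow> real) list"
  assumes len: "\<And>t. length (cs t) = n"
    and cont: "\<And>p q. p < n \<Longrightarrow> q < n \<Longrightarrow> continuous_on S (\<lambda>t. (cs t ! q) p)"
  shows "continuous_on S (\<lambda>t. col_det (cs t))"
proof -
  have eq: "col_det (cs t) = (\<Sum>\<pi> | \<pi> permutes {0..<n}. signof \<pi> * (\<Prod>i = 0..<n. (cs t ! \<pi> i) i))" for t
  proof -
    have "col_det (cs t) = (\<Sum>\<pi> | \<pi> permutes {0..<n}. signof \<pi> *
        (\<Prod>i = 0..<n. mat n n (\<lambda>(p, q). (cs t ! q) p) $$ (i, \<pi> i)))"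
      unfolding col_det_def len by (rule det_def') simp
    also have "\<dots> = (\<Sum>\<pi> | \<pi> permutes {0..<n}. signof \<pi> * (\<Prod>i = 0..<n. (cs t ! \<pi> i) i))"
    proof (intro sum.cong refl arg_cong2[where f = "(*)"] prod.cong)
      fix \<pi> i assume "\<pi> \<in> {\<pi>. \<pi> permutes {0..<n}}" "i \<in> {0..<n}"
      then have "\<pi> i < n" "i < n" using permutes_in_image[of \<pi> "{0..<n}" i] by auto
      then show "mat n n (\<lambda>(p, q). (cs t ! q) p) $$ (i, \<pi> i) = (cs t ! \<pi> i) i" by simp
    qed
    finally show ?thesis .
  qed
  show ?thesis unfolding eq
  proof (intro continuous_on_sum continuous_on_mult continuous_on_const continuous_on_prod)
    fix \<pi> i assume "\<pi> \<in> {\<pi>. \<pi> permutes {0..<n}}" "i \<in> {0..<n}"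
    then have "\<pi> i < n" "i < n" using permutes_in_image[of \<pi> "{0..<n}" i] by auto
    then show "continuous_on S (\<lambda>t. (cs t ! \<pi> i) i)" by (intro cont)
  qed
qed

lemma continuous_on_coeff_mult:
  fixes P Q :: "'b::topological_space \<Rightarrow> real poly"
  assumes "\<And>n. continuous_on S (\<lambda>t. coeff (P t) n)" "\<And>n. continuous_on S (\<lambda>t. coeff (Q t) n)"
  shows "continuous_on S (\<lambda>t. coeff (P t * Q t) n)"
  unfolding coeff_mult by (intro continuous_on_sum continuous_on_mult assms)

lemma continuous_on_coeff_power:
  fixes P :: "'b::topological_space \<Rightarrow> real poly"
  assumes "\<And>n. continuous_on S (\<lambda>t. coeff (P t) n)"
  shows "continuous_on S (\<lambda>t. coeff (P t ^ k) n)"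
proof (induction k arbitrary: n)
  case (Suc k)
  show ?case unfolding power_Suc by (intro continuous_on_coeff_mult assms Suc)
qed (simp add: continuous_on_const)

lemma continuous_on_coeff_cone_monomial: "continuous_on S (\<lambda>t. coeff (cone_monomial t m j) n)"
proof -
  have "continuous_on S (\<lambda>t. coeff [:t, 1:] n)" "continuous_on S (\<lambda>t. coeff [:1, t:] n)" for n
    by (cases n; cases "n - 1"; simp add: coeff_pCons continuous_on_id continuous_on_const)+
  then show ?thesis unfolding cone_monomial_def by (intro continuous_on_coeff_mult continuous_on_coeff_power)
qed

lemma continuous_on_umbral:
  assumes "\<And>n. continuous_on S (\<lambda>t. coeff (P t) n)"
  shows "continuous_on S (\<lambda>t. umbral c d (P t))"
  unfolding umbral_def by (intro continuous_on_sum continuous_on_mult assms continuous_on_const)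

lemma continuous_on_hessian_det_cone_monomial: "continuous_on S (\<lambda>t. hessian_det c d i (cone_monomial t m j))"
  unfolding hessian_det_def
proof (rule continuous_on_col_det)
  fix p q assume "p < Suc i" "q < Suc i"
  then show "continuous_on S (\<lambda>t. (map (\<lambda>q p. umbral c d (cone_monomial t m j * monom 1 (i + q - p))) [0..<Suc i] ! q) p)"
    by (simp del: upt_Suc)
      (intro continuous_on_umbral continuous_on_coeff_mult continuous_on_coeff_cone_monomial continuous_on_const)
qed simp

lemma continuous_on_minor_cone_seq: "continuous_on S (\<lambda>t. minor (toep_entry (cone_seq c d t) i) I J)"
  unfolding minor_def
proof (rule continuous_on_col_det)
  fix p q assume "p < length J" "q < length J"
  then show "continuous_on S (\<lambda>t. (map (\<lambda>j p. toep_entry (cone_seq c d t) i (I ! p) j) J ! q) p)"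
    by (simp add: toep_entry_def cone_seq_def) (intro continuous_on_umbral continuous_on_coeff_cone_monomial)
qed simp

lemma minors_nonneg_limit:
  assumes "t0 < t1"
    and pos: "\<And>t. t0 < t \<Longrightarrow> t < t1 \<Longrightarrow> minors_satisfy (\<lambda>z. z > 0) (toep_entry (cone_seq c d t) i) M N"
  shows "minors_satisfy (\<lambda>z. z \<ge> 0) (toep_entry (cone_seq c d t0) i) M N"
  unfolding minors_satisfy_def
proof (intro allI impI, elim conjE)
  fix I J assume IJ: "sorted_wrt (<) I" "sorted_wrt (<) J" "set I \<subseteq> {..M}" "set J \<subseteq> {..N}" "length I = length J"
  let ?f = "\<lambda>t. minor (toep_entry (cone_seq c d t) i) I J"
  have "continuous_on UNIV ?f" by (rule continuous_on_minor_cone_seq)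
  then have "isCont ?f t0" by (simp add: continuous_on_eq_continuous_at)
  then have "(?f \<longlongrightarrow> ?f t0) (at_right t0)"
    unfolding isCont_def by (rule filterlim_mono) (auto simp: at_le)
  moreover have "eventually (\<lambda>t. 0 \<le> ?f t) (at_right t0)"
    using assms(1) IJ less_imp_le[OF minors_satisfyD[OF pos]]
    by (auto simp: eventually_at_right[OF assms(1)] intro!: exI[of _ t1])
  ultimately show "?f t0 \<ge> 0" by (intro tendsto_lowerbound) auto
qed

text \<open>
  The deformation argument.  \<open>E\<close> collects the finitely many determinants that have to stay positive and
  \<open>B\<close> is the set of parameters at which one of them fails to be.  At the largest element of \<open>B\<close> the
  matrices are totally nonnegative with nonzero corner minors, so \<open>toeplitz_det_pos_of_corners\<close> applies
  and contradicts the choice of \<open>B\<close>.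
\<close>

lemma cone_seq_totally_positive:
  assumes s: "s \<ge> 1" "2 * s \<le> Suc (Suc d)" and t1: "0 \<le> t1" "t1 < 1"
    and pure1: "\<And>i t. i < s \<Longrightarrow> t1 \<le> t \<Longrightarrow> t \<le> 1 \<Longrightarrow> hessian_det c d i ([:t, 1:] ^ (d - 2 * i)) > 0"
    and pure2: "\<And>i t. i < s \<Longrightarrow> t1 \<le> t \<Longrightarrow> t \<le> 1 \<Longrightarrow> hessian_det c d i ([:1, t:] ^ (d - 2 * i)) > 0"
    and rec: "s \<le> d \<Longrightarrow> \<exists>g. (\<exists>j\<le>s. g j \<noteq> 0) \<and> (\<forall>q. q + s \<le> d \<longrightarrow> (\<Sum>j\<le>s. g j * c (q + j)) = 0)"
    and t: "t1 \<le> t" "t < 1" and i: "i < s"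
  shows "minors_satisfy (\<lambda>z. z > 0) (toep_entry (cone_seq c d t) i) i (d - i)"
proof -
  define E where "E = (\<lambda>(i, a) t. hessian_det c d i (cone_monomial t (d - 2 * i) a))"
  define K where "K = (SIGMA i:{..<s}. {..d - 2 * i})"
  define B where "B = (\<Union>k\<in>K. {t \<in> {t1..1}. E k t \<le> 0})"
  have contE: "continuous_on S (E k)" for S k
    unfolding E_def by (cases k) (simp add: continuous_on_hessian_det_cone_monomial)
  have finK: "finite K" unfolding K_def by simp
  have tp: "minors_satisfy (\<lambda>z. z > 0) (toep_entry (cone_seq c d t) i) i (d - i)"
    if "\<And>k. k \<in> K \<Longrightarrow> E k t > 0" "t1 \<le> t" "t < 1" "i < s" for t i
  proof (rule toeplitz_fekete)
    fix r m assume rm: "r \<le> Suc i" "r \<le> Suc m" "m + r \<le> Suc d"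
    show "toeplitz_det (cone_seq c d t) r m > 0"
    proof (cases r)
      case 0
      then show ?thesis by (simp add: toeplitz_det_def col_det_def)
    next
      case (Suc j)
      define a where "a = m - j"
      have a: "m = j + a" "a + 2 * j \<le> d" using rm Suc by (auto simp: a_def)
      have "t * t \<noteq> 1" using that(2,3) t1 by (metis abs_of_nonneg abs_square_eq_1 less_irrefl order_trans power2_eq_square)
      then have "det (cone_monomial_mat t j) \<noteq> 0" by (rule det_cone_monomial_mat_nonzero)
      moreover have "E (j, a) t > 0" using rm Suc that(4) a by (intro that(1)) (auto simp: K_def)
      ultimately show ?thesis unfolding Suc a(1) toeplitz_det_cone_seq[OF a(2)] by (simp add: E_def)
    qed
  qed (use that(4) s in auto)
  have "B = {}"
  proof (rule ccontr)
    assume "B \<noteq> {}"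
    have "closed B" unfolding B_def
    proof (intro closed_UN finK ballI)
      fix k assume "k \<in> K"
      show "closed {t \<in> {t1..1}. E k t \<le> 0}"
        unfolding Collect_conj_eq Collect_mem_eq
        by (intro closed_Int closed_atLeastAtMost closed_Collect_le contE continuous_on_const)
    qed
    moreover have "{t1..1} \<inter> B = B" by (auto simp: B_def)
    ultimately have "compact B" by (metis compact_Int_closed compact_Icc)
    then obtain t0 where t0: "t0 \<in> B" "\<And>t. t \<in> B \<Longrightarrow> t \<le> t0"
      using compact_attains_sup[OF _ \<open>B \<noteq> {}\<close>] by blast
    then obtain k0 where k0: "k0 \<in> K" "E k0 t0 \<le> 0" "t1 \<le> t0" "t0 \<le> 1" by (auto simp: B_def)
    obtain i0 a0 where k0': "k0 = (i0, a0)" "i0 < s" "a0 \<le> d - 2 * i0" using k0(1) by (auto simp: K_def)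
    have "t0 \<noteq> 1"
    proof
      assume "t0 = 1"
      then have "cone_monomial t0 (d - 2 * i0) a0 = [:t0, 1:] ^ (d - 2 * i0)"
        by (simp only: cone_monomial_def power_add[symmetric] le_add_diff_inverse k0'(3))
      then show False using pure1[of i0 t0] k0 k0' by (simp add: E_def)
    qed
    then have t01: "t0 < 1" using k0 by simp
    have Epos: "E k t > 0" if "k \<in> K" "t0 < t" "t \<le> 1" for k t
    proof (rule ccontr)
      assume "\<not> E k t > 0"
      then have "t \<in> B" using that k0 by (auto simp: B_def not_less)
      then show False using t0(2) that by force
    qed
    \<comment> \<open>beyond \<open>t0\<close> all determinants are positive, so Fekete applies there and the limit is nonnegative\<close>
    have tnn: "minors_satisfy (\<lambda>z. z \<ge> 0) (toep_entry (cone_seq c d t0) i) i (d - i)" if "i < s" for i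
      by (rule minors_nonneg_limit[OF t01]) (use tp Epos k0 that in auto)
    have sq: "t0 * t0 \<noteq> 1" using t01 k0(3) t1(1)
      by (metis abs_of_nonneg abs_square_eq_1 less_irrefl order_trans power2_eq_square)
    have "toeplitz_det (cone_seq c d t0) (Suc i0) (i0 + a0) > 0"
    proof (rule toeplitz_det_pos_of_corners[OF s tnn])
      fix r assume r: "1 \<le> r" "r \<le> s"
      then obtain j where j: "r = Suc j" by (cases r) auto
      have jd: "2 * j \<le> d" using r s j by simp
      have ne: "det (cone_monomial_mat t0 j) \<noteq> 0" by (rule det_cone_monomial_mat_nonzero[OF sq])
      have "hessian_det c d j (cone_monomial t0 (d - 2 * j) 0) > 0"
        using pure2[of j t0] k0 r j by (simp add: cone_monomial_def)
      then show "toeplitz_det (cone_seq c d t0) r (r - 1) \<noteq> 0"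
        using toeplitz_det_cone_seq[of 0 j d c t0] ne jd by (simp add: j)
      have "hessian_det c d j (cone_monomial t0 (d - 2 * j) (d - 2 * j)) > 0"
        using pure1[of j t0] k0 r j by (simp add: cone_monomial_def)
      moreover have "Suc d - r = j + (d - 2 * j)" using jd j by simp
      ultimately show "toeplitz_det (cone_seq c d t0) r (Suc d - r) \<noteq> 0"
        using toeplitz_det_cone_seq[of "d - 2 * j" j d c t0] ne jd by (simp add: j)
    next
      assume sd: "s \<le> d"
      then obtain g j where "\<And>q. q + s \<le> d \<Longrightarrow> (\<Sum>j\<le>s. g j * c (q + j)) = 0" "j \<le> s" "g j \<noteq> 0"
        using rec by blast
      from cone_seq_recurrence[OF sq this sd]
      show "\<exists>g. (\<exists>j\<le>s. g j \<noteq> 0) \<and> (\<forall>q. q + s \<le> d \<longrightarrow> (\<Sum>j\<le>s. g j * cone_seq c d t0 (q + j)) = 0)" .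
    qed (use k0' s in auto)
    moreover have "a0 + 2 * i0 \<le> d" using k0' s by auto
    ultimately have "E k0 t0 > 0"
      using det_cone_monomial_mat_nonzero[OF sq, of i0] by (simp add: toeplitz_det_cone_seq E_def k0' zero_less_mult_iff)
    then show False using k0(2) by simp
  qed
  then have "E k t > 0" if "k \<in> K" for k
    using that t by (auto simp: B_def not_le) (meson not_le less_imp_le)
  then show ?thesis by (rule tp) (use t i in auto)
qed

lemma cone_seq_0:
  assumes "k \<le> d"
  shows "cone_seq c d 0 k = c k"
proof -
  have "[:1, 0 :: real:] ^ n = 1" for n by (metis one_pCons pCons_0_0 power_one)
  then have "cone_monomial 0 d k = monom 1 k" by (simp only: cone_monomial_def monom_altdef) simp
  then show ?thesis using assms by (simp add: cone_seq_def umbral_monom)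
qed

lemma minors_satisfy_cone_seq_0:
  assumes "minors_satisfy P (toep_entry (cone_seq c d 0) i) i (d - i)" "i \<le> d"
  shows "minors_satisfy P (toep_entry c i) i (d - i)"
  unfolding minors_satisfy_def
proof (intro allI impI, elim conjE)
  fix I J assume IJ: "sorted_wrt (<) I" "sorted_wrt (<) J" "set I \<subseteq> {..i}" "set J \<subseteq> {..d - i}" "length I = length J"
  have "minor (toep_entry c i) I J = minor (toep_entry (cone_seq c d 0) i) I J"
    unfolding minor_def
  proof (rule col_det_cong)
    fix p q assume "p < length (map (\<lambda>j p. toep_entry c i (I ! p) j) J)" "q < length (map (\<lambda>j p. toep_entry c i (I ! p) j) J)"
    then have q: "q < length J" by simp_all
    then have "J ! q \<le> d - i" using IJ(4) nth_mem[of q J] by blast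
    then have "i + J ! q - I ! p \<le> d" using assms(2) by auto
    then show "(map (\<lambda>j p. toep_entry c i (I ! p) j) J ! q) p = (map (\<lambda>j p. toep_entry (cone_seq c d 0) i (I ! p) j) J ! q) p"
      using q by (simp add: toep_entry_def cone_seq_0)
  qed simp
  then show "P (minor (toep_entry c i) I J)" using minors_satisfyD[OF assms(1) IJ(1,3,2,4,5)] by simp
qed

section \<open>Values of the higher Hessians\<close>

lemma bicoeff_dX: "bicoeff (dX F) a b = of_nat (Suc a) * bicoeff F (Suc a) b"
  by (simp add: bicoeff_def dX_def coeff_map_poly coeff_pderiv)

lemma bicoeff_dY: "bicoeff (dY F) a b = of_nat (Suc b) * bicoeff F a (Suc b)"
  by (simp add: bicoeff_def dY_def coeff_pderiv of_nat_poly)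

lemma bicoeff_dX_power: "fact a * bicoeff ((dX ^^ m) F) a b = fact (a + m) * bicoeff F (a + m) b"
proof (induction m arbitrary: F)
  case (Suc m)
  have "fact a * bicoeff ((dX ^^ Suc m) F) a b = fact a * bicoeff ((dX ^^ m) (dX F)) a b"
    by (simp only: funpow_Suc_right o_def)
  also have "\<dots> = fact (a + m) * bicoeff (dX F) (a + m) b" by (rule Suc.IH)
  finally show ?case by (simp add: bicoeff_dX algebra_simps)
qed simp

lemma bicoeff_dY_power: "fact b * bicoeff ((dY ^^ m) F) a b = fact (b + m) * bicoeff F a (b + m)"
proof (induction m arbitrary: F)
  case (Suc m)
  have "fact b * bicoeff ((dY ^^ Suc m) F) a b = fact b * bicoeff ((dY ^^ m) (dY F)) a b"
    by (simp only: funpow_Suc_right o_def)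
  also have "\<dots> = fact (b + m) * bicoeff (dY F) a (b + m)" by (rule Suc.IH)
  finally show ?case by (simp add: bicoeff_dY algebra_simps)
qed simp

lemma bicoeff_deriv:
  "fact a * fact b * bicoeff ((dX ^^ m) ((dY ^^ n) F)) a b = fact (a + m) * fact (b + n) * bicoeff F (a + m) (b + n)"
proof -
  have "fact a * fact b * bicoeff ((dX ^^ m) ((dY ^^ n) F)) a b
      = fact b * (fact a * bicoeff ((dX ^^ m) ((dY ^^ n) F)) a b)" by simp
  also have "\<dots> = fact (a + m) * (fact b * bicoeff ((dY ^^ n) F) (a + m) b)"
    unfolding bicoeff_dX_power by simp
  also have "\<dots> = fact (a + m) * (fact (b + n) * bicoeff F (a + m) (b + n))"
    unfolding bicoeff_dY_power ..
  finally show ?thesis by simp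
qed

lemma bieval_form:
  assumes "G \<in> forms e"
  shows "bieval G X Y = (\<Sum>a\<le>e. bicoeff G a (e - a) * X ^ a * Y ^ (e - a))"
proof -
  have G: "coeff G b = (if b \<le> e then monom (bicoeff G (e - b) b) (e - b) else 0)" for b
  proof (rule poly_eqI)
    fix a
    have "coeff (coeff G b) a = 0" if "a + b \<noteq> e"
      using assms that by (auto simp: forms_def bicoeff_def)
    then show "coeff (coeff G b) a = coeff (if b \<le> e then monom (bicoeff G (e - b) b) (e - b) else 0) a"
      by (cases "a + b = e") (auto simp: bicoeff_def)
  qed
  have "degree G \<le> e" by (rule degree_le) (auto simp: G)
  then have "poly G [:Y:] = (\<Sum>b\<le>e. coeff G b * [:Y:] ^ b)"
    unfolding poly_altdef by (intro sum.mono_neutral_left) (auto simp: coeff_eq_0)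
  then have "bieval G X Y = (\<Sum>b\<le>e. bicoeff G (e - b) b * X ^ (e - b) * Y ^ b)"
    by (simp add: bieval_def poly_sum G poly_monom poly_power)
  also have "\<dots> = (\<Sum>a\<le>e. bicoeff G a (e - a) * X ^ a * Y ^ (e - a))"
    by (rule sum.reindex_bij_witness[of _ "\<lambda>k. e - k" "\<lambda>k. e - k"]) auto
  finally show ?thesis .
qed

lemma form_bicoeff:
  assumes "F \<in> forms d" "k \<le> d"
  shows "fact k * fact (d - k) * bicoeff F k (d - k) = fact d * normalized_coeff d F k"
proof -
  have "bicoeff F k (d - k) = normalized_coeff d F k * real (d choose k)"
    using assms(2) by (simp add: normalized_coeff_def)
  moreover have "fact d = fact k * fact (d - k) * real (d choose k)"
    using binomial_fact_lemma[OF assms(2)] by (metis of_nat_fact of_nat_mult)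
  ultimately show ?thesis by (simp only: mult_ac)
qed

text \<open>
  The derivatives of \<open>F\<close> are umbral evaluations because the binomial coefficients in the definition
  of \<open>c\<close> turn into those of \<open>(X x + Y)\<^sup>e\<close>.
\<close>

lemma bieval_deriv:
  assumes F: "F \<in> forms d" and mn: "m + n \<le> d"
  shows "bieval ((dX ^^ m) ((dY ^^ n) F)) X Y
    = fact d / fact (d - (m + n)) * umbral (normalized_coeff d F) d ([:Y, X:] ^ (d - (m + n)) * monom 1 m)"
proof -
  define e where "e = d - (m + n)"
  define G where "G = (dX ^^ m) ((dY ^^ n) F)"
  let ?c = "normalized_coeff d F"
  have G: "G \<in> forms e"
    unfolding forms_def
  proof (intro CollectI allI impI)
    fix a b assume "bicoeff G a b \<noteq> 0"
    then have "fact (a + m) * fact (b + n) * bicoeff F (a + m) (b + n) \<noteq> 0"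
      unfolding bicoeff_deriv[symmetric] by (simp add: G_def)
    then have "a + m + (b + n) = d" using F by (auto simp: forms_def)
    then show "a + b = e" by (simp add: e_def)
  qed
  have "bieval G X Y = (\<Sum>a\<le>e. bicoeff G a (e - a) * X ^ a * Y ^ (e - a))"
    by (rule bieval_form[OF G])
  also have "\<dots> = (\<Sum>a\<le>e. fact d / fact e * (coeff ([:Y, X:] ^ e) a * ?c (a + m)))"
  proof (rule sum.cong)
    fix a assume "a \<in> {..e}"
    then have a: "a \<le> e" by simp
    have "d - (a + m) = e - a + n" using a mn by (simp add: e_def)
    then have "fact a * fact (e - a) * bicoeff G a (e - a) = fact d * ?c (a + m)"
      using bicoeff_deriv[of a "e - a" m n F] form_bicoeff[OF F, of "a + m"] a mn
      by (simp add: G_def e_def)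
    then have "real (e choose a) * (fact a * fact (e - a) * bicoeff G a (e - a))
        = real (e choose a) * (fact d * ?c (a + m))" by (simp only:)
    then have "fact a * fact (e - a) * real (e choose a) * bicoeff G a (e - a)
        = fact d * (real (e choose a) * ?c (a + m))" by (simp only: mult_ac)
    moreover have "fact a * fact (e - a) * real (e choose a) = fact e"
      using binomial_fact_lemma[OF a] by (metis of_nat_fact of_nat_mult)
    ultimately have "bicoeff G a (e - a) = fact d / fact e * (real (e choose a) * ?c (a + m))"
      by (simp only: times_divide_eq_left nonzero_eq_divide_eq[OF fact_nonzero] mult.commute)
    then show "bicoeff G a (e - a) * X ^ a * Y ^ (e - a) = fact d / fact e * (coeff ([:Y, X:] ^ e) a * ?c (a + m))"
      using a by (simp add: coeff_linear_poly_power)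
  qed simp
  also have "\<dots> = fact d / fact e * umbral ?c d ([:Y, X:] ^ e * monom 1 m)"
  proof -
    have "umbral ?c d ([:Y, X:] ^ e * monom 1 m) = (\<Sum>k\<in>{m..m + e}. coeff ([:Y, X:] ^ e) (k - m) * ?c k)"
      unfolding umbral_def
    proof (rule sum.mono_neutral_cong_right)
      have deg: "degree ([:Y, X:] ^ e) \<le> e" using degree_linear_powers[of Y X e 0 0 0] by simp
      show "\<forall>k\<in>{..d} - {m..m + e}. coeff ([:Y, X:] ^ e * monom 1 m) k * ?c k = 0"
      proof
        fix k assume "k \<in> {..d} - {m..m + e}"
        then have "k < m \<or> e < k - m" by auto
        then show "coeff ([:Y, X:] ^ e * monom 1 m) k * ?c k = 0"
          using coeff_eq_0[of "[:Y, X:] ^ e" "k - m"] deg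
          by (auto simp: mult.commute[of _ "monom 1 m"] coeff_monom_mult)
      qed
    qed (use mn in \<open>auto simp: e_def mult.commute[of _ "monom 1 m"] coeff_monom_mult\<close>)
    also have "\<dots> = (\<Sum>a\<le>e. coeff ([:Y, X:] ^ e) a * ?c (a + m))"
      by (rule sum.reindex_bij_witness[of _ "\<lambda>a. a + m" "\<lambda>k. k - m"]) auto
    finally show ?thesis by (simp add: sum_distrib_left)
  qed
  finally show ?thesis by (simp add: G_def e_def)
qed

lemma comm_ring_hom_bieval: "comm_ring_hom (\<lambda>F. bieval F X Y)"
  by unfold_locales (simp_all add: bieval_def)

lemma bieval_hess:
  assumes F: "F \<in> forms d" and i: "2 * i \<le> d"
  shows "bieval (hess F i) X Y
    = (fact d / fact (d - 2 * i)) ^ Suc i * hessian_det (normalized_coeff d F) d i ([:Y, X:] ^ (d - 2 * i))"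
proof -
  interpret comm_ring_hom "\<lambda>F. bieval F X Y" by (rule comm_ring_hom_bieval)
  let ?c = "normalized_coeff d F"
  let ?n = "Suc i" and ?K = "fact d / fact (d - 2 * i) :: real"
  define L where "L = [:Y, X:] ^ (d - 2 * i)"
  define A where "A = mat ?n ?n (\<lambda>(p, q). (dX ^^ (p + q)) ((dY ^^ (2 * i - p - q)) F))"
  define B where "B = mat ?n ?n (\<lambda>(p, q). umbral ?c d (L * monom 1 (p + q)))"
  have "map_mat (\<lambda>F. bieval F X Y) A = ?K \<cdot>\<^sub>m B"
  proof (rule eq_matI)
    fix p q assume "p < dim_row (?K \<cdot>\<^sub>m B)" "q < dim_col (?K \<cdot>\<^sub>m B)"
    then have pq: "p \<le> i" "q \<le> i" by (simp_all add: B_def)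
    then have "p + q + (2 * i - p - q) = 2 * i" by simp
    then show "map_mat (\<lambda>F. bieval F X Y) A $$ (p, q) = (?K \<cdot>\<^sub>m B) $$ (p, q)"
      using pq bieval_deriv[OF F, of "p + q" "2 * i - p - q" X Y] i by (simp add: A_def B_def L_def)
  qed (simp_all add: A_def B_def)
  then have "bieval (det A) X Y = ?K ^ ?n * det B"
    using hom_det[of A] by (simp add: B_def)
  moreover have "det B = (- 1) ^ (?n div 2) * hessian_det ?c d i L"
  proof -
    let ?T = "map (\<lambda>p q. umbral ?c d (L * monom 1 (i + q - p))) [0..<?n]"
    have "hessian_det ?c d i L = minor (\<lambda>p q. umbral ?c d (L * monom 1 (i + q - p))) [0..<?n] [0..<?n]"
      unfolding hessian_det_def minor_def by (rule col_det_cong) (auto simp del: upt_Suc)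
    also have "\<dots> = col_det ?T"
      by (subst minor_transpose) (auto simp: minor_def simp del: upt_Suc intro!: col_det_cong)
    finally have T: "hessian_det ?c d i L = col_det ?T" .
    have "det B = col_det (rev ?T)"
      unfolding col_det_def B_def
      by (rule arg_cong[where f = det]) (rule eq_matI, auto simp: rev_nth add.commute simp del: upt_Suc)
    also have "\<dots> = (- 1) ^ (?n div 2) * col_det ?T"
      using col_det_rev[of "[]" ?T] by simp
    finally show ?thesis unfolding T .
  qed
  moreover have "bieval (hess F i) X Y = (- 1) ^ (?n div 2) * bieval (det A) X Y"
    unfolding hess_def A_def by (simp add: hom_mult hom_power hom_uminus)
  ultimately have "bieval (hess F i) X Y = ((- 1) ^ (?n div 2) * (- 1) ^ (?n div 2)) * (?K ^ ?n * hessian_det ?c d i L)"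
    by (simp only: mult_ac)
  then show ?thesis by (simp only: L_def power_mult_distrib[symmetric]) simp
qed

section \<open>The apolar ideal of a form\<close>

definition xymon :: "nat \<Rightarrow> nat \<Rightarrow> bipoly" where
  "xymon a b = monom (monom 1 a) b"

lemma bicoeff_add: "bicoeff (f + g) a b = bicoeff f a b + bicoeff g a b"
  by (simp add: bicoeff_def)

lemma bicoeff_smult: "bicoeff (smult [:x:] f) a b = x * bicoeff f a b"
  by (simp add: bicoeff_def)

lemma bicoeff_sum: "bicoeff (\<Sum>i\<in>A. f i) a b = (\<Sum>i\<in>A. bicoeff (f i) a b)"
  by (simp add: bicoeff_def coeff_sum)

lemma bicoeff_xymon: "bicoeff (xymon a b) m n = (if m = a \<and> n = b then 1 else 0)"
  by (simp add: bicoeff_def xymon_def)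

lemma bicoeff_xymon_mult:
  "bicoeff (xymon a b * f) m n = (if a \<le> m \<and> b \<le> n then bicoeff f (m - a) (n - b) else 0)"
  by (simp add: bicoeff_def xymon_def coeff_monom_mult)

lemma bipoly_eqI: "(\<And>a b. bicoeff f a b = bicoeff g a b) \<Longrightarrow> f = g"
  by (intro poly_eqI) (simp add: bicoeff_def)

lemma xymon_mult: "xymon a b * xymon a' b' = xymon (a + a') (b + b')"
  by (simp add: xymon_def mult_monom)

lemma bipoly_expand:
  "h = (\<Sum>b\<le>degree h. \<Sum>a\<le>degree (coeff h b). smult [:bicoeff h a b:] (xymon a b))"
proof -
  have "monom (coeff h b) b = (\<Sum>a\<le>degree (coeff h b). smult [:bicoeff h a b:] (xymon a b))" for b
  proof -
    have "monom (\<Sum>a\<in>A. p a) b = (\<Sum>a\<in>A. monom (p a) b)" if "finite A" for A :: "nat set" and p :: "nat \<Rightarrow> real poly"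
      using that by induction (simp_all add: add_monom[symmetric])
    from this[of "{..degree (coeff h b)}" "\<lambda>a. monom (bicoeff h a b) a"]
    show ?thesis
      by (simp add: poly_as_sum_of_monoms bicoeff_def xymon_def smult_monom)
  qed
  then show ?thesis using poly_as_sum_of_monoms[of h] by simp
qed

text \<open>
  The pairing of an operator of degree \<open>d\<close> with \<open>F\<close>, divided by \<open>d!\<close>; other homogeneous components do
  not contribute.
\<close>

definition apolar_pairing :: "(nat \<Rightarrow> real) \<Rightarrow> nat \<Rightarrow> bipoly \<Rightarrow> real" where
  "apolar_pairing c d g = (\<Sum>k\<le>d. bicoeff g k (d - k) * c k)"

lemma apolar_pairing_add: "apolar_pairing c d (f + g) = apolar_pairing c d f + apolar_pairing c d g"
  by (simp add: apolar_pairing_def bicoeff_add distrib_right sum.distrib)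

lemma apolar_pairing_smult: "apolar_pairing c d (smult [:x:] f) = x * apolar_pairing c d f"
  by (simp add: apolar_pairing_def bicoeff_smult sum_distrib_left mult.assoc)

lemma apolar_pairing_sum: "apolar_pairing c d (\<Sum>i\<in>A. f i) = (\<Sum>i\<in>A. apolar_pairing c d (f i))"
  unfolding apolar_pairing_def bicoeff_sum sum_distrib_right by (rule sum.swap)

text \<open>
  The coefficients of \<open>f \<circ> F\<close> are, up to factorials, the pairings of \<open>F\<close> with the monomial multiples
  of \<open>f\<close>.
\<close>

lemma bicoeff_diff_act:
  assumes F: "F \<in> forms d"
  shows "fact a * fact b * bicoeff (diff_act f F) a b = fact d * apolar_pairing (normalized_coeff d F) d (xymon a b * f)"
proof -
  define T where "T = (\<lambda>(n, m). bicoeff f m n * (fact (a + m) * fact (b + n) * bicoeff F (a + m) (b + n)))"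
  define h where "h k = bicoeff (xymon a b * f) k (d - k) * (fact k * fact (d - k) * bicoeff F k (d - k))" for k
  define S where "S = (SIGMA n:{..degree f}. {..degree (coeff f n)})"
  have "fact a * fact b * bicoeff (diff_act f F) a b
      = (\<Sum>n\<le>degree f. \<Sum>m\<le>degree (coeff f n).
          bicoeff f m n * (fact a * fact b * bicoeff ((dX ^^ m) ((dY ^^ n) F)) a b))"
    unfolding diff_act_def bicoeff_sum bicoeff_smult sum_distrib_left
    by (intro sum.cong refl) (simp only: mult_ac)
  also have "\<dots> = sum T S"
    unfolding bicoeff_deriv S_def T_def by (subst sum.Sigma) auto
  also have "\<dots> = sum T {x \<in> S. T x \<noteq> 0}"
    by (rule sum.mono_neutral_right) (auto simp: S_def)
  also have "\<dots> = sum h {k \<in> {..d}. h k \<noteq> 0}"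
  proof (rule sum.reindex_bij_witness[of _ "\<lambda>k. (d - k - b, k - a)" "\<lambda>(n, m). a + m"])
    fix x assume "x \<in> {x \<in> S. T x \<noteq> 0}"
    then obtain n m where x: "x = (n, m)" "(n, m) \<in> S" "T (n, m) \<noteq> 0" by (cases x) auto
    then have "bicoeff F (a + m) (b + n) \<noteq> 0" by (auto simp: T_def)
    then have d: "d = a + m + (b + n)" using F by (auto simp: forms_def)
    show "(\<lambda>k. (d - k - b, k - a)) (case x of (n, m) \<Rightarrow> a + m) = x" using x(1) d by simp
    have hT: "h (a + m) = T (n, m)" using d by (simp add: h_def T_def bicoeff_xymon_mult)
    then show "h (case x of (n, m) \<Rightarrow> a + m) = T x" using x(1) by simp
    show "(case x of (n, m) \<Rightarrow> a + m) \<in> {k \<in> {..d}. h k \<noteq> 0}" using x hT d by simp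
  next
    fix k assume "k \<in> {k \<in> {..d}. h k \<noteq> 0}"
    then have k: "k \<le> d" "h k \<noteq> 0" by auto
    then have ab: "a \<le> k" "b \<le> d - k" "bicoeff f (k - a) (d - k - b) \<noteq> 0"
      by (auto simp: h_def bicoeff_xymon_mult split: if_splits)
    show "(case (d - k - b, k - a) of (n, m) \<Rightarrow> a + m) = k" using ab by simp
    have e: "b + (d - k - b) = d - k" "a + (k - a) = k" using ab by simp_all
    have hT: "h k = T (d - k - b, k - a)"
      by (simp only: h_def T_def prod.case bicoeff_xymon_mult e ab(1,2) if_True simp_thms)
    have "coeff (coeff f (d - k - b)) (k - a) \<noteq> 0" using ab(3) by (simp add: bicoeff_def)
    then have "k - a \<le> degree (coeff f (d - k - b))" "d - k - b \<le> degree f"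
      by (auto intro: le_degree simp: le_degree)
    then show "(d - k - b, k - a) \<in> {x \<in> S. T x \<noteq> 0}" using hT k by (simp add: S_def)
  qed
  also have "\<dots> = sum h {..d}" by (rule sum.mono_neutral_left) auto
  also have "\<dots> = fact d * apolar_pairing (normalized_coeff d F) d (xymon a b * f)"
    unfolding apolar_pairing_def sum_distrib_left h_def using form_bicoeff[OF F] by (intro sum.cong refl) simp
  finally show ?thesis .
qed

lemma apolar_pairing_mult_eq_0:
  assumes "\<And>a b. apolar_pairing c d (xymon a b * f) = 0"
  shows "apolar_pairing c d (h * f) = 0"
proof -
  have "h * f = (\<Sum>b\<le>degree h. \<Sum>a\<le>degree (coeff h b). smult [:bicoeff h a b:] (xymon a b * f))"
    by (subst bipoly_expand[of h]) (simp add: sum_distrib_right)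
  then show ?thesis by (simp only: apolar_pairing_sum apolar_pairing_smult assms) simp
qed

text \<open>
  In this description it is immediate that the annihilator is an ideal.
\<close>

lemma Ann_iff_apolar_pairing:
  assumes F: "F \<in> forms d"
  shows "f \<in> Ann F \<longleftrightarrow> (\<forall>h. apolar_pairing (normalized_coeff d F) d (h * f) = 0)"
proof
  assume "f \<in> Ann F"
  then have mon: "apolar_pairing (normalized_coeff d F) d (xymon a b * f) = 0" for a b
    using bicoeff_diff_act[OF F, of a b f] by (simp add: Ann_def bicoeff_def)
  show "\<forall>h. apolar_pairing (normalized_coeff d F) d (h * f) = 0"
    by (rule allI) (rule apolar_pairing_mult_eq_0[OF mon])
next
  assume z: "\<forall>h. apolar_pairing (normalized_coeff d F) d (h * f) = 0"
  have "diff_act f F = 0"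
  proof (rule bipoly_eqI)
    fix a b
    have "fact a * fact b * bicoeff (diff_act f F) a b = 0"
      using bicoeff_diff_act[OF F, of a b f] z by simp
    then show "bicoeff (diff_act f F) a b = bicoeff 0 a b" by (simp add: bicoeff_def)
  qed
  then show "f \<in> Ann F" by (simp add: Ann_def)
qed

lemma bipoly_ring_simps:
  "carrier bipoly_ring = UNIV" "f \<otimes>\<^bsub>bipoly_ring\<^esub> g = f * g" "\<one>\<^bsub>bipoly_ring\<^esub> = 1"
  "\<zero>\<^bsub>bipoly_ring\<^esub> = 0" "f \<oplus>\<^bsub>bipoly_ring\<^esub> g = f + g"
  by (simp_all add: bipoly_ring_def)

lemma cring_bipoly_ring: "cring bipoly_ring"
proof (rule cringI)
  show "abelian_group bipoly_ring"
  proof (rule abelian_groupI)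
    show "\<exists>y\<in>carrier bipoly_ring. y \<oplus>\<^bsub>bipoly_ring\<^esub> x = \<zero>\<^bsub>bipoly_ring\<^esub>" for x
      by (rule bexI[of _ "- x"]) (simp_all add: bipoly_ring_simps)
  qed (simp_all add: bipoly_ring_simps algebra_simps)
  show "comm_monoid bipoly_ring"
    by (rule comm_monoidI) (auto simp: bipoly_ring_simps algebra_simps)
qed (auto simp: bipoly_ring_simps algebra_simps)

lemma ideal_Ann:
  assumes F: "F \<in> forms d"
  shows "ideal (Ann F) bipoly_ring"
proof -
  interpret cring bipoly_ring by (rule cring_bipoly_ring)
  have closed: "g * f \<in> Ann F" if "f \<in> Ann F" for f g
    using that unfolding Ann_iff_apolar_pairing[OF F] by (simp flip: mult.assoc)
  show ?thesis
  proof (rule idealI[OF ring_axioms])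
    show "subgroup (Ann F) (add_monoid bipoly_ring)"
    proof (rule add.subgroupI)
      have "0 \<in> Ann F" by (simp add: Ann_iff_apolar_pairing[OF F] apolar_pairing_def bicoeff_def)
      then show "Ann F \<noteq> {}" by auto
    next
      fix f assume "f \<in> Ann F"
      have "\<ominus>\<^bsub>bipoly_ring\<^esub> f = - f"
        by (rule minus_equality) (simp_all add: bipoly_ring_simps)
      then show "\<ominus>\<^bsub>bipoly_ring\<^esub> f \<in> Ann F" using closed[OF \<open>f \<in> Ann F\<close>, of "- 1"] by simp
    next
      fix f g assume "f \<in> Ann F" "g \<in> Ann F"
      then show "f \<oplus>\<^bsub>bipoly_ring\<^esub> g \<in> Ann F"
        by (simp add: Ann_iff_apolar_pairing[OF F] bipoly_ring_simps distrib_left apolar_pairing_add)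
    qed (simp add: bipoly_ring_simps)
  qed (use closed in \<open>auto simp: bipoly_ring_simps mult.commute\<close>)
qed

definition form_of :: "nat \<Rightarrow> (nat \<Rightarrow> real) \<Rightarrow> bipoly" where
  "form_of i u = (\<Sum>k\<le>i. smult [:u k:] (xymon k (i - k)))"

lemma bicoeff_form_of: "bicoeff (form_of i u) a b = (if a + b = i then u a else 0)"
proof -
  have "bicoeff (form_of i u) a b = (\<Sum>k\<le>i. if k = a then (if a + b = i then u a else 0) else 0)"
    unfolding form_of_def bicoeff_sum bicoeff_smult bicoeff_xymon by (intro sum.cong) auto
  then show ?thesis by auto
qed

lemma form_of_in_forms: "form_of i u \<in> forms i"
  by (simp add: forms_def bicoeff_form_of)

lemma forms_eq_form_of: "f \<in> forms i \<Longrightarrow> f = form_of i (\<lambda>k. bicoeff f k (i - k))"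
  by (rule bipoly_eqI) (auto simp: bicoeff_form_of forms_def)

text \<open>
  Annihilating forms of degree \<open>i\<close> are linear recurrences of length \<open>i\<close>.
\<close>

lemma form_of_in_Ann_iff:
  assumes F: "F \<in> forms d"
  shows "form_of i u \<in> Ann F \<longleftrightarrow> (\<forall>q. q + i \<le> d \<longrightarrow> (\<Sum>k\<le>i. u k * normalized_coeff d F (q + k)) = 0)"
proof -
  let ?c = "normalized_coeff d F"
  have val: "apolar_pairing ?c d (xymon a b * form_of i u) = (if a + b + i = d then \<Sum>k\<le>i. u k * ?c (a + k) else 0)" for a b
  proof -
    have "apolar_pairing ?c d (xymon a b * form_of i u)
        = (\<Sum>k\<le>d. if a + b + i = d \<and> a \<le> k \<and> k \<le> a + i then u (k - a) * ?c k else 0)"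
      unfolding apolar_pairing_def
    proof (rule sum.cong)
      fix k assume "k \<in> {..d}"
      then have "(a \<le> k \<and> b \<le> d - k \<and> k - a + (d - k - b) = i) \<longleftrightarrow> (a + b + i = d \<and> a \<le> k \<and> k \<le> a + i)"
        by auto
      then have "bicoeff (xymon a b * form_of i u) k (d - k)
          = (if a + b + i = d \<and> a \<le> k \<and> k \<le> a + i then u (k - a) else 0)"
        unfolding bicoeff_xymon_mult bicoeff_form_of by (simp only: if_if_eq_conj conj_assoc)
      then show "bicoeff (xymon a b * form_of i u) k (d - k) * ?c k
          = (if a + b + i = d \<and> a \<le> k \<and> k \<le> a + i then u (k - a) * ?c k else 0)" by simp
    qed simp
    also have "\<dots> = (if a + b + i = d then \<Sum>k\<in>{a..a + i}. u (k - a) * ?c k else 0)"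
      by (auto simp: sum.If_cases intro!: sum.cong)
    also have "(\<Sum>k\<in>{a..a + i}. u (k - a) * ?c k) = (\<Sum>k\<le>i. u k * ?c (a + k))"
      by (rule sum.reindex_bij_witness[of _ "\<lambda>k. a + k" "\<lambda>k. k - a"]) auto
    finally show ?thesis .
  qed
  show ?thesis
  proof
    assume "form_of i u \<in> Ann F"
    then have z: "apolar_pairing ?c d (xymon a b * form_of i u) = 0" for a b unfolding Ann_iff_apolar_pairing[OF F] by simp
    show "\<forall>q. q + i \<le> d \<longrightarrow> (\<Sum>k\<le>i. u k * ?c (q + k)) = 0"
    proof (intro allI impI)
      fix q assume "q + i \<le> d"
      then show "(\<Sum>k\<le>i. u k * ?c (q + k)) = 0" using z[of q "d - i - q"] unfolding val by simp
    qed
  next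
    assume z: "\<forall>q. q + i \<le> d \<longrightarrow> (\<Sum>k\<le>i. u k * ?c (q + k)) = 0"
    have mon: "apolar_pairing ?c d (xymon a b * form_of i u) = 0" for a b
      using z unfolding val by auto
    show "form_of i u \<in> Ann F"
      unfolding Ann_iff_apolar_pairing[OF F] by (rule allI) (rule apolar_pairing_mult_eq_0[OF mon])
  qed
qed

section \<open>The Sperner number as a recurrence length\<close>

lemma (in ring) Span_dimension_le:
  assumes K: "subfield K R" and "set Us \<subseteq> carrier R"
  shows "\<exists>n\<le>length Us. dimension n K (Span K Us)"
  using assms(2)
proof (induction Us)
  case Nil
  then show ?case by auto
next
  case (Cons u Us)
  then obtain n where n: "n \<le> length Us" "dimension n K (Span K Us)" by auto
  show ?case
  proof (cases "u \<in> Span K Us")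
    case True
    then have "Span K (u # Us) = Span K Us"
      using Span_base_incl[OF K] mono_Span_subset[OF K] Cons.prems
      by (metis insert_subset list.simps(15) subset_antisym)
    then show ?thesis using n by (metis length_Cons le_SucI)
  next
    case False
    then have "dimension (Suc n) K (Span K (u # Us))"
      using Suc_dim[OF _ False n(2)] Cons.prems by simp
    then show ?thesis using n(1) by auto
  qed
qed

lemma form_eq_0:
  assumes F: "F \<in> forms d" and c: "\<And>k. k \<le> d \<Longrightarrow> normalized_coeff d F k = 0"
  shows "F = 0"
proof (rule bipoly_eqI)
  fix a b
  have "bicoeff F a b = 0"
  proof (cases "a + b = d")
    case True
    then have "fact a * fact (d - a) * bicoeff F a (d - a) = 0"
      using form_bicoeff[OF F, of a] c[of a] by simp
    then show ?thesis using True by auto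
  qed (use F in \<open>auto simp: forms_def\<close>)
  then show "bicoeff F a b = bicoeff 0 a b" by (simp add: bicoeff_def)
qed

locale apolar =
  fixes d :: nat and F :: bipoly
  assumes F: "F \<in> forms d" and nz: "F \<noteq> 0"
begin

abbreviation "c \<equiv> normalized_coeff d F"
abbreviation "cls f \<equiv> Ann F +>\<^bsub>bipoly_ring\<^esub> f"
abbreviation "K \<equiv> apolar_scalars F"
abbreviation "A \<equiv> apolar_algebra F"

lemma ring_A: "ring A"
  unfolding apolar_algebra_def by (rule ideal.quotient_is_ring[OF ideal_Ann[OF F]])

lemma cls_hom: "(+>\<^bsub>bipoly_ring\<^esub>) (Ann F) \<in> Ring.ring_hom bipoly_ring A"
  unfolding apolar_algebra_def by (rule ideal.rcos_ring_hom[OF ideal_Ann[OF F]])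

lemma cls_add: "cls (f + g) = cls f \<oplus>\<^bsub>A\<^esub> cls g"
  using ring_hom_add[OF cls_hom, of f g] by (simp add: bipoly_ring_simps)

lemma cls_mult: "cls (f * g) = cls f \<otimes>\<^bsub>A\<^esub> cls g"
  using ring_hom_mult[OF cls_hom, of f g] by (simp add: bipoly_ring_simps)

lemma cls_carrier: "cls f \<in> carrier A"
  using ring_hom_closed[OF cls_hom, of f] by (simp add: bipoly_ring_simps)

lemma cls_one: "cls 1 = \<one>\<^bsub>A\<^esub>"
  using ring_hom_one[OF cls_hom] by (simp add: bipoly_ring_simps)

lemma zero_A: "\<zero>\<^bsub>A\<^esub> = Ann F"
  unfolding apolar_algebra_def FactRing_def by (simp only: ring.select_convs)

lemma cls_zero_iff: "cls f = \<zero>\<^bsub>A\<^esub> \<longleftrightarrow> f \<in> Ann F"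
proof -
  interpret I: ideal "Ann F" bipoly_ring by (rule ideal_Ann[OF F])
  show ?thesis
    unfolding zero_A using I.a_rcos_const[of f] I.rcos_const_imp_mem[of f] unfolding bipoly_ring_simps by blast
qed

lemma zero_in_Ann: "0 \<in> Ann F"
  by (simp add: Ann_iff_apolar_pairing[OF F] apolar_pairing_def bicoeff_def)

lemma cls_0: "cls 0 = \<zero>\<^bsub>A\<^esub>"
  unfolding cls_zero_iff by (rule zero_in_Ann)

lemma one_notin_Ann: "1 \<notin> Ann F"
proof
  assume "1 \<in> Ann F"
  moreover have "(1 :: bipoly) = form_of 0 (\<lambda>_. 1)"
    by (simp add: form_of_def xymon_def pCons_one)
  ultimately have c0: "c q = 0" if "q \<le> d" for q
    using form_of_in_Ann_iff[OF F, of 0 "\<lambda>_. 1"] that by simp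
  show False using form_eq_0[OF F c0] nz by simp
qed

lemma subfield_constants: "subfield (range (\<lambda>x. [:[:x:]:])) bipoly_ring"
proof (rule ring.subfieldI[OF cring.axioms(1)[OF cring_bipoly_ring]])
  interpret B: cring bipoly_ring by (rule cring_bipoly_ring)
  have minus: "\<ominus>\<^bsub>bipoly_ring\<^esub> f = - f" for f
    by (rule B.minus_equality) (simp_all add: bipoly_ring_simps)
  let ?K = "range (\<lambda>x::real. [:[:x:]:])"
  have "subring ?K bipoly_ring"
  proof (rule B.subringI)
    show "\<one>\<^bsub>bipoly_ring\<^esub> \<in> ?K" by (auto simp: bipoly_ring_simps one_pCons)
    fix f assume "f \<in> ?K"
    then obtain x where f: "f = [:[:x:]:]" by auto
    have "- f = [:[:- x:]:]" unfolding f by simp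
    then show "\<ominus>\<^bsub>bipoly_ring\<^esub> f \<in> ?K" unfolding minus by blast
  next
    fix f g assume "f \<in> ?K" "g \<in> ?K"
    then obtain x y where f: "f = [:[:x:]:]" "g = [:[:y:]:]" by auto
    have "f * g = [:[:x * y:]:]" "f + g = [:[:x + y:]:]" unfolding f by simp_all
    then show "f \<otimes>\<^bsub>bipoly_ring\<^esub> g \<in> ?K" "f \<oplus>\<^bsub>bipoly_ring\<^esub> g \<in> ?K"
      unfolding bipoly_ring_simps by blast+
  qed (simp add: bipoly_ring_simps)
  then show "subcring ?K bipoly_ring" by (rule B.subcringI')
  show "Units (bipoly_ring \<lparr>carrier := ?K\<rparr>) = ?K - {\<zero>\<^bsub>bipoly_ring\<^esub>}"
  proof (intro equalityI subsetI)
    fix f assume "f \<in> Units (bipoly_ring \<lparr>carrier := ?K\<rparr>)"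
    then show "f \<in> ?K - {\<zero>\<^bsub>bipoly_ring\<^esub>}"
      by (auto simp: Units_def bipoly_ring_simps)
  next
    fix f assume "f \<in> ?K - {\<zero>\<^bsub>bipoly_ring\<^esub>}"
    then obtain x where f: "f = [:[:x:]:]" "x \<noteq> 0" by (auto simp: bipoly_ring_simps)
    have "[:[:inverse x:]:] * f = 1" "f * [:[:inverse x:]:] = 1"
      using f by (simp_all add: one_pCons)
    then show "f \<in> Units (bipoly_ring \<lparr>carrier := ?K\<rparr>)"
      unfolding Units_def using f(1) by (auto simp: bipoly_ring_simps intro!: bexI[of _ "[:[:inverse x:]:]"])
  qed
qed

lemma subfield_K: "subfield K A"
proof -
  have "\<one>\<^bsub>A\<^esub> \<noteq> \<zero>\<^bsub>A\<^esub>"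
    using cls_one cls_zero_iff[of 1] one_notin_Ann by simp
  moreover have "K = (+>\<^bsub>bipoly_ring\<^esub>) (Ann F) ` range (\<lambda>x. [:[:x:]:])"
    unfolding apolar_scalars_def image_image ..
  moreover have "ring_hom_ring bipoly_ring A ((+>\<^bsub>bipoly_ring\<^esub>) (Ann F))"
    by (rule ring_hom_ringI2[OF cring.axioms(1)[OF cring_bipoly_ring] ring_A cls_hom])
  ultimately show ?thesis using ring_hom_ring.img_is_subfield(2)[OF _ subfield_constants] by simp
qed

lemma combine_cls:
  "length xs = length fs \<Longrightarrow>
    ring.combine A (map (\<lambda>x. cls [:[:x:]:]) xs) (map cls fs) = cls (\<Sum>i<length fs. smult [:xs ! i:] (fs ! i))"
proof (induction xs fs rule: list_induct2)
  case Nil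
  show ?case by (simp add: cls_0 ring.combine.simps[OF ring_A])
next
  case (Cons x xs f fs)
  have "cls (smult [:x:] f) = cls [:[:x:]:] \<otimes>\<^bsub>A\<^esub> cls f" by (simp flip: cls_mult)
  moreover have "(\<Sum>i<length (f # fs). smult [:(x # xs) ! i:] ((f # fs) ! i))
      = smult [:x:] f + (\<Sum>i<length fs. smult [:xs ! i:] (fs ! i))"
    by (simp add: sum.lessThan_Suc_shift del: sum.lessThan_Suc)
  ultimately show ?case using Cons by (simp only: list.map ring.combine.simps[OF ring_A] cls_add)
qed

lemma Span_cls_iff:
  "z \<in> ring.Span A K (map cls fs) \<longleftrightarrow> (\<exists>x. z = cls (\<Sum>i<length fs. smult [:x i:] (fs ! i)))"
proof -
  have sub: "set (map cls fs) \<subseteq> carrier A" using cls_carrier by auto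
  have "(\<exists>Ks. set Ks \<subseteq> K \<and> length Ks = length fs \<and> z = ring.combine A Ks (map cls fs))
      \<longleftrightarrow> (\<exists>xs. length xs = length fs \<and> z = cls (\<Sum>i<length fs. smult [:xs ! i:] (fs ! i)))" (is "?L \<longleftrightarrow> ?R")
  proof
    assume ?L
    then obtain Ks where Ks: "set Ks \<subseteq> K" "length Ks = length fs" "z = ring.combine A Ks (map cls fs)" by blast
    then have "\<exists>xs. Ks = map (\<lambda>x. cls [:[:x:]:]) xs"
      unfolding ex_map_conv by (auto simp: apolar_scalars_def)
    then obtain xs where "Ks = map (\<lambda>x. cls [:[:x:]:]) xs" by blast
    then show ?R using Ks combine_cls[of xs fs] by auto
  next
    assume ?R
    then obtain xs where "length xs = length fs" "z = cls (\<Sum>i<length fs. smult [:xs ! i:] (fs ! i))" by blast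
    then show ?L using combine_cls[of xs fs]
      by (intro exI[of _ "map (\<lambda>x. cls [:[:x:]:]) xs"]) (auto simp: apolar_scalars_def)
  qed
  also have "\<dots> \<longleftrightarrow> (\<exists>x. z = cls (\<Sum>i<length fs. smult [:x i:] (fs ! i)))"
  proof
    assume "\<exists>x. z = cls (\<Sum>i<length fs. smult [:x i:] (fs ! i))"
    then obtain x where z: "z = cls (\<Sum>i<length fs. smult [:x i:] (fs ! i))" by blast
    have "(\<Sum>i<length fs. smult [:x i:] (fs ! i)) = (\<Sum>i<length fs. smult [:map x [0..<length fs] ! i:] (fs ! i))"
      by (intro sum.cong) auto
    then have "z = cls (\<Sum>i<length fs. smult [:map x [0..<length fs] ! i:] (fs ! i))" unfolding z by (rule arg_cong)
    moreover have "length (map x [0..<length fs]) = length fs" by simp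
    ultimately show "\<exists>xs. length xs = length fs \<and> z = cls (\<Sum>i<length fs. smult [:xs ! i:] (fs ! i))" by blast
  qed auto
  finally show ?thesis
    unfolding ring.Span_mem_iff_length_version[OF ring_A subfield_K sub] by simp
qed

definition form_monomials :: "nat \<Rightarrow> bipoly list" where
  "form_monomials i = map (\<lambda>k. xymon k (i - k)) [0..<Suc i]"

lemma lincomb_form_monomials: "(\<Sum>k<length (form_monomials i). smult [:x k:] (form_monomials i ! k)) = form_of i x"
  unfolding form_of_def form_monomials_def by (rule sum.cong) (auto simp del: upt_Suc)

lemma component_eq_Span: "apolar_component F i = ring.Span A K (map cls (form_monomials i))"
proof (intro equalityI subsetI)
  fix z assume "z \<in> apolar_component F i"
  then obtain f where "f \<in> forms i" "z = cls f" by (auto simp: apolar_component_def)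
  then have "z = cls (form_of i (\<lambda>k. bicoeff f k (i - k)))" using forms_eq_form_of by metis
  then show "z \<in> ring.Span A K (map cls (form_monomials i))" unfolding Span_cls_iff lincomb_form_monomials by blast
next
  fix z assume "z \<in> ring.Span A K (map cls (form_monomials i))"
  then obtain x where "z = cls (form_of i x)" unfolding Span_cls_iff lincomb_form_monomials by blast
  then show "z \<in> apolar_component F i" unfolding apolar_component_def using form_of_in_forms by blast
qed

abbreviation "comp_dim i \<equiv> ring.dim A K (apolar_component F i)"

lemma dimension_component: "ring.dimension A (comp_dim i) K (apolar_component F i)"
proof -
  have "ring.finite_dimension A K (apolar_component F i)"
    unfolding component_eq_Span using cls_carrier by (intro ring.Span_finite_dimension[OF ring_A subfield_K]) auto
  from ring.finite_dimensionE[OF ring_A subfield_K this] show ?thesis by (simp add: over_def)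
qed

lemma comp_dim_le:
  assumes "apolar_component F i \<subseteq> ring.Span A K (map cls fs)"
  shows "comp_dim i \<le> length fs"
proof -
  obtain Vs where Vs: "ring.independent A K Vs" "length Vs = comp_dim i" "ring.Span A K Vs = apolar_component F i" "set Vs \<subseteq> carrier A"
    using ring.exists_base[OF ring_A subfield_K dimension_component[of i]] by blast
  have "set (map cls fs) \<subseteq> carrier A" using cls_carrier by auto
  then obtain n where n: "n \<le> length (map cls fs)" "ring.dimension A n K (ring.Span A K (map cls fs))"
    using ring.Span_dimension_le[OF ring_A subfield_K] by blast
  have "set Vs \<subseteq> ring.Span A K (map cls fs)"
    using ring.Span_base_incl[OF ring_A subfield_K Vs(4)] Vs(3) assms by blast
  then have "length Vs \<le> n" by (rule ring.independent_length_le_dimension[OF ring_A subfield_K n(2) Vs(1)])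
  then show ?thesis using Vs(2) n(1) by simp
qed

text \<open>
  The \<open>i + 1\<close> monomials of degree \<open>i\<close> are dependent in a component of dimension at most \<open>i\<close>.
\<close>

lemma form_in_Ann_of_comp_dim_le:
  assumes "comp_dim i \<le> i"
  obtains u k where "k \<le> i" "u k \<noteq> 0" "form_of i u \<in> Ann F"
proof -
  have sub: "set (map cls (form_monomials i)) \<subseteq> carrier A" using cls_carrier by auto
  have "\<not> ring.independent A K (map cls (form_monomials i))"
  proof
    assume "ring.independent A K (map cls (form_monomials i))"
    from ring.independent_length_le_dimension[OF ring_A subfield_K dimension_component[of i] this]
    have "length (map cls (form_monomials i)) \<le> comp_dim i"
      unfolding component_eq_Span using ring.Span_base_incl[OF ring_A subfield_K sub] by blast
    then show False using assms by (simp add: form_monomials_def)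
  qed
  then obtain Ks where Ks: "length Ks = length (map cls (form_monomials i))" "ring.combine A Ks (map cls (form_monomials i)) = \<zero>\<^bsub>A\<^esub>"
      "set Ks \<subseteq> K" "set Ks \<noteq> {\<zero>\<^bsub>A\<^esub>}"
    using ring.dependent_imp_non_trivial_combine[OF ring_A subfield_K sub] by blast
  from Ks(3) have "\<exists>xs. Ks = map (\<lambda>x. cls [:[:x:]:]) xs"
    unfolding ex_map_conv by (auto simp: apolar_scalars_def)
  then obtain xs where xs: "Ks = map (\<lambda>x. cls [:[:x:]:]) xs" by blast
  have len: "length xs = length (form_monomials i)" "length xs = Suc i" using Ks(1) xs by (simp_all add: form_monomials_def)
  have "cls (form_of i ((!) xs)) = \<zero>\<^bsub>A\<^esub>"
    using Ks(2) combine_cls[OF len(1)] unfolding xs lincomb_form_monomials by simp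
  then have "form_of i ((!) xs) \<in> Ann F" unfolding cls_zero_iff .
  moreover have "\<exists>k\<le>i. xs ! k \<noteq> 0"
  proof (rule ccontr)
    assume "\<not> ?thesis"
    then have "\<forall>x\<in>set xs. x = 0" using len(2) by (auto simp: in_set_conv_nth)
    then have "set Ks \<subseteq> {\<zero>\<^bsub>A\<^esub>}" unfolding xs by (auto simp: cls_0)
    moreover have "set Ks \<noteq> {}" using len(2) xs by auto
    ultimately show False using Ks(4) by (metis subset_singletonD)
  qed
  ultimately show ?thesis using that by blast
qed

text \<open>
  Call the monomial with the largest power of \<open>x\<close> in the annihilating form its leading monomial.  Modulo
  multiples of the form, a monomial of degree \<open>j\<close> divisible by the leading one reduces to monomials
  with smaller powers of \<open>x\<close>.  If \<open>j \<ge> m\<close>, exactly \<open>m\<close> monomials of degree \<open>j\<close> are not divisible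
  by it; if \<open>j < m\<close>, there are at most \<open>m\<close> monomials at all.
\<close>

lemma comp_dim_le_of_annihilator:
  assumes w: "form_of m w \<in> Ann F" "k1 \<le> m" "w k1 \<noteq> 0"
  shows "comp_dim j \<le> m"
proof (cases "j < m")
  case True
  have "comp_dim j \<le> length (form_monomials j)" by (rule comp_dim_le) (simp add: component_eq_Span)
  then show ?thesis using True by (simp add: form_monomials_def)
next
  case False
  define k0 where "k0 = Max {k. k \<le> m \<and> w k \<noteq> 0}"
  have fin: "finite {k. k \<le> m \<and> w k \<noteq> 0}" by simp
  have "k0 \<in> {k. k \<le> m \<and> w k \<noteq> 0}" unfolding k0_def using w(2,3) by (intro Max_in[OF fin]) auto
  then have k0: "k0 \<le> m" "w k0 \<noteq> 0" by auto
  have above: "w k = 0" if "k0 < k" "k \<le> m" for k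
    using Max_ge[OF fin, of k] that unfolding k0_def[symmetric] by force
  \<comment> \<open>the monomials of degree \<open>j\<close> not divisible by the leading monomial of the form\<close>
  define fs where "fs = map (\<lambda>k. xymon k (j - k)) ([0..<k0] @ [j - m + k0 + 1..<Suc j])"
  have len: "length fs = m" using k0(1) False by (auto simp: fs_def simp del: upt_Suc)
  define inS where "inS f \<longleftrightarrow> cls f \<in> ring.Span A K (map cls fs)" for f
  have sub: "set (map cls fs) \<subseteq> carrier A" using cls_carrier by auto
  have inS_add: "inS (f + g)" if "inS f" "inS g" for f g
    using that ring.Span_subgroup_props(3)[OF ring_A subfield_K sub] by (simp add: inS_def cls_add)
  have inS_smult: "inS (smult [:x:] f)" if "inS f" for f x
  proof -
    have "cls (smult [:x:] f) = cls [:[:x:]:] \<otimes>\<^bsub>A\<^esub> cls f" by (simp flip: cls_mult)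
    moreover have "cls [:[:x:]:] \<in> K" by (auto simp: apolar_scalars_def)
    ultimately show ?thesis using that ring.Span_smult_closed[OF ring_A subfield_K sub] by (simp add: inS_def)
  qed
  have inS_Ann: "inS f" if "f \<in> Ann F" for f
    using that ring.Span_subgroup_props(2)[OF ring_A subfield_K sub] unfolding inS_def cls_zero_iff[symmetric] by simp
  have inS_sum: "inS (\<Sum>k\<in>S. f k)" if "finite S" "\<And>k. k \<in> S \<Longrightarrow> inS (f k)" for S :: "nat set" and f
    using that
  proof (induction S)
    case empty
    show ?case using inS_Ann[OF zero_in_Ann] by simp
  qed (auto intro: inS_add)
  have inS_mono: "inS (xymon k (j - k))" if "k \<le> j" for k
    using that
  proof (induction k rule: less_induct)
    case (less k)
    show ?case
    proof (cases "k < k0 \<or> j - m + k0 < k")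
      case True
      then have "xymon k (j - k) \<in> set fs" using less.prems by (auto simp: fs_def)
      then show ?thesis unfolding inS_def using ring.Span_base_incl[OF ring_A subfield_K sub] by auto
    next
      case f: False
      \<comment> \<open>multiply the form so that its leading monomial becomes the given one\<close>
      define a b where "a = k - k0" and "b = j - k - (m - k0)"
      have ab: "k = a + k0" "j - k = b + (m - k0)" using f k0(1) False less.prems by (auto simp: a_def b_def)
      have "xymon a b * form_of m w \<in> Ann F"
        using ideal.I_l_closed[OF ideal_Ann[OF F] w(1), of "xymon a b"] by (simp add: bipoly_ring_simps)
      then have s1: "inS (smult [:inverse (w k0):] (xymon a b * form_of m w))"
        by (intro inS_smult inS_Ann)
      have s2: "inS (\<Sum>l<k0. smult [:- inverse (w k0) * w l:] (xymon (a + l) (j - (a + l))))"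
      proof (intro inS_sum inS_smult)
        fix l assume "l \<in> {..<k0}"
        then show "inS (xymon (a + l) (j - (a + l)))" using ab less.prems by (intro less.IH) auto
      qed simp
      have "xymon a b * form_of m w = (\<Sum>l\<le>m. smult [:w l:] (xymon (a + l) (b + (m - l))))"
        unfolding form_of_def sum_distrib_left by (simp only: mult_smult_right xymon_mult)
      also have "\<dots> = (\<Sum>l\<le>k0. smult [:w l:] (xymon (a + l) (b + (m - l))))"
        using k0(1) above by (intro sum.mono_neutral_right) auto
      also have "\<dots> = (\<Sum>l<k0. smult [:w l:] (xymon (a + l) (b + (m - l)))) + smult [:w k0:] (xymon k (j - k))"
        by (simp only: lessThan_Suc_atMost[symmetric] sum.lessThan_Suc ab(1)[symmetric] ab(2)[symmetric])
      also have "(\<Sum>l<k0. smult [:w l:] (xymon (a + l) (b + (m - l))))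
          = (\<Sum>l<k0. smult [:w l:] (xymon (a + l) (j - (a + l))))"
      proof (intro sum.cong refl)
        fix l assume "l \<in> {..<k0}"
        then have "b + (m - l) = j - (a + l)" using ab k0(1) less.prems by auto
        then show "smult [:w l:] (xymon (a + l) (b + (m - l))) = smult [:w l:] (xymon (a + l) (j - (a + l)))" by simp
      qed
      finally have eq: "xymon a b * form_of m w
          = (\<Sum>l<k0. smult [:w l:] (xymon (a + l) (j - (a + l)))) + smult [:w k0:] (xymon k (j - k))" .
      have "smult [:inverse (w k0):] (xymon a b * form_of m w)
            + (\<Sum>l<k0. smult [:- inverse (w k0) * w l:] (xymon (a + l) (j - (a + l))))
          = xymon k (j - k)"
        unfolding eq using k0(2)
        by (intro bipoly_eqI) (simp add: bicoeff_add bicoeff_smult bicoeff_sum sum_distrib_left distrib_left mult.assoc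
            sum_negf flip: mult.assoc)
      then show ?thesis using inS_add[OF s1 s2] by simp
    qed
  qed
  have "apolar_component F j \<subseteq> ring.Span A K (map cls fs)"
  proof
    fix z assume "z \<in> apolar_component F j"
    then obtain f where f: "f \<in> forms j" "z = cls f" by (auto simp: apolar_component_def)
    have "inS (form_of j (\<lambda>k. bicoeff f k (j - k)))"
      unfolding form_of_def using inS_mono by (intro inS_sum inS_smult) auto
    then have "inS f" using forms_eq_form_of[OF f(1)] by simp
    then show "z \<in> ring.Span A K (map cls fs)" using f(2) by (simp add: inS_def)
  qed
  from comp_dim_le[OF this] show ?thesis using len by simp
qed

lemma comp_dim_0_pos: "comp_dim 0 \<ge> 1"
proof (rule ccontr)
  assume "\<not> ?thesis"
  then have "comp_dim 0 \<le> 0" by simp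
  then obtain u k where u: "k \<le> 0" "u k \<noteq> 0" "form_of 0 u \<in> Ann F" by (rule form_in_Ann_of_comp_dim_le)
  have c0: "c q = 0" if "q \<le> d" for q
    using form_of_in_Ann_iff[OF F, of 0 u] u that by simp
  show False using form_eq_0[OF F c0] nz by simp
qed

lemma sperner_eq: "sperner d F = Max (comp_dim ` {0..d})"
  by (simp add: sperner_def)

lemma comp_dim_le_sperner: "i \<le> d \<Longrightarrow> comp_dim i \<le> sperner d F"
  unfolding sperner_eq by (rule Max_ge) auto

lemma sperner_pos: "sperner d F \<ge> 1"
  using comp_dim_0_pos comp_dim_le_sperner[of 0] by simp

lemma sperner_recurrence:
  assumes "sperner d F \<le> d"
  shows "\<exists>g. (\<exists>j\<le>sperner d F. g j \<noteq> 0) \<and>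
    (\<forall>q. q + sperner d F \<le> d \<longrightarrow> (\<Sum>j\<le>sperner d F. g j * c (q + j)) = 0)"
proof -
  obtain u k where u: "k \<le> sperner d F" "u k \<noteq> 0" "form_of (sperner d F) u \<in> Ann F"
    using form_in_Ann_of_comp_dim_le[OF comp_dim_le_sperner[OF assms]] by blast
  then show ?thesis using form_of_in_Ann_iff[OF F] by blast
qed

text \<open>
  A recurrence of length \<open>s - 1\<close> would bound all components by \<open>s - 1\<close>.
\<close>

lemma no_short_recurrence:
  assumes "\<And>q. q + (sperner d F - 1) \<le> d \<Longrightarrow> (\<Sum>k\<le>sperner d F - 1. u k * c (q + k)) = 0"
    and "k \<le> sperner d F - 1"
  shows "u k = 0"
proof (rule ccontr)
  assume k: "u k \<noteq> 0"
  have "form_of (sperner d F - 1) u \<in> Ann F" using assms(1) form_of_in_Ann_iff[OF F] by blast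
  then have "comp_dim j \<le> sperner d F - 1" for j using comp_dim_le_of_annihilator assms(2) k by blast
  then have "sperner d F \<le> sperner d F - 1" unfolding sperner_eq[of, THEN arg_cong[where f = "\<lambda>z. z \<le> _"]] by simp
  then show False using sperner_pos by simp
qed

text \<open>
  If \<open>2 (s - 1) > d\<close>, a recurrence of length \<open>s - 1\<close> has more unknown coefficients than equations, so
  there is a nontrivial one.
\<close>

lemma sperner_le: "2 * (sperner d F - 1) \<le> d"
proof (rule ccontr)
  assume neg: "\<not> ?thesis"
  define m where "m = sperner d F - 1"
  have "Suc d - m < Suc m" using neg by (simp add: m_def)
  then obtain u k where u: "k < Suc m" "u k \<noteq> 0" "\<And>q. q < Suc d - m \<Longrightarrow> (\<Sum>k<Suc m. u k * c (q + k)) = 0"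
    by (rule underdetermined_system[of _ _ "\<lambda>k q. c (q + k)"]) blast
  have "u k = 0"
  proof (rule no_short_recurrence, unfold m_def[symmetric])
    fix q assume "q + m \<le> d"
    then show "(\<Sum>k\<le>m. u k * c (q + k)) = 0" using u(3)[of q] by (simp add: lessThan_Suc_atMost)
  qed (use u(1) in simp)
  then show False using u(2) by simp
qed

end

section \<open>The two equivalences\<close>

lemma sorted_list_of_set_pick:
  assumes "finite I"
  shows "sorted_list_of_set I = map (pick I) [0..<card I]"
proof (rule strict_sorted_equal)
  have mono: "pick I m < pick I n" if "m < n" "n < card I" for m n
    using that by (intro pick_mono_le) auto
  show "sorted_wrt (<) (map (pick I) [0..<card I])"
    unfolding sorted_wrt_map by (rule sorted_wrt_mono_rel[OF _ sorted_wrt_upt]) (use mono in auto)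
  have "inj_on (pick I) {..<card I}"
    by (rule inj_onI) (metis lessThan_iff linorder_neqE_nat mono less_irrefl)
  then have "card (pick I ` {..<card I}) = card I" by (simp add: card_image)
  moreover have "pick I ` {..<card I} \<subseteq> I" using pick_in_set_le by auto
  ultimately have "pick I ` {..<card I} = I" using assms by (intro card_subset_eq) auto
  then show "set (sorted_list_of_set I) = set (map (pick I) [0..<card I])"
    using assms by (simp add: atLeast0LessThan)
qed simp

text \<open>
  Translates minors indexed by sets of rows and columns into minors indexed by increasing lists.
\<close>

lemma minors_satisfy_submatrix:
  assumes "P 1"
  shows "(\<forall>I J. I \<subseteq> {..<dim_row (toeplitz d i F)} \<and> J \<subseteq> {..<dim_col (toeplitz d i F)} \<and> card I = card J \<and> I \<noteq> {}
      \<longrightarrow> P (det (submatrix (toeplitz d i F) I J)))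
    \<longleftrightarrow> minors_satisfy P (toep_entry (normalized_coeff d F) i) i (d - i)" (is "?L \<longleftrightarrow> ?R")
proof -
  let ?A = "toep_entry (normalized_coeff d F) i" and ?T = "toeplitz d i F"
  have eq: "det (submatrix ?T I J) = minor ?A (sorted_list_of_set I) (sorted_list_of_set J)"
    if IJ: "I \<subseteq> {..i}" "J \<subseteq> {..d - i}" "card I = card J" for I J
  proof -
    have fin: "finite I" "finite J" using IJ finite_subset by blast+
    have "{k. k < dim_row ?T \<and> k \<in> I} = I" "{k. k < dim_col ?T \<and> k \<in> J} = J"
      using IJ by (auto simp: toeplitz_def)
    then have "submatrix ?T I J = mat (card J) (card J) (\<lambda>(p, q). ?T $$ (pick I p, pick J q))"
      unfolding submatrix_def using IJ(3) by simp
    also have "\<dots> = mat (card J) (card J) (\<lambda>(p, q). ?A (pick I p) (pick J q))"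
    proof (rule eq_matI)
      fix p q assume "p < dim_row (mat (card J) (card J) (\<lambda>(p, q). ?A (pick I p) (pick J q)))"
        and "q < dim_col (mat (card J) (card J) (\<lambda>(p, q). ?A (pick I p) (pick J q)))"
      then have pq: "p < card I" "q < card J" using IJ(3) by simp_all
      then have "pick I p \<in> I" "pick J q \<in> J" by (simp_all add: pick_in_set_le)
      then have "pick I p < i + 1" "pick J q < d - i + 1" using IJ by auto
      then show "mat (card J) (card J) (\<lambda>(p, q). ?T $$ (pick I p, pick J q)) $$ (p, q)
          = mat (card J) (card J) (\<lambda>(p, q). ?A (pick I p) (pick J q)) $$ (p, q)"
        using pq IJ(3) by (simp add: toeplitz_def toep_entry_def)
    qed simp_all
    finally show ?thesis
      unfolding minor_def col_det_def sorted_list_of_set_pick[OF fin(1)] sorted_list_of_set_pick[OF fin(2)]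
      by (simp only:) (rule arg_cong[where f = det], rule eq_matI, auto simp: IJ(3))
  qed
  have dims: "{..<dim_row ?T} = {..i}" "{..<dim_col ?T} = {..d - i}" by (auto simp: toeplitz_def)
  show ?thesis
  proof
    assume L: ?L
    show ?R unfolding minors_satisfy_def
    proof (intro allI impI, elim conjE)
      fix I J assume IJ: "sorted_wrt (<) I" "sorted_wrt (<) J" "set I \<subseteq> {..i}" "set J \<subseteq> {..d - i}" "length I = length J"
      have card: "card (set I) = length I" "card (set J) = length J"
        using IJ(1,2) by (simp_all add: distinct_card strict_sorted_iff)
      have srt: "sorted_list_of_set (set I) = I" "sorted_list_of_set (set J) = J"
        using IJ(1,2) by (simp_all add: strict_sorted_iff sorted_list_of_set.idem_if_sorted_distinct)
      show "P (minor ?A I J)"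
      proof (cases "I = []")
        case True
        then show ?thesis using IJ(5) assms by (simp add: minor_def col_det_def)
      next
        case False
        then have "P (det (submatrix ?T (set I) (set J)))"
          using L IJ card unfolding dims by simp
        then show ?thesis using eq[of "set I" "set J"] IJ card srt by simp
      qed
    qed
  next
    assume R: ?R
    show ?L unfolding dims
    proof (intro allI impI, elim conjE)
      fix I J assume IJ: "I \<subseteq> {..i}" "J \<subseteq> {..d - i}" "card I = card J"
      have fin: "finite I" "finite J" using IJ finite_subset by blast+
      show "P (det (submatrix ?T I J))" unfolding eq[OF IJ]
        by (rule minors_satisfyD[OF R]) (use IJ fin in auto)
    qed
  qed
qed

theorem theorem1:
  fixes d s :: nat and F :: "real poly poly"
  assumes "F \<in> forms d" and "F \<noteq> 0" and "s = sperner d F"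
  shows "(totally_positive (toeplitz d (s - 1) F) \<longleftrightarrow>
            (\<forall>X Y. X \<ge> 0 \<and> Y \<ge> 0 \<and> (X, Y) \<noteq> (0, 0) \<longrightarrow>
               (\<forall>i. 0 \<le> i \<and> i \<le> s - 1 \<longrightarrow> bieval (hess F i) X Y > 0))) \<and>
         (totally_nonnegative (toeplitz d (s - 1) F) \<longleftrightarrow>
            (\<forall>X Y. X > 0 \<and> Y > 0 \<longrightarrow>
               (\<forall>i. 0 \<le> i \<and> i \<le> s - 1 \<longrightarrow> bieval (hess F i) X Y > 0)))"
proof -
  interpret apolar d F using assms(1,2) by unfold_locales
  let ?c = "normalized_coeff d F" and ?N = "d - (s - 1)"
  have s: "s \<ge> 1" "2 * s \<le> Suc (Suc d)"
    using sperner_pos sperner_le assms(3) by auto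
  have rec: "s \<le> d \<Longrightarrow> \<exists>g. (\<exists>j\<le>s. g j \<noteq> 0) \<and> (\<forall>q. q + s \<le> d \<longrightarrow> (\<Sum>j\<le>s. g j * ?c (q + j)) = 0)"
    using sperner_recurrence unfolding assms(3) by blast
  have hess: "bieval (hess F i) X Y > 0 \<longleftrightarrow> hessian_det ?c d i ([:Y, X:] ^ (d - 2 * i)) > 0" if "i \<le> s - 1" for i X Y
  proof -
    have "2 * i \<le> d" using that s by auto
    moreover have "(fact d / fact (d - 2 * i) :: real) ^ Suc i > 0" by (intro zero_less_power divide_pos_pos) simp_all
    ultimately show ?thesis unfolding bieval_hess[OF assms(1) \<open>2 * i \<le> d\<close>] by (metis mult_pos_pos zero_less_mult_pos)
  qed
  have tp: "totally_positive (toeplitz d (s - 1) F) \<longleftrightarrow> minors_satisfy (\<lambda>z. z > 0) (toep_entry ?c (s - 1)) (s - 1) ?N"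
    unfolding totally_positive_def by (rule minors_satisfy_submatrix) simp
  have tnn: "totally_nonnegative (toeplitz d (s - 1) F) \<longleftrightarrow> minors_satisfy (\<lambda>z. z \<ge> 0) (toep_entry ?c (s - 1)) (s - 1) ?N"
    unfolding totally_nonnegative_def by (rule minors_satisfy_submatrix) simp
  have rank: "\<exists>J. sorted_wrt (<) J \<and> set J \<subseteq> {..?N} \<and> length J = r \<and> minor (toep_entry ?c (s - 1)) [0..<r] J \<noteq> 0"
    if "r \<le> s" for r
  proof (rule full_row_rank_minor[OF _ that])
    fix a p assume a: "\<And>j. j \<le> ?N \<Longrightarrow> (\<Sum>p<s. a p * toep_entry ?c (s - 1) p j) = 0" and p: "p < s"
    \<comment> \<open>row \<open>p\<close> of the Toeplitz matrix belongs to the coefficient \<open>s - 1 - p\<close> of a recurrence\<close>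
    have "a (s - 1 - (s - 1 - p)) = 0"
    proof (rule no_short_recurrence[of "\<lambda>k. a (s - 1 - k)"], unfold assms(3)[symmetric])
      fix q assume "q + (s - 1) \<le> d"
      have "(\<Sum>k\<le>s - 1. a (s - 1 - k) * ?c (q + k)) = (\<Sum>p<s. a p * toep_entry ?c (s - 1) p q)"
        using s(1) by (intro sum.reindex_bij_witness[of _ "\<lambda>k. s - 1 - k" "\<lambda>k. s - 1 - k"])
          (auto simp: toep_entry_def intro!: arg_cong[where f = ?c])
      then show "(\<Sum>k\<le>s - 1. a (s - 1 - k) * ?c (q + k)) = 0"
        using a[of q] \<open>q + (s - 1) \<le> d\<close> by simp
    qed simp
    then show "a p = 0" using p by simp
  qed
  have tp_t: "minors_satisfy (\<lambda>z. z > 0) (toep_entry (cone_seq ?c d t) (s - 1)) (s - 1) ?N"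
    if t: "0 \<le> t" "t < 1"
      and pos: "\<And>X Y i. t \<le> X \<Longrightarrow> t \<le> Y \<Longrightarrow> (X, Y) \<noteq> (0, 0) \<Longrightarrow> i \<le> s - 1 \<Longrightarrow> bieval (hess F i) X Y > 0" for t
  proof (rule cone_seq_totally_positive[OF s t _ _ rec _ t(2)])
    show "hessian_det ?c d i ([:t', 1:] ^ (d - 2 * i)) > 0" "hessian_det ?c d i ([:1, t':] ^ (d - 2 * i)) > 0"
      if "i < s" "t \<le> t'" "t' \<le> 1" for i t'
      using that t hess[of i] pos[of 1 t' i] pos[of t' 1 i] by auto
  qed (use s in auto)
  show ?thesis
  proof (intro conjI iffI allI impI)
    fix X Y :: real and i
    assume "totally_positive (toeplitz d (s - 1) F)" "X \<ge> 0 \<and> Y \<ge> 0 \<and> (X, Y) \<noteq> (0, 0)" "0 \<le> i \<and> i \<le> s - 1"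
    then show "bieval (hess F i) X Y > 0"
      unfolding tp using s hess[of i X Y] hessian_det_pos_of_totally_positive[of i s d ?c X Y] by auto
  next
    assume pos: "\<forall>X Y. X \<ge> 0 \<and> Y \<ge> 0 \<and> (X, Y) \<noteq> (0, 0) \<longrightarrow> (\<forall>i. 0 \<le> i \<and> i \<le> s - 1 \<longrightarrow> bieval (hess F i) X Y > 0)"
    have "minors_satisfy (\<lambda>z. z > 0) (toep_entry (cone_seq ?c d 0) (s - 1)) (s - 1) ?N"
    proof (rule tp_t)
      show "bieval (hess F i) X Y > 0" if "0 \<le> X" "0 \<le> Y" "(X, Y) \<noteq> (0, 0)" "i \<le> s - 1" for X Y i
        by (rule pos[rule_format]) (intro conjI that le0)+
    qed simp_all
    then show "totally_positive (toeplitz d (s - 1) F)"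
      unfolding tp by (rule minors_satisfy_cone_seq_0) (use s in linarith)
  next
    fix X Y :: real and i
    assume a: "totally_nonnegative (toeplitz d (s - 1) F)" "X > 0 \<and> Y > 0" "0 \<le> i \<and> i \<le> s - 1"
    then have i: "i < s" using s by simp
    obtain J where "sorted_wrt (<) J" "set J \<subseteq> {..?N}" "length J = Suc i" "minor (toep_entry ?c (s - 1)) [0..<Suc i] J \<noteq> 0"
      using rank[of "Suc i"] i by auto
    moreover have "sorted_wrt (<) [0..<Suc i]" "set [0..<Suc i] \<subseteq> {..s - 1}" "length [0..<Suc i] = Suc i"
      using i by (auto simp del: upt_Suc)
    ultimately have "\<exists>I J. sorted_wrt (<) I \<and> set I \<subseteq> {..s - 1} \<and> length I = Suc i \<and>
      sorted_wrt (<) J \<and> set J \<subseteq> {..?N} \<and> length J = Suc i \<and> minor (toep_entry ?c (s - 1)) I J \<noteq> 0"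
      by blast
    then show "bieval (hess F i) X Y > 0"
      using a s i hess[of i X Y] hessian_det_pos_of_totally_nonnegative[of i s d ?c X Y] unfolding tnn by auto
  next
    assume pos: "\<forall>X Y. X > 0 \<and> Y > 0 \<longrightarrow> (\<forall>i. 0 \<le> i \<and> i \<le> s - 1 \<longrightarrow> bieval (hess F i) X Y > 0)"
    have "minors_satisfy (\<lambda>z. z \<ge> 0) (toep_entry (cone_seq ?c d 0) (s - 1)) (s - 1) ?N"
    proof (rule minors_nonneg_limit[of 0 1])
      fix t :: real assume "0 < t" "t < 1"
      show "minors_satisfy (\<lambda>z. z > 0) (toep_entry (cone_seq ?c d t) (s - 1)) (s - 1) ?N"
      proof (rule tp_t)
        show "bieval (hess F i) X Y > 0" if "t \<le> X" "t \<le> Y" "i \<le> s - 1" for X Y i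
        proof (rule pos[rule_format])
          show "X > 0 \<and> Y > 0" using that \<open>0 < t\<close> by linarith
        qed (use that in simp)
      qed (use \<open>0 < t\<close> \<open>t < 1\<close> in simp_all)
    qed simp
    then show "totally_nonnegative (toeplitz d (s - 1) F)"
      unfolding tnn by (rule minors_satisfy_cone_seq_0) (use s in linarith)
  qed
qed

end
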